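(* (i) Let $M$ be a finitely generated left preGarside monoid with an additive and homogeneous norm $\nu$, and let $\varphi\in\mathrm{End}(M)$ be such that the morphism $\pi=\pi_{S_2}$ is well-defined. Then $\mathrm{Fix}(\varphi)$ and $\mathrm{Per}(\varphi)$ are also finitely generated left preGarside monoids. (ii) Let $M$ be an Artin monoid and let $\varphi\in\mathrm{End}(M)$. Then $\mathrm{Fix}(\varphi)$ and $\mathrm{Per}(\varphi)$ are also Artin monoids.
   Context: For a monoid $M$ and a monoid endomorphism $\varphi\in\mathrm{End}(M)$: $\mathrm{Fix}(\varphi)=\{x\in M:\varphi(x)=x\}$ and $\mathrm{Per}(\varphi)=\bigcup_{n\ge 1}\mathrm{Fix}(\varphi^n)$ (submonoids of $M$). For $a,b\in M$, $a\preceq b$ means $b=ac$ for some $c\in M$. $M$ is atomic if there is a map $\nu:M\to\mathbb{N}$ (a norm) with $\nu(a)>0$ for $a\ne1$ and $\nu(ab)\ge\nu(a)+\nu(b)$ for all $a,b\in M$. The norm $\nu$ is additive if $\nu(ab)=\nu(a)+\nu(b)$ for all $a,b$. An atom is an element $a\neq 1$ such that $a=bc$ implies $b=1$ or $c=1$; $\mathcal{S}(M)$ is the set of atoms (it generates an atomic monoid $M$, and $M$ is finitely generated iff $\mathcal S(M)$ is finite). The norm $\nu$ is homogeneous if $\nu(a)=\nu(b)$ for all atoms $a,b$. $M$ is left preGarside if it is atomic, left cancellative ($ca=cb\Rightarrow a=b$), and for all $a,b\in M$, if $\{c\in M: a\preceq c\text{ and }b\preceq c\}$ is nonempty then it has a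 least element for $\preceq$. For a submonoid, these notions are taken inside the submonoid. The morphism $\pi$: let $S=\mathcal{S}(M)$ (finite). Put $n_\varphi=\max\{k\ge1:\exists s\in S,\ \varphi^k(s)=1\text{ and }\varphi^{k-1}(s)\ne1\}$ if $1\in\varphi(S)$, and $n_\varphi=1$ if $1\notin\varphi(S)$. Put $S_1=\{s\in S:\varphi^{n_\varphi}(s)=1\}$ and $S_2=S\setminus S_1$. Let $\pi^*_{S_2}:S^*\to S_2^*$ be the morphism of free monoids with $t\mapsto t$ for $t\in S_2$ and $t\mapsto\varepsilon$ (empty word) for $t\in S\setminus S_2$. The morphism $\pi=\pi_{S_2}:M\to M$ is well-defined if $\pi^*_{S_2}$ induces a monoid morphism $M\to M$, i.e. whenever two words over $S$ represent the same element of $M$, so do their images under $\pi^*_{S_2}$. Artin monoid: a monoid with presentation $\langle S\mid [a,b\rangle^{m_{ab}}=[b,a\rangle^{m_{ab}},\ m_{ab}\ne\infty\rangle^+$, where $S$ is a finite set, $(m_{ab})_{a,b\in S}$ is a symmetric matrix with entries in $\{1,2,\dots,\infty\}$, $m_{aa}=1$, $m_{ab}\ge2$ for $a\ne b$, and $[a,b\rangle^m$ is the alternating product $aba\cdots$ with $m$ factors. The trivial monoid ($S=\emptyset$) is counted as an Artin monoid. *)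

theory Defs
  imports "HOL-Algebra.Divisibility" "HOL-Library.Extended_Nat"
begin

section \<open>Endomorphisms, fixed points and periodic points\<close>

text \<open>\<^const>\<open>hom\<close> only asks for multiplicativity, so preservation of the unit is added.\<close>

definition monoid_End :: "('a, 'm) monoid_scheme \<Rightarrow> ('a \<Rightarrow> 'a) set" where
  "monoid_End M = {\<phi> \<in> hom M M. \<phi> \<one>\<^bsub>M\<^esub> = \<one>\<^bsub>M\<^esub>}"

definition Fix :: "('a, 'm) monoid_scheme \<Rightarrow> ('a \<Rightarrow> 'a) \<Rightarrow> 'a set" where
  "Fix M \<phi> = {x \<in> carrier M. \<phi> x = x}"

definition Per :: "('a, 'm) monoid_scheme \<Rightarrow> ('a \<Rightarrow> 'a) \<Rightarrow> 'a set" where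
  "Per M \<phi> = (\<Union>n\<in>{1..}. Fix M (\<phi> ^^ n))"

section \<open>Left preGarside monoids\<close>

definition monoid_norm :: "('a, 'm) monoid_scheme \<Rightarrow> ('a \<Rightarrow> nat) \<Rightarrow> bool" where
  "monoid_norm M \<nu> \<longleftrightarrow>
     (\<forall>a\<in>carrier M. a \<noteq> \<one>\<^bsub>M\<^esub> \<longrightarrow> \<nu> a > 0) \<and>
     (\<forall>a\<in>carrier M. \<forall>b\<in>carrier M. \<nu> (a \<otimes>\<^bsub>M\<^esub> b) \<ge> \<nu> a + \<nu> b)"

definition additive_norm :: "('a, 'm) monoid_scheme \<Rightarrow> ('a \<Rightarrow> nat) \<Rightarrow> bool" where
  "additive_norm M \<nu> \<longleftrightarrow> monoid_norm M \<nu> \<and>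
     (\<forall>a\<in>carrier M. \<forall>b\<in>carrier M. \<nu> (a \<otimes>\<^bsub>M\<^esub> b) = \<nu> a + \<nu> b)"

definition atomic_monoid :: "('a, 'm) monoid_scheme \<Rightarrow> bool" where
  "atomic_monoid M \<longleftrightarrow> monoid M \<and> (\<exists>\<nu>. monoid_norm M \<nu>)"

definition atoms :: "('a, 'm) monoid_scheme \<Rightarrow> 'a set" where
  "atoms M = {a \<in> carrier M. a \<noteq> \<one>\<^bsub>M\<^esub> \<and>
     (\<forall>b\<in>carrier M. \<forall>c\<in>carrier M. a = b \<otimes>\<^bsub>M\<^esub> c \<longrightarrow> b = \<one>\<^bsub>M\<^esub> \<or> c = \<one>\<^bsub>M\<^esub>)}"

definition homogeneous_norm :: "('a, 'm) monoid_scheme \<Rightarrow> ('a \<Rightarrow> nat) \<Rightarrow> bool" where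
  "homogeneous_norm M \<nu> \<longleftrightarrow> monoid_norm M \<nu> \<and> (\<forall>a\<in>atoms M. \<forall>b\<in>atoms M. \<nu> a = \<nu> b)"

text \<open>The order $a \preceq b$ is \<^const>\<open>factor\<close> (left divisibility, no commutativity involved),
  and \<^const>\<open>islcm\<close> says that an element is the least common upper bound for it.\<close>

definition left_preGarside :: "('a, 'm) monoid_scheme \<Rightarrow> bool" where
  "left_preGarside M \<longleftrightarrow> atomic_monoid M \<and>
     (\<forall>a\<in>carrier M. \<forall>b\<in>carrier M. \<forall>c\<in>carrier M.
        c \<otimes>\<^bsub>M\<^esub> a = c \<otimes>\<^bsub>M\<^esub> b \<longrightarrow> a = b) \<and>
     (\<forall>a\<in>carrier M. \<forall>b\<in>carrier M.
        {c \<in> carrier M. a divides\<^bsub>M\<^esub> c \<and> b divides\<^bsub>M\<^esub> c} \<noteq> {} \<longrightarrow>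
        (\<exists>m\<in>carrier M. m lcmof\<^bsub>M\<^esub> a b))"

definition word_eval :: "('a, 'm) monoid_scheme \<Rightarrow> 'a list \<Rightarrow> 'a" where
  "word_eval M w = foldr (\<otimes>\<^bsub>M\<^esub>) w \<one>\<^bsub>M\<^esub>"

definition fin_gen_monoid :: "('a, 'm) monoid_scheme \<Rightarrow> bool" where
  "fin_gen_monoid M \<longleftrightarrow> monoid M \<and>
     (\<exists>A. finite A \<and> A \<subseteq> carrier M \<and> carrier M = word_eval M ` lists A)"

section \<open>The morphism deleting the eventually killed atoms\<close>

definition n_index :: "('a, 'm) monoid_scheme \<Rightarrow> ('a \<Rightarrow> 'a) \<Rightarrow> nat" where
  "n_index M \<phi> =
     (if \<one>\<^bsub>M\<^esub> \<in> \<phi> ` atoms M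
      then Max {k. k \<ge> 1 \<and> (\<exists>s\<in>atoms M. (\<phi> ^^ k) s = \<one>\<^bsub>M\<^esub> \<and> (\<phi> ^^ (k - 1)) s \<noteq> \<one>\<^bsub>M\<^esub>)}
      else 1)"

definition S1 :: "('a, 'm) monoid_scheme \<Rightarrow> ('a \<Rightarrow> 'a) \<Rightarrow> 'a set" where
  "S1 M \<phi> = {s \<in> atoms M. (\<phi> ^^ n_index M \<phi>) s = \<one>\<^bsub>M\<^esub>}"

definition S2 :: "('a, 'm) monoid_scheme \<Rightarrow> ('a \<Rightarrow> 'a) \<Rightarrow> 'a set" where
  "S2 M \<phi> = atoms M - S1 M \<phi>"

definition pi_word :: "'a set \<Rightarrow> 'a list \<Rightarrow> 'a list" where
  "pi_word T w = filter (\<lambda>t. t \<in> T) w"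

definition pi_well_defined :: "('a, 'm) monoid_scheme \<Rightarrow> 'a set \<Rightarrow> bool" where
  "pi_well_defined M T \<longleftrightarrow>
     (\<forall>u\<in>lists (atoms M). \<forall>v\<in>lists (atoms M).
        word_eval M u = word_eval M v \<longrightarrow>
        word_eval M (pi_word T u) = word_eval M (pi_word T v))"

section \<open>Monoid presentations and Artin monoids\<close>

inductive pres_cong :: "'b set \<Rightarrow> ('b list \<times> 'b list) set \<Rightarrow> 'b list \<Rightarrow> 'b list \<Rightarrow> bool"
  for X R where
  rel: "(l, r) \<in> R \<Longrightarrow> l \<in> lists X \<Longrightarrow> r \<in> lists X \<Longrightarrow> pres_cong X R l r"
| refl: "w \<in> lists X \<Longrightarrow> pres_cong X R w w"
| sym: "pres_cong X R u v \<Longrightarrow> pres_cong X R v u"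
| trans: "pres_cong X R u v \<Longrightarrow> pres_cong X R v w \<Longrightarrow> pres_cong X R u w"
| mult: "pres_cong X R u v \<Longrightarrow> pres_cong X R u' v' \<Longrightarrow> pres_cong X R (u @ u') (v @ v')"

definition pres_rel :: "'b set \<Rightarrow> ('b list \<times> 'b list) set \<Rightarrow> ('b list \<times> 'b list) set" where
  "pres_rel X R = {(u, v). pres_cong X R u v}"

definition presented_monoid :: "'b set \<Rightarrow> ('b list \<times> 'b list) set \<Rightarrow> 'b list set monoid" where
  "presented_monoid X R =
     \<lparr>carrier = lists X // pres_rel X R,
      mult = (\<lambda>A B. \<Union>u\<in>A. \<Union>v\<in>B. pres_rel X R `` {u @ v}),
      one = pres_rel X R `` {[]}\<rparr>"

fun alt_word :: "'b \<Rightarrow> 'b \<Rightarrow> nat \<Rightarrow> 'b list" where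
  "alt_word a b 0 = []"
| "alt_word a b (Suc n) = a # alt_word b a n"

definition coxeter_matrix :: "'b set \<Rightarrow> ('b \<Rightarrow> 'b \<Rightarrow> enat) \<Rightarrow> bool" where
  "coxeter_matrix S m \<longleftrightarrow>
     (\<forall>a\<in>S. \<forall>b\<in>S. m a b = m b a) \<and>
     (\<forall>a\<in>S. m a a = 1) \<and>
     (\<forall>a\<in>S. \<forall>b\<in>S. a \<noteq> b \<longrightarrow> m a b \<ge> 2)"

definition artin_relations :: "'b set \<Rightarrow> ('b \<Rightarrow> 'b \<Rightarrow> enat) \<Rightarrow> ('b list \<times> 'b list) set" where
  "artin_relations S m =
     {(alt_word a b k, alt_word b a k) | a b k. a \<in> S \<and> b \<in> S \<and> m a b = enat k}"

text \<open>Generators are labelled by natural numbers; since the generating set is finite, this is no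
  restriction. The empty set of generators gives the trivial monoid. Being a monoid is required
  separately because \<open>\<cong>\<close> says nothing about the unit of a structure not known to be a monoid.\<close>

definition artin_monoid :: "('a, 'm) monoid_scheme \<Rightarrow> bool" where
  "artin_monoid M \<longleftrightarrow> monoid M \<and>
     (\<exists>(S :: nat set) m. finite S \<and> coxeter_matrix S m \<and>
        M \<cong> presented_monoid S (artin_relations S m))"

end

theory Submission
  imports Defs Complex_Main
begin

text \<open>Let \<open>\<phi>\<close> be an endomorphism of \<open>M\<close>.

\<^bold>\<open>Least common multiples of fixed points.\<close> By left cancellation, divisibility between fixed
points is the same in \<open>M\<close> and in \<open>Fix \<phi>\<close>. If \<open>a\<close>, \<open>b\<close> are fixed and have a fixed common multiple
\<open>c\<close>, then their lcm \<open>m\<close> satisfies \<open>m \<preceq> \<phi> m \<preceq> \<phi>\<^sup>2 m \<preceq> \<dots> \<preceq> c\<close>; the norm of \<open>c\<close> bounds the chain,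
so it becomes stationary, and its last term is the lcm inside \<open>Fix \<phi>\<close> (\<open>left_preGarside_Fix\<close>).

\<^bold>\<open>Periodic points.\<close> Deleting the atoms that \<open>\<phi>\<close> eventually kills is an endomorphism \<open>\<pi>\<close>, and
\<open>\<psi> = \<pi> \<circ> \<phi>\<close> sends no surviving atom to \<open>1\<close>. With an additive homogeneous norm, \<open>\<psi>\<close> can
therefore never shorten a word in the surviving atoms, so on a \<open>\<psi>\<close>-periodic element it merely maps
letters to letters. Hence \<open>\<pi>\<close> identifies \<open>Per \<phi>\<close> with the submonoid generated by a set \<open>T\<close> of atoms
that some power of \<open>\<psi>\<close> fixes, and \<open>Per \<phi> = Fix (\<phi>\<^sup>N)\<close> for one exponent \<open>N\<close> (\<open>Per_structure\<close>).
On \<open>Per \<phi>\<close> the map \<open>\<phi>\<close> has finite order, and a fixed point divisible by an atom is divisible by the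
lcm of the orbit of that atom. These finitely many lcms generate \<open>Fix \<phi>\<close>
(\<open>Fix_generated_by_orbit_lubs\<close>), which gives part (i).

\<^bold>\<open>Artin monoids are left preGarside.\<close> The Coxeter group enters through the dual of its
geometric representation: words act on real functions on the generators, and the sign at \<open>s\<close> of
the image of the constant function \<open>1\<close> tells whether the letter \<open>s\<close> lengthens or shortens a shortest
word for this image. This yields Matsumoto's theorem and identifies the reduced words with the
words that no braid relations can bring into a form with a repeated adjacent letter
(\<open>squarefree_iff_reduced\<close>). With squarefree words as a supply of elements whose divisors are
understood, the argument of Brieskorn and Saito applies without any classification: if
\<open>a x = b y\<close>, then \<open>x\<close> and \<open>y\<close> come from the relation between \<open>a\<close> and \<open>b\<close>
(\<open>braid_heads_agree\<close>). Left cancellation and lcms follow from it.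

\<^bold>\<open>Part (ii).\<close> For an endomorphism of an Artin monoid, \<open>\<pi>\<close> is always well defined: an atom joined by
an odd relation to a killed atom is itself killed. So \<open>Per \<phi>\<close> is isomorphic to a parabolic submonoid,
and this is Artin. For \<open>Fix \<phi>\<close>, the lcm of two generators \<open>d\<close>, \<open>e\<close> (lcms of orbits)
is the lcm of a set of atoms, hence squarefree; so neither \<open>d d\<close> nor \<open>e e\<close> occurs in it and it is an
alternating product of \<open>d\<close> and \<open>e\<close>, starting with either of them, and lengths force
the two alternating products to have equally many factors (\<open>orbit_lubs_alternating\<close>). A left preGarside monoid
whose generators have such lcms is Artin (\<open>artin_on_if_alternating_lcms\<close>).\<close>

section \<open>Alternating words\<close>

lemma length_alt_word [simp]: "length (alt_word a b k) = k"
  by (induction k arbitrary: a b) auto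

lemma set_alt_word_subset: "set (alt_word a b k) \<subseteq> {a, b}"
proof (induction k arbitrary: a b)
  case (Suc k)
  show ?case using Suc[of b a] by auto
qed simp

lemma alt_word_in_lists: "a \<in> X \<Longrightarrow> b \<in> X \<Longrightarrow> alt_word a b k \<in> lists X"
  using set_alt_word_subset[of a b k] by auto

lemma alt_word_add:
  "alt_word a b (i + j) = alt_word a b i @ (if even i then alt_word a b j else alt_word b a j)"
  by (induction i arbitrary: a b) auto

lemma alt_word_snoc: "alt_word a b (Suc k) = alt_word a b k @ [if even k then a else b]"
  using alt_word_add[of a b k 1] by simp

lemma rev_alt_word: "rev (alt_word a b k) = (if odd k then alt_word a b k else alt_word b a k)"
proof (induction k arbitrary: a b)
  case (Suc k)
  show ?case
  proof (cases "even k")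
    case True
    then show ?thesis using alt_word_snoc[of a b k] by (simp add: Suc)
  next
    case False
    then show ?thesis using alt_word_snoc[of b a k] by (simp add: Suc)
  qed
qed simp

text \<open>Over two letters, avoiding a repeated adjacent letter leaves no choice after the first letter.\<close>

lemma alternating_is_alt_word:
  assumes "set u \<subseteq> {s, t}" "\<nexists>x c y. u = x @ [c, c] @ y"
  shows "u = alt_word s t (length u) \<or> u = alt_word t s (length u)"
  using assms
proof (induction u)
  case (Cons a u)
  have "\<nexists>x c y. u = x @ [c, c] @ y"
    using Cons.prems(2) by (metis append_Cons)
  with Cons have IH: "u = alt_word s t (length u) \<or> u = alt_word t s (length u)" by auto
  show ?case
  proof (cases u)
    case Nil
    then show ?thesis using Cons.prems by auto
  next
    case (Cons b v)
    have "a \<noteq> b" using Cons.prems(2) \<open>u = b # v\<close> by (metis append_Cons append_Nil)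
    moreover have "a \<in> {s, t}" "b \<in> {s, t}" using Cons.prems(1) \<open>u = b # v\<close> by auto
    ultimately have "a = s \<and> b = t \<or> a = t \<and> b = s" by auto
    then show ?thesis using IH \<open>u = b # v\<close> by auto
  qed
qed simp

lemma map_alt_word: "map f (alt_word a b k) = alt_word (f a) (f b) k"
  by (induction k arbitrary: a b) auto

section \<open>A recurrence for dihedral reflections\<close>

text \<open>Chebyshev polynomials of the second kind, as functions of \<open>c = 2 cos x\<close> and with the index shifted
by one. Their values are the coordinates of the roots of a dihedral group; the
boundary value \<open>c = 2\<close> belongs to the infinite dihedral group.\<close>

fun cheb :: "real \<Rightarrow> nat \<Rightarrow> real" where
  "cheb c 0 = 0"
| "cheb c (Suc 0) = 1"
| "cheb c (Suc (Suc k)) = c * cheb c (Suc k) - cheb c k"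

lemma cheb_2: "cheb 2 k = real k"
  by (induction "2 :: real" k rule: cheb.induct) auto

lemma cheb_cos: "sin x * cheb (2 * cos x) k = sin (real k * x)"
proof (induction "2 * cos x" k rule: cheb.induct)
  case (3 k)
  have e1: "real (Suc (Suc k)) * x = real (Suc k) * x + x" by (simp add: algebra_simps)
  have e2: "real k * x = real (Suc k) * x - x" by (simp add: algebra_simps)
  have "sin x * cheb (2 * cos x) (Suc (Suc k))
      = 2 * cos x * (sin x * cheb (2 * cos x) (Suc k)) - sin x * cheb (2 * cos x) k"
    by (simp add: algebra_simps)
  also have "\<dots> = 2 * cos x * sin (real (Suc k) * x) - sin (real k * x)"
    using 3 by simp
  also have "\<dots> = sin (real (Suc (Suc k)) * x)"
    unfolding e1 e2 sin_add sin_diff by (simp add: algebra_simps)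
  finally show ?case .
qed auto

section \<open>The dual geometric action of an Artin presentation\<close>

locale coxeter =
  fixes S :: "'b set" and m :: "'b \<Rightarrow> 'b \<Rightarrow> enat"
  assumes coxeter: "coxeter_matrix S m"
begin

lemma m_sym: "a \<in> S \<Longrightarrow> b \<in> S \<Longrightarrow> m a b = m b a"
  and m_refl: "a \<in> S \<Longrightarrow> m a a = 1"
  and m_ge2: "a \<in> S \<Longrightarrow> b \<in> S \<Longrightarrow> a \<noteq> b \<Longrightarrow> m a b \<ge> 2"
  using coxeter by (auto simp: coxeter_matrix_def)

lemma m_enat_ge2:
  assumes "a \<in> S" "b \<in> S" "a \<noteq> b" "m a b = enat k"
  shows "k \<ge> 2"
proof -
  have "(2 :: enat) \<le> enat k" using m_ge2[OF assms(1-3)] assms(4) by simp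
  then show ?thesis by (simp add: numeral_eq_enat)
qed

abbreviation braid_eq :: "'b list \<Rightarrow> 'b list \<Rightarrow> bool" (infix "\<approx>" 50) where
  "u \<approx> v \<equiv> pres_cong S (artin_relations S m) u v"

lemma braid_in_lists: "u \<approx> v \<Longrightarrow> u \<in> lists S \<and> v \<in> lists S"
  by (induction rule: pres_cong.induct) auto

lemma braid_length: "u \<approx> v \<Longrightarrow> length u = length v"
  by (induction rule: pres_cong.induct) (auto simp: artin_relations_def)

lemma braid_alt:
  assumes "a \<in> S" "b \<in> S" "m a b = enat k"
  shows "alt_word a b k \<approx> alt_word b a k"
  using assms by (intro pres_cong.rel) (auto simp: artin_relations_def alt_word_in_lists in_listsI)

lemma braid_append_left: "w \<in> lists S \<Longrightarrow> u \<approx> v \<Longrightarrow> w @ u \<approx> w @ v"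
  by (rule pres_cong.mult) (auto intro: pres_cong.refl)

lemma braid_append_right: "w \<in> lists S \<Longrightarrow> u \<approx> v \<Longrightarrow> u @ w \<approx> v @ w"
  by (rule pres_cong.mult) (auto intro: pres_cong.refl)

lemma braid_Cons: "a \<in> S \<Longrightarrow> u \<approx> v \<Longrightarrow> a # u \<approx> a # v"
  using braid_append_left[of "[a]" u v] by simp

lemma braid_rev: "u \<approx> v \<Longrightarrow> rev u \<approx> rev v"
proof (induction rule: pres_cong.induct)
  case (rel l r)
  then obtain a b k where ab: "l = alt_word a b k" "r = alt_word b a k" "a \<in> S" "b \<in> S" "m a b = enat k"
    by (auto simp: artin_relations_def)
  have "alt_word a b k \<approx> alt_word b a k" "alt_word b a k \<approx> alt_word a b k"
    using braid_alt[of a b k] braid_alt[of b a k] ab m_sym by auto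
  then show ?case unfolding ab rev_alt_word by auto
next
  case (refl w) then show ?case by (intro pres_cong.refl) auto
next
  case (sym u v) then show ?case by (blast intro: pres_cong.sym)
next
  case (trans u v w) then show ?case by (blast intro: pres_cong.trans)
next
  case (mult u v u' v') then show ?case by (simp add: pres_cong.mult)
qed

text \<open>For \<open>a \<noteq> b\<close>, minus twice the bilinear form of the geometric representation of the Coxeter group at the
simple roots of \<open>a\<close> and \<open>b\<close>.\<close>

definition edge :: "'b \<Rightarrow> 'b \<Rightarrow> real" where
  "edge a b = (case m a b of enat k \<Rightarrow> 2 * cos (pi / real k) | \<infinity> \<Rightarrow> 2)"

lemma edge_sym: "a \<in> S \<Longrightarrow> b \<in> S \<Longrightarrow> edge a b = edge b a"
  by (simp add: edge_def m_sym)

lemma cheb_edge_pos: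
  assumes "a \<in> S" "b \<in> S" "a \<noteq> b" "0 < k" "enat k < m a b"
  shows "cheb (edge a b) k > 0"
proof (cases "m a b")
  case (enat n)
  then have n: "n \<ge> 2" "k < n" using m_enat_ge2[OF assms(1-3)] assms(5) by auto
  have "0 < sin (pi / real n)" using n by (intro sin_gt_zero) (auto simp: field_simps)
  moreover have "0 < sin (real k * (pi / real n))" using n assms(4)
    by (intro sin_gt_zero) (auto simp: field_simps)
  ultimately have "0 < cheb (2 * cos (pi / real n)) k"
    unfolding cheb_cos[symmetric] by (rule zero_less_mult_pos[rotated])
  then show ?thesis by (simp add: edge_def enat)
qed (simp add: edge_def cheb_2 assms)

text \<open>The sine at \<open>\<pi> - \<pi>/k\<close>, \<open>\<pi>\<close> and \<open>\<pi> + \<pi>/k\<close>; these three values express that the two reflections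
generate a dihedral group of order \<open>2k\<close>.\<close>

lemma cheb_edge_period:
  assumes "a \<in> S" "b \<in> S" "a \<noteq> b" "m a b = enat k"
  shows "cheb (edge a b) k = 0" "cheb (edge a b) (k - 1) = 1" "cheb (edge a b) (Suc k) = - 1"
proof -
  have k: "k \<ge> 2" using m_enat_ge2 assms by blast
  let ?x = "pi / real k"
  have pos: "0 < sin ?x" using k by (intro sin_gt_zero) (auto simp: field_simps)
  have c: "edge a b = 2 * cos ?x" by (simp add: edge_def assms)
  have "real (k - 1) * ?x = pi - ?x" "real (Suc k) * ?x = ?x + pi" "real k * ?x = pi"
    using k by (auto simp: field_simps of_nat_diff)
  then have "sin (real (k - 1) * ?x) = sin ?x" "sin (real (Suc k) * ?x) = - sin ?x"
    "sin (real k * ?x) = 0"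
    by (simp_all only: sin_pi_minus sin_periodic_pi sin_pi)
  then have e: "sin ?x * cheb (edge a b) (k - 1) = sin ?x * 1"
     "sin ?x * cheb (edge a b) (Suc k) = sin ?x * (- 1)" "sin ?x * cheb (edge a b) k = sin ?x * 0"
    using cheb_cos[of ?x "k - 1"] cheb_cos[of ?x "Suc k"] cheb_cos[of ?x k] unfolding c by simp_all
  have "sin ?x \<noteq> 0" using pos by simp
  then show "cheb (edge a b) k = 0" "cheb (edge a b) (k - 1) = 1" "cheb (edge a b) (Suc k) = - 1"
    using e by (metis mult_left_cancel)+
qed

text \<open>The dual of the geometric representation: \<open>f s\<close> is the value of the functional \<open>f\<close> at the simple
root of \<open>s\<close>. A reflection then changes every coordinate by a multiple of a single one, instead of changing
one coordinate by a sum over all generators.\<close>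

definition reflect :: "'b \<Rightarrow> ('b \<Rightarrow> real) \<Rightarrow> 'b \<Rightarrow> real" where
  "reflect s f = (\<lambda>t. if t = s then - f s else f t + edge s t * f s)"

abbreviation act :: "'b list \<Rightarrow> ('b \<Rightarrow> real) \<Rightarrow> 'b \<Rightarrow> real" where
  "act w f \<equiv> foldr reflect w f"

lemma reflect_reflect [simp]: "reflect s (reflect s f) = f"
  by (rule ext) (simp add: reflect_def)

lemma reflect_inject: "reflect s f = reflect s g \<Longrightarrow> f = g"
  by (metis reflect_reflect)

text \<open>The value of \<open>f\<close> at the root that the alternating word of length \<open>k\<close> makes out of the simple root of
\<open>s\<close>. The coefficient with index \<open>Suc k\<close> belongs to \<open>s\<close> or to \<open>t\<close> depending on the last letter of the word,
hence on the parity of \<open>k\<close>.\<close>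

definition dihedral_form :: "'b \<Rightarrow> 'b \<Rightarrow> nat \<Rightarrow> ('b \<Rightarrow> real) \<Rightarrow> real" where
  "dihedral_form s t k f = (if even k
     then cheb (edge s t) (Suc k) * f s + cheb (edge s t) k * f t
     else cheb (edge s t) (Suc k) * f t + cheb (edge s t) k * f s)"

lemma act_alt_word_other:
  assumes "s \<in> S" "t \<in> S" "s \<noteq> t"
  shows "act (alt_word t s k) f s = dihedral_form s t k f"
  using assms
proof (induction k arbitrary: s t rule: less_induct)
  case (less k)
  consider "k = 0" | "k = 1" | j where "k = Suc (Suc j)"
    by (metis One_nat_def not0_implies_Suc)
  then show ?case
  proof cases
    case 3
    have 1: "act (alt_word t s j) f s = dihedral_form s t j f" using less 3 by simp
    have 2: "act (alt_word s t (Suc j)) f t = dihedral_form t s (Suc j) f"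
      by (rule less.IH) (use less.prems 3 in auto)
    have "act (alt_word t s k) f s
       = - act (alt_word t s j) f s + edge t s * act (alt_word s t (Suc j)) f t"
      using less.prems by (simp add: 3 reflect_def)
    also have "\<dots> = dihedral_form s t k f"
      unfolding 1 2 using less.prems edge_sym[of t s]
      by (simp add: dihedral_form_def 3 algebra_simps)
    finally show ?thesis .
  qed (use less.prems edge_sym[of t s] in \<open>auto simp: dihedral_form_def reflect_def\<close>)
qed

lemma act_alt_word_same:
  assumes "s \<in> S" "t \<in> S" "s \<noteq> t"
  shows "act (alt_word s t (Suc k)) f s = - dihedral_form s t k f"
  using act_alt_word_other[OF assms, of k f] by (simp add: reflect_def)

text \<open>A coordinate \<open>r\<close> outside of \<open>{s, t}\<close> accumulates contributions of both letters. The difference of the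
two alternating words is a multiple of \<open>cheb c k\<close>, which vanishes at \<open>k = m s t\<close>; this avoids summing the
contributions.\<close>

lemma act_alt_word_diff:
  assumes "s \<in> S" "t \<in> S" "s \<noteq> t" "r \<noteq> s" "r \<noteq> t"
  shows "act (alt_word s t k) f r - act (alt_word t s k) f r = cheb (edge s t) k *
     (if odd k then edge s r * f s - edge t r * f t else edge s r * f t - edge t r * f s)"
proof (induction k)
  case (Suc k)
  have "act (alt_word s t (Suc k)) f r - act (alt_word t s (Suc k)) f r
     = - (act (alt_word s t k) f r - act (alt_word t s k) f r)
       + edge s r * dihedral_form s t k f - edge t r * dihedral_form t s k f"
    using assms act_alt_word_other[of s t k f] act_alt_word_other[of t s k f]
    by (simp add: reflect_def)
  then show ?case unfolding Suc using edge_sym[OF assms(1,2)]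
    by (auto simp: dihedral_form_def algebra_simps)
qed simp

lemma act_braid_relation:
  assumes "a \<in> S" "b \<in> S" "m a b = enat k"
  shows "act (alt_word a b k) f = act (alt_word b a k) f"
proof (cases "a = b")
  case False
  have k: "k \<ge> 2" using m_enat_ge2 assms False by blast
  then obtain j where j: "k = Suc j" by (cases k) auto
  note per = cheb_edge_period[OF assms(1,2) False assms(3)]
  have sym: "edge b a = edge a b" using edge_sym assms by simp
  show ?thesis
  proof
    fix r
    have a: "act (alt_word a b k) f a = act (alt_word b a k) f a"
      using act_alt_word_same[of a b j f] act_alt_word_other[of a b k f] assms False per
      by (auto simp: j dihedral_form_def simp del: cheb.simps alt_word.simps)
    have b: "act (alt_word a b k) f b = act (alt_word b a k) f b"
      using act_alt_word_same[of b a j f] act_alt_word_other[of b a k f] assms False per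
      by (auto simp: j dihedral_form_def sym simp del: cheb.simps alt_word.simps)
    show "act (alt_word a b k) f r = act (alt_word b a k) f r"
      using a b act_alt_word_diff[OF assms(1,2) False, of r k f] per(1) by fastforce
  qed
qed simp

lemma act_braid: "u \<approx> v \<Longrightarrow> act u f = act v f"
proof (induction arbitrary: f rule: pres_cong.induct)
  case (rel l r)
  then obtain a b k where "l = alt_word a b k" "r = alt_word b a k" "a \<in> S" "b \<in> S" "m a b = enat k"
    by (auto simp: artin_relations_def)
  then show ?case using act_braid_relation by metis
qed simp_all

text \<open>Before length \<open>m s t\<close> is reached, the roots obtained from a simple root are nonnegative
combinations of the two simple ones.\<close>

lemma dihedral_form_pos:
  assumes "s \<in> S" "t \<in> S" "s \<noteq> t" "enat k < m s t" "f s > 0" "f t > 0"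
  shows "dihedral_form s t k f > 0"
proof (cases "k = 0")
  case False
  have 1: "cheb (edge s t) k > 0" using cheb_edge_pos assms False by blast
  have "cheb (edge s t) (Suc k) \<ge> 0"
  proof (cases "enat (Suc k) < m s t")
    case True
    then show ?thesis using cheb_edge_pos[OF assms(1-3)] by (simp add: less_imp_le)
  next
    case False
    then have "m s t = enat (Suc k)" using assms(4) by (cases "m s t") auto
    then show ?thesis using cheb_edge_period[OF assms(1-3)] by simp
  qed
  then show ?thesis using 1 assms(5,6)
    by (auto simp: dihedral_form_def intro!: add_nonneg_pos mult_nonneg_nonneg mult_pos_pos)
qed (use assms in \<open>simp add: dihedral_form_def\<close>)

end

section \<open>Reduced words and Matsumoto's theorem\<close>

context coxeter
begin

text \<open>The orbit of the constant function \<open>1\<close>, a point inside the fundamental chamber, plays the part of the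
Coxeter group itself.\<close>

definition point :: "'b list \<Rightarrow> 'b \<Rightarrow> real" where
  "point w = act w (\<lambda>_. 1)"

definition depth :: "('b \<Rightarrow> real) \<Rightarrow> nat" where
  "depth p = (LEAST n. \<exists>w\<in>lists S. length w = n \<and> point w = p)"

definition reduced :: "'b list \<Rightarrow> bool" where
  "reduced w \<longleftrightarrow> w \<in> lists S \<and> length w = depth (point w)"

lemma point_Nil: "point [] = (\<lambda>_. 1)"
  by (simp add: point_def)

lemma point_Cons: "point (s # w) = reflect s (point w)"
  by (simp add: point_def)

lemma point_append: "point (u @ v) = act u (point v)"
  by (simp add: point_def)

lemma point_braid: "u \<approx> v \<Longrightarrow> point u = point v"
  by (simp add: point_def act_braid)

lemma depth_le: "w \<in> lists S \<Longrightarrow> depth (point w) \<le> length w"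
  unfolding depth_def by (rule Least_le) auto

lemma reduced_exists:
  assumes "w \<in> lists S"
  obtains v where "reduced v" "point v = point w"
proof -
  have "\<exists>v\<in>lists S. length v = depth (point w) \<and> point v = point w"
    unfolding depth_def by (rule LeastI_ex) (use assms in auto)
  then show ?thesis using that unfolding reduced_def by metis
qed

lemma depth_reflect_le:
  assumes "w \<in> lists S" "s \<in> S"
  shows "depth (reflect s (point w)) \<le> Suc (depth (point w))"
proof -
  obtain v where v: "reduced v" "point v = point w" using reduced_exists assms(1) .
  then have "depth (point (s # v)) \<le> length (s # v)"
    using assms(2) by (intro depth_le) (auto simp: reduced_def)
  then show ?thesis using v by (simp add: point_Cons reduced_def)
qed

lemma reduced_braid: "u \<approx> v \<Longrightarrow> reduced u \<Longrightarrow> reduced v"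
  using point_braid braid_length braid_in_lists by (metis reduced_def)

lemma reduced_tl: 
  assumes "reduced (s # w)"
  shows "reduced w"
proof -
  have w: "w \<in> lists S" "s \<in> S" using assms by (auto simp: reduced_def)
  have "Suc (length w) = depth (reflect s (point w))" using assms by (simp add: reduced_def point_Cons)
  also have "\<dots> \<le> Suc (depth (point w))" using depth_reflect_le[OF w] .
  finally show ?thesis using depth_le[OF w(1)] w by (simp add: reduced_def)
qed

lemma reduced_suffix: "reduced (u @ v) \<Longrightarrow> reduced v"
  by (induction u) (auto dest: reduced_tl)

lemma reduced_Cons_iff:
  assumes "reduced w" "s \<in> S"
  shows "reduced (s # w) \<longleftrightarrow> depth (reflect s (point w)) > depth (point w)"
proof -
  have w: "w \<in> lists S" using assms by (auto simp: reduced_def)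
  show ?thesis using depth_reflect_le[OF w assms(2)] depth_le[of "s # w"] assms w
    by (auto simp: reduced_def point_Cons)
qed

lemma reduced_no_square: "\<not> reduced (x @ [c, c] @ y)"
proof
  assume r: "reduced (x @ [c, c] @ y)"
  then have "x @ y \<in> lists S" by (auto simp: reduced_def)
  moreover have "point (x @ [c, c] @ y) = point (x @ y)" by (simp add: point_append point_Cons)
  ultimately show False using depth_le[of "x @ y"] r by (simp add: reduced_def)
qed

text \<open>Write a shortest word as \<open>u v\<close> with \<open>u\<close> in the letters \<open>s\<close>, \<open>t\<close> and \<open>v\<close> as short as possible. Then
neither \<open>s\<close> nor \<open>t\<close> shortens \<open>v\<close>, since such a letter could be moved into \<open>u\<close>; and \<open>u\<close>, being
reduced, alternates and is at most as long as the braid relation.\<close>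

lemma coset_decomposition:
  assumes w: "w \<in> lists S" and st: "s \<in> S" "t \<in> S" "s \<noteq> t"
  obtains u v k where "u = alt_word s t k \<or> u = alt_word t s k" "enat k \<le> m s t"
    "reduced (u @ v)" "point (u @ v) = point w"
    "depth (point v) \<le> depth (reflect s (point v))" "depth (point v) \<le> depth (reflect t (point v))"
    "\<forall>u' v'. set u' \<subseteq> {s, t} \<longrightarrow> reduced (u' @ v') \<longrightarrow> point (u' @ v') = point w \<longrightarrow> length v \<le> length v'"
proof -
  define D where "D u v \<longleftrightarrow> set u \<subseteq> {s, t} \<and> reduced (u @ v) \<and> point (u @ v) = point w" for u v
  obtain r where "reduced r" "point r = point w" using reduced_exists w .
  then have "D [] r" by (simp add: D_def)
  then have "\<exists>v. \<exists>u. D u v" by blast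
  then obtain v where "\<exists>u. D u v" and vmin': "\<And>v'. \<exists>u. D u v' \<Longrightarrow> length v \<le> length v'"
    using ex_has_least_nat[of "\<lambda>v. \<exists>u. D u v" _ length] by metis
  then obtain u where D: "D u v" by blast
  have vmin: "length v \<le> length v'" if "D u' v'" for u' v' using vmin' that by blast
  have r: "reduced (u @ v)" "point (u @ v) = point w" "set u \<subseteq> {s, t}" using D by (auto simp: D_def)
  have uS: "u \<in> lists S" and vr: "reduced v" and vS: "v \<in> lists S"
    using r(1) reduced_suffix by (auto simp: reduced_def)
  have asc: "depth (point v) \<le> depth (reflect c (point v))" if c: "c \<in> {s, t}" for c
  proof (rule ccontr)
    assume "\<not> depth (point v) \<le> depth (reflect c (point v))"
    then have lt: "depth (reflect c (point v)) < length v" using vr by (simp add: reduced_def)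
    have cS: "c \<in> S" using c st by auto
    obtain v' where v': "reduced v'" "point v' = point (c # v)"
      using reduced_exists[of "c # v"] cS vS by auto
    have len: "length v' < length v" using v' lt by (simp add: reduced_def point_Cons)
    have pt: "point ((u @ [c]) @ v') = point (u @ v)"
      using v'(2) by (simp add: point_append point_Cons)
    have "(u @ [c]) @ v' \<in> lists S" using uS cS v' by (auto simp: reduced_def)
    then have "reduced ((u @ [c]) @ v')"
      using pt len depth_le[of "(u @ [c]) @ v'"] r(1) by (auto simp: reduced_def)
    then have "D (u @ [c]) v'" using pt r c by (auto simp: D_def)
    then show False using vmin len by force
  qed
  define k where "k = length u"
  have nosq: "\<nexists>x c y. u = x @ [c, c] @ y"
    using r(1) reduced_no_square by (metis append.assoc)
  then have u: "u = alt_word s t k \<or> u = alt_word t s k"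
    using alternating_is_alt_word r(3) k_def by metis
  \<comment> \<open>A longer alternating word contains a side of the braid relation after its first letter; replacing it by the other side produces a square.\<close>
  have "enat k \<le> m s t"
  proof (rule ccontr)
    assume "\<not> enat k \<le> m s t"
    then obtain n where n: "m s t = enat n" "n < k" by (cases "m s t") auto
    then have n': "m t s = enat n" using m_sym st by simp
    have "n \<ge> 2" using m_enat_ge2 st n by blast
    then obtain n0 where n0: "n = Suc n0" by (cases n) auto
    obtain j where j: "k = Suc (n + j)" using n(2) less_imp_Suc_add by auto
    have False if ab: "u = alt_word a b k" "a \<in> S" "b \<in> S" "m b a = enat n" for a b
    proof -
      obtain rest where rest: "alt_word b a (n + j) = alt_word b a n @ rest" and restS: "rest \<in> lists S"
        using alt_word_add[of b a n j] alt_word_in_lists[of a S b j] alt_word_in_lists[of b S a j] ab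
        by (cases "even n") auto
      have "u = a # alt_word b a n @ rest" using ab rest j by simp
      moreover have "a # alt_word b a n @ rest @ v \<approx> a # alt_word a b n @ rest @ v"
        using ab restS vS braid_append_right[OF _ braid_alt[OF ab(3,2,4)], of "rest @ v"]
        by (intro braid_Cons) auto
      ultimately have "reduced (a # alt_word a b n @ rest @ v)"
        using reduced_braid r(1) by simp
      then have "reduced ([] @ [a, a] @ alt_word b a n0 @ rest @ v)" by (simp add: n0)
      then show False using reduced_no_square by blast
    qed
    then show False using u st n(1) n' by blast
  qed
  then show ?thesis using that[of u k v] u r asc vmin D_def by auto
qed

text \<open>The dichotomy between positive and negative roots. A word that \<open>s\<close> does not shorten, with first letter
\<open>t\<close>, decomposes as \<open>u v\<close> for the pair \<open>s\<close>, \<open>t\<close>. By induction the point of \<open>v\<close> has positive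
coordinates at \<open>s\<close> and \<open>t\<close>, and \<open>u\<close> is too short to turn the coordinate at \<open>s\<close> negative.

The hypothesis is a weak inequality, so that the lemma can be applied at both ends of a reflection: it then also
excludes that a reflection preserves the depth (see \<open>ascent_iff\<close>).\<close>

lemma ascent_pos:
  assumes "w \<in> lists S" "s \<in> S" "depth (point w) \<le> depth (reflect s (point w))"
  shows "point w s > 0"
  using assms
proof (induction "depth (point w)" arbitrary: w s rule: less_induct)
  case less
  obtain r where r: "reduced r" "point r = point w" using reduced_exists less.prems(1) .
  show ?case
  proof (cases r)
    case Nil
    then show ?thesis using r by (simp flip: r(2) add: point_Nil)
  next
    case (Cons t r')
    have tS: "t \<in> S" using r Cons by (auto simp: reduced_def)
    have r': "reduced r'" using r Cons reduced_tl by blast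
    have "reflect t (point w) = point r'" using r(2) by (simp flip: r(2) add: Cons point_Cons)
    then have lt: "depth (reflect t (point w)) < depth (point w)"
      using r r' Cons by (simp flip: r(2) add: reduced_def)
    then have st: "s \<noteq> t" using less.prems(3) by auto
    obtain u v k where uv: "u = alt_word s t k \<or> u = alt_word t s k" "enat k \<le> m s t"
      "reduced (u @ v)" "point (u @ v) = point w"
      "depth (point v) \<le> depth (reflect s (point v))" "depth (point v) \<le> depth (reflect t (point v))"
      "\<forall>u' v'. set u' \<subseteq> {s, t} \<longrightarrow> reduced (u' @ v') \<longrightarrow> point (u' @ v') = point w \<longrightarrow> length v \<le> length v'"
      by (rule coset_decomposition[OF less.prems(1,2) tS st])
    have "length v \<le> length r'" using uv(7)[rule_format, of "[t]" r'] r Cons by simp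
    then have "length v < depth (point w)" using r Cons by (simp add: reduced_def)
    moreover have vr: "reduced v" using uv(3) reduced_suffix by blast
    ultimately have vlt: "depth (point v) < depth (point w)" by (simp add: reduced_def)
    have vS: "v \<in> lists S" using vr by (simp add: reduced_def)
    have pos: "point v s > 0" "point v t > 0"
      using less.hyps[OF vlt vS] less.prems(2) tS uv(5,6) by auto
    \<comment> \<open>No reduced word of this point begins with \<open>s\<close>, because \<open>s\<close> does not shorten it.\<close>
    have not_s: False if eq: "x \<approx> s # x'" "point x = point w" "reduced x" for x x'
    proof -
      have red: "reduced (s # x')" using eq reduced_braid by blast
      then have "reduced x'" using reduced_tl by blast
      moreover have "reflect s (point w) = point x'"
        using eq point_braid[OF eq(1)] by (metis point_Cons reflect_reflect)
      ultimately have "depth (reflect s (point w)) < depth (point w)"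
        using red eq point_braid[OF eq(1)] by (simp add: reduced_def)
      then show False using less.prems(3) by simp
    qed
    have uvS: "u @ v \<in> lists S" using uv(3) by (simp add: reduced_def)
    have u: "u = alt_word t s k"
    proof (rule ccontr)
      assume "u \<noteq> alt_word t s k"
      then have "u = alt_word s t k" "k \<noteq> 0" using uv(1) by (auto intro: gr0I)
      then obtain j where "u = s # alt_word t s j" by (cases k) auto
      then show False using not_s[of "u @ v" "alt_word t s j @ v"] uv(3,4) pres_cong.refl[OF uvS] by auto
    qed
    \<comment> \<open>At full length the braid relation would let \<open>u\<close> begin with \<open>s\<close>.\<close>
    have "enat k \<noteq> m s t"
    proof
      assume k: "enat k = m s t"
      then have "k \<ge> 2" using m_enat_ge2[OF less.prems(2) tS st] by simp
      then obtain j where j: "k = Suc j" by (cases k) auto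
      have "alt_word t s k \<approx> alt_word s t k"
        using braid_alt[of t s k] k m_sym tS less.prems(2) by auto
      then have "u @ v \<approx> alt_word s t k @ v" using braid_append_right[OF vS] u by blast
      then show False using not_s[of "u @ v"] uv(3,4) j by auto
    qed
    then have "enat k < m s t" using uv(2) by simp
    then have "dihedral_form s t k (point v) > 0"
      using dihedral_form_pos less.prems(2) tS st pos by blast
    then show ?thesis
      using act_alt_word_other[OF less.prems(2) tS st, of k "point v"] uv(4) u
      by (metis point_append)
  qed
qed

lemma ascent_iff:
  assumes "w \<in> lists S" "s \<in> S"
  shows "depth (point w) < depth (reflect s (point w)) \<longleftrightarrow> point w s > 0"
proof -
  have 1: "point w s > 0" if "depth (point w) \<le> depth (reflect s (point w))"
    using ascent_pos assms that by blast
  have 2: "point w s < 0" if "depth (reflect s (point w)) \<le> depth (point w)"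
    using ascent_pos[of "s # w" s] assms that by (simp add: point_Cons) (simp add: reflect_def)
  show ?thesis using 1 2 by fastforce
qed

lemma reduced_Cons_iff_pos:
  assumes "reduced w" "s \<in> S"
  shows "reduced (s # w) \<longleftrightarrow> point w s > 0"
  using reduced_Cons_iff[OF assms] ascent_iff assms by (simp add: reduced_def)

lemma reduced_descent_neg:
  assumes "reduced (s # w)"
  shows "point (s # w) s < 0"
  using assms reduced_Cons_iff_pos[of w s] reduced_tl[OF assms]
  by (auto simp: point_Cons reduced_def reflect_def)

text \<open>If both \<open>a\<close> and \<open>b\<close> can be first letters, the coordinates at \<open>a\<close> and \<open>b\<close> are both negative. In the
decomposition \<open>u v\<close> for this pair that is only possible when \<open>u\<close> has the full length \<open>m a b\<close>.\<close>

lemma reduced_two_descents: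
  assumes "reduced (a # x)" "reduced (b # y)" "point (a # x) = point (b # y)" "a \<noteq> b"
  obtains k v where "m a b = enat k" "reduced (alt_word a b k @ v)" "point (alt_word a b k @ v) = point (a # x)"
proof -
  have S: "a \<in> S" "b \<in> S" "a # x \<in> lists S" using assms by (auto simp: reduced_def)
  have neg: "point (a # x) a < 0" "point (a # x) b < 0"
    using reduced_descent_neg[OF assms(1)] reduced_descent_neg[OF assms(2)] assms(3) by auto
  obtain u v k where uv: "u = alt_word a b k \<or> u = alt_word b a k" "enat k \<le> m a b"
    "reduced (u @ v)" "point (u @ v) = point (a # x)"
    "depth (point v) \<le> depth (reflect a (point v))" "depth (point v) \<le> depth (reflect b (point v))"
    by (rule coset_decomposition[OF S(3,1,2) assms(4)])
  have vS: "v \<in> lists S" using uv(3) by (auto simp: reduced_def)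
  have pos: "point v a > 0" "point v b > 0" using ascent_pos[OF vS] S uv by auto
  have k: "m a b = enat k"
  proof (rule ccontr)
    assume "m a b \<noteq> enat k"
    then have lt: "enat k < m a b" using uv(2) by auto
    then have "dihedral_form a b k (point v) > 0" "dihedral_form b a k (point v) > 0"
      using dihedral_form_pos pos S assms(4) m_sym by auto
    moreover have "act u (point v) = point (a # x)" using uv(4) by (simp add: point_append)
    ultimately show False
      using uv(1) act_alt_word_other[OF S(1,2) assms(4), of k "point v"]
        act_alt_word_other[OF S(2,1) assms(4)[symmetric], of k "point v"] neg by force
  qed
  have "u @ v \<approx> alt_word a b k @ v"
  proof (cases "u = alt_word a b k")
    case True
    then show ?thesis using uv(3) by (auto intro!: pres_cong.refl simp: reduced_def)
  next
    case False
    then show ?thesis using uv(1) braid_append_right[OF vS braid_alt[of b a k]] k m_sym S by auto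
  qed
  then show ?thesis using that[OF k, of v] reduced_braid point_braid uv(3,4) by metis
qed

text \<open>If two reduced words of the same point begin with different letters, then by induction each of them can be
transformed into a word that begins with its side of the braid relation between these letters.\<close>

theorem matsumoto:
  assumes "reduced u" "reduced v" "point u = point v"
  shows "u \<approx> v"
  using assms
proof (induction "length u" arbitrary: u v rule: less_induct)
  case less
  have len: "length u = length v" using less.prems by (simp add: reduced_def)
  show ?case
  proof (cases u)
    case Nil
    then show ?thesis using len by (auto intro: pres_cong.refl)
  next
    case (Cons a x)
    then obtain b y where v: "v = b # y" using len by (cases v) auto
    have S: "a \<in> S" "b \<in> S" using less.prems Cons v by (auto simp: reduced_def)
    have tl: "reduced x" "reduced y" using less.prems Cons v reduced_tl by blast+
    show ?thesis
    proof (cases "a = b")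
      case True
      then have "point x = point y" using less.prems(3) Cons v by (auto simp: point_Cons dest: reflect_inject)
      then show ?thesis using less.hyps[of x y] tl Cons v True S by (auto intro: braid_Cons)
    next
      case False
      obtain k z where z: "m a b = enat k" "reduced (alt_word a b k @ z)" "point (alt_word a b k @ z) = point u"
        using reduced_two_descents[of a x b y] less.prems Cons v False by metis
      have zS: "z \<in> lists S" using z(2) by (simp add: reduced_def)
      have "k \<ge> 2" using m_enat_ge2 S False z(1) by blast
      then obtain j where j: "k = Suc j" by (cases k) auto
      have eq: "alt_word a b k @ z \<approx> alt_word b a k @ z"
        using braid_append_right[OF zS braid_alt] S z(1) by blast
      have "reduced (a # alt_word b a j @ z)" "reduced (b # alt_word a b j @ z)"
        using z(2) reduced_braid[OF eq] by (simp_all add: j)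
      then have r: "reduced (alt_word b a j @ z)" "reduced (alt_word a b j @ z)" using reduced_tl by blast+
      have "reflect a (point x) = reflect a (point (alt_word b a j @ z))"
        using z(3) Cons by (simp add: point_Cons j)
      then have p1: "point x = point (alt_word b a j @ z)" by (rule reflect_inject)
      have "reflect b (point y) = reflect b (point (alt_word a b j @ z))"
        using z(3) less.prems(3) v point_braid[OF eq] by (simp add: point_Cons j)
      then have p2: "point y = point (alt_word a b j @ z)" by (rule reflect_inject)
      have "x \<approx> alt_word b a j @ z" "y \<approx> alt_word a b j @ z"
        using less.hyps[OF _ tl(1) r(1) p1] less.hyps[OF _ tl(2) r(2) p2] len Cons v by auto
      then have "u \<approx> alt_word a b k @ z" "v \<approx> alt_word b a k @ z"
        using braid_Cons S Cons v by (auto simp: j)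
      then show ?thesis using eq by (blast intro: pres_cong.trans pres_cong.sym)
    qed
  qed
qed

section \<open>Squarefree words\<close>

text \<open>Unlike being reduced, this condition is visibly invariant under reversal of words and inherited by
factors.\<close>

definition squarefree :: "'b list \<Rightarrow> bool" where
  "squarefree w \<longleftrightarrow> w \<in> lists S \<and> (\<forall>x c y. \<not> w \<approx> x @ [c, c] @ y)"

text \<open>A reduced word cannot contain a square, because a square acts trivially. Conversely, if \<open>s w\<close> is
not reduced although \<open>w\<close> is, then \<open>s\<close> shortens \<open>w\<close>, so \<open>w\<close> is braid equivalent to a word beginning
with \<open>s\<close> by Matsumoto's theorem, and \<open>s w\<close> to one beginning with \<open>s s\<close>.\<close>

theorem squarefree_iff_reduced: "squarefree w \<longleftrightarrow> reduced w"
proof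
  assume "reduced w"
  then show "squarefree w"
    unfolding squarefree_def using reduced_braid reduced_no_square by (metis reduced_def)
next
  assume "squarefree w"
  then show "reduced w"
  proof (induction w)
    case Nil
    then show ?case using depth_le[of "[]"] by (simp add: reduced_def)
  next
    case (Cons s w)
    have S: "s \<in> S" "w \<in> lists S" using Cons.prems by (auto simp: squarefree_def)
    have "squarefree w"
      using Cons.prems braid_Cons[OF S(1)] S unfolding squarefree_def by (metis append_Cons)
    then have w: "reduced w" using Cons.IH by blast
    show ?case
    proof (rule ccontr)
      assume nr: "\<not> reduced (s # w)"
      then have "\<not> point w s > 0" using reduced_Cons_iff_pos[OF w S(1)] by blast
      then have lt: "depth (reflect s (point w)) < depth (point w)"
        using ascent_pos[OF S(2,1)] by fastforce
      obtain z where z: "reduced z" "point z = point (s # w)"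
        using reduced_exists[of "s # w"] S by auto
      have pz: "point (s # z) = point w" using z by (simp add: point_Cons)
      have "reduced (s # z)"
        using z lt pz depth_reflect_le[of z s] depth_le[of "s # z"] S by (auto simp: reduced_def point_Cons)
      then have "w \<approx> s # z" using matsumoto w pz by simp
      then have "s # w \<approx> [] @ [s, s] @ z" using braid_Cons S(1) by simp
      then show False using Cons.prems unfolding squarefree_def by blast
    qed
  qed
qed

lemma squarefree_rev: 
  assumes "squarefree w"
  shows "squarefree (rev w)"
  unfolding squarefree_def
proof (intro conjI allI notI)
  fix x c y assume "rev w \<approx> x @ [c, c] @ y"
  then have "rev (rev w) \<approx> rev (x @ [c, c] @ y)" by (rule braid_rev)
  then have "w \<approx> rev y @ [c, c] @ rev x" by simp
  then show False using assms unfolding squarefree_def by blast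
qed (use assms in \<open>auto simp: squarefree_def\<close>)

lemma squarefree_braid: "squarefree u \<Longrightarrow> u \<approx> v \<Longrightarrow> squarefree v"
  by (simp add: squarefree_iff_reduced reduced_braid)

lemma squarefree_suffix: "squarefree (u @ v) \<Longrightarrow> squarefree v"
  by (simp add: squarefree_iff_reduced reduced_suffix)

lemma squarefree_prefix: "squarefree (u @ v) \<Longrightarrow> squarefree u"
  using squarefree_rev[of "u @ v"] squarefree_suffix[of "rev v" "rev u"] squarefree_rev[of "rev u"] by simp

lemma squarefree_singleton: "s \<in> S \<Longrightarrow> squarefree [s]"
  unfolding squarefree_def using braid_length by fastforce

lemma squarefree_cancel:
  assumes "squarefree (u @ x)" "u @ x \<approx> u @ y"
  shows "x \<approx> y"
proof -
  have "reduced (u @ x)" "reduced (u @ y)" using assms squarefree_iff_reduced squarefree_braid by auto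
  moreover have "point x = point y" if "point (u @ x) = point (u @ y)" for u
    using that by (induction u) (auto simp: point_Cons dest: reflect_inject)
  ultimately show ?thesis using matsumoto reduced_suffix point_braid assms(2) by metis
qed

lemma squarefree_two_heads:
  assumes "squarefree (a # x)" "a # x \<approx> b # y" "a \<noteq> b"
  obtains k v where "m a b = enat k" "v \<in> lists S" "a # x \<approx> alt_word a b k @ v"
proof -
  have r: "reduced (a # x)" "reduced (b # y)"
    using assms(1) squarefree_braid[OF assms(1,2)] by (auto simp: squarefree_iff_reduced)
  obtain k v where v: "m a b = enat k" "reduced (alt_word a b k @ v)"
    "point (alt_word a b k @ v) = point (a # x)"
    using reduced_two_descents[OF r point_braid[OF assms(2)] assms(3)] .
  have "v \<in> lists S" using v(2) by (simp add: reduced_def)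
  then show ?thesis using that[OF v(1)] matsumoto[OF r(1) v(2)] v(3) by simp
qed

text \<open>Positivity of the coordinates at \<open>s\<close> and \<open>t\<close> allows prepending letters from \<open>{s, t}\<close>
alternately up to the length of the braid relation.\<close>

lemma squarefree_dihedral_left:
  assumes "squarefree (s # w)" "squarefree (t # w)" "s \<noteq> t" "enat k \<le> m s t"
  shows "squarefree (alt_word s t k @ w)" "squarefree (alt_word t s k @ w)"
proof -
  have S: "s \<in> S" "t \<in> S" using assms by (auto simp: squarefree_def)
  have r: "reduced w" "reduced (s # w)" "reduced (t # w)"
    using assms reduced_tl by (auto simp: squarefree_iff_reduced)
  then have pos: "point w s > 0" "point w t > 0" using reduced_Cons_iff_pos S by auto
  have *: "reduced (alt_word a b k @ w)"
    if "a \<in> S" "b \<in> S" "a \<noteq> b" "point w a > 0" "point w b > 0" "enat k \<le> m a b" for a b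
    using that
  proof (induction k arbitrary: a b)
    case (Suc k)
    have lt: "enat k < m a b" using Suc.prems(6) by (metis Suc_ile_eq)
    then have IH: "reduced (alt_word b a k @ w)" using Suc m_sym[of a b] by auto
    have "dihedral_form a b k (point w) > 0" using dihedral_form_pos lt Suc.prems by blast
    then have "point (alt_word b a k @ w) a > 0"
      using act_alt_word_other Suc.prems by (simp add: point_append)
    then show ?case using reduced_Cons_iff_pos[OF IH Suc.prems(1)] by simp
  qed (use r in simp)
  show "squarefree (alt_word s t k @ w)" "squarefree (alt_word t s k @ w)"
    using *[of s t] *[of t s] S assms pos m_sym by (auto simp: squarefree_iff_reduced)
qed

lemma squarefree_dihedral_right:
  assumes "squarefree (w @ [s])" "squarefree (w @ [t])" "s \<noteq> t" "enat k \<le> m s t"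
  shows "squarefree (w @ alt_word s t k)"
proof -
  have "squarefree (rev (alt_word s t k) @ rev w)"
    using squarefree_dihedral_left[of s "rev w" t k] squarefree_rev[OF assms(1)] squarefree_rev[OF assms(2)]
      assms(3,4) by (simp add: rev_alt_word)
  then show ?thesis using squarefree_rev by force
qed

end

section \<open>Greatest elements from local confluence\<close>

text \<open>Newman's lemma for a bounded preorder: if any two elementary extensions \<open>cov\<close> of the same element have
a common upper bound in \<open>X\<close>, then \<open>X\<close> is directed, and an element of maximal rank is a greatest one.\<close>

lemma greatest_of_locally_confluent:
  fixes le cov :: "'x \<Rightarrow> 'x \<Rightarrow> bool" and rank :: "'x \<Rightarrow> nat"
  assumes refl: "\<And>x. x \<in> X \<Longrightarrow> le x x"
    and trans: "\<And>x y z. x \<in> X \<Longrightarrow> y \<in> X \<Longrightarrow> z \<in> X \<Longrightarrow> le x y \<Longrightarrow> le y z \<Longrightarrow> le x z"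
    and bound: "\<And>x. x \<in> X \<Longrightarrow> rank x \<le> B"
    and step: "\<And>x y. x \<in> X \<Longrightarrow> y \<in> X \<Longrightarrow> le x y \<Longrightarrow> \<not> le y x \<Longrightarrow> \<exists>x'\<in>X. cov x x' \<and> le x' y"
    and cov: "\<And>x x'. x \<in> X \<Longrightarrow> x' \<in> X \<Longrightarrow> cov x x' \<Longrightarrow> le x x' \<and> rank x < rank x'"
    and confluent: "\<And>x y z. x \<in> X \<Longrightarrow> y \<in> X \<Longrightarrow> z \<in> X \<Longrightarrow> cov x y \<Longrightarrow> cov x z \<Longrightarrow> \<exists>w\<in>X. le y w \<and> le z w"
    and base: "e \<in> X" "\<And>x. x \<in> X \<Longrightarrow> le e x"
  shows "\<exists>g\<in>X. \<forall>x\<in>X. le x g"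
proof -
  have directed: "\<exists>w\<in>X. le y w \<and> le z w" if "x \<in> X" "y \<in> X" "z \<in> X" "le x y" "le x z" for x y z
    using that
  proof (induction "B - rank x" arbitrary: x y z rule: less_induct)
    case less
    show ?case
    proof (cases "le y x \<or> le z x")
      case True
      then show ?thesis using less.prems refl trans by meson
    next
      case False
      then obtain s t where s: "s \<in> X" "cov x s" "le s y" and t: "t \<in> X" "cov x t" "le t z"
        using step less.prems by meson
      have rk: "B - rank s < B - rank x" "B - rank t < B - rank x"
        using cov[of x s] cov[of x t] bound[of s] bound[of t] s t less.prems by auto
      obtain w where w: "w \<in> X" "le s w" "le t w" using confluent less.prems s t by meson
      obtain w1 where w1: "w1 \<in> X" "le y w1" "le w w1"
        using less.hyps[OF rk(1) s(1) less.prems(2) w(1) s(3) w(2)] by blast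
      have "le t w1" using trans t(1) w w1 by meson
      then obtain w2 where "w2 \<in> X" "le w1 w2" "le z w2"
        using less.hyps[OF rk(2) t(1) w1(1) less.prems(3) _ t(3)] by blast
      then show ?thesis using trans w1 less.prems by meson
    qed
  qed
  have "\<forall>x. x \<in> X \<longrightarrow> rank x < Suc B" using bound le_imp_less_Suc by blast
  then obtain g where g: "g \<in> X" and gmax: "\<And>x. x \<in> X \<Longrightarrow> rank x \<le> rank g"
    using ex_has_greatest_nat[of "\<lambda>x. x \<in> X" e rank "Suc B"] base(1) by blast
  have "le x g" if x: "x \<in> X" for x
  proof -
    obtain w where w: "w \<in> X" "le g w" "le x w" using directed[OF base(1) g x] base(2) g x by blast
    have "le w g"
    proof (rule ccontr)
      assume "\<not> le w g"
      then obtain g' where "g' \<in> X" "cov g g'" using step g w by blast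
      then show False using cov g gmax by (meson leD)
    qed
    then show ?thesis using trans x w g by blast
  qed
  then show ?thesis using g by blast
qed

section \<open>Common multiples of generators in an Artin monoid\<close>

context coxeter
begin

text \<open>Two words with first letters \<open>a \<noteq> b\<close> should be equal only for the obvious reason: both start with
the braid relation between \<open>a\<close> and \<open>b\<close>, followed by the same rest.\<close>

definition heads_agree :: "'b list \<Rightarrow> 'b list \<Rightarrow> bool" where
  "heads_agree u v \<longleftrightarrow> u = [] \<and> v = [] \<or>
     (\<exists>a x b y. u = a # x \<and> v = b # y \<and> a \<in> S \<and> b \<in> S \<and>
        (if a = b then x \<approx> y
         else \<exists>k w. m a b = enat k \<and> w \<in> lists S \<and>
                x \<approx> alt_word b a (k - 1) @ w \<and> y \<approx> alt_word a b (k - 1) @ w))"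

lemma alt_word_Cons_pred:
  assumes "a \<in> S" "b \<in> S" "a \<noteq> b" "m a b = enat k"
  shows "alt_word a b k = a # alt_word b a (k - 1)"
  using m_enat_ge2[OF assms] by (cases k) auto

lemma heads_agree_sym:
  assumes "heads_agree u v"
  shows "heads_agree v u"
proof (cases "u = []")
  case False
  then obtain a x b y where *: "u = a # x" "v = b # y" "a \<in> S" "b \<in> S"
    "if a = b then x \<approx> y
         else \<exists>k w. m a b = enat k \<and> w \<in> lists S \<and>
                x \<approx> alt_word b a (k - 1) @ w \<and> y \<approx> alt_word a b (k - 1) @ w"
    using assms unfolding heads_agree_def by blast
  have "if b = a then y \<approx> x
         else \<exists>k w. m b a = enat k \<and> w \<in> lists S \<and>
                y \<approx> alt_word a b (k - 1) @ w \<and> x \<approx> alt_word b a (k - 1) @ w"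
  proof (cases "a = b")
    case True
    then show ?thesis using * pres_cong.sym by auto
  next
    case False
    then show ?thesis using * m_sym by metis
  qed
  then show ?thesis using * unfolding heads_agree_def by blast
qed (use assms in \<open>auto simp: heads_agree_def\<close>)

lemma heads_agree_Cons:
  "heads_agree (a # x) (a # y) \<longleftrightarrow> a \<in> S \<and> x \<approx> y"
  by (simp add: heads_agree_def)

lemma heads_agree_Cons_neq:
  "a \<noteq> b \<Longrightarrow> heads_agree (a # x) (b # y) \<longleftrightarrow> a \<in> S \<and> b \<in> S \<and> 
     (\<exists>k w. m a b = enat k \<and> w \<in> lists S \<and>
        x \<approx> alt_word b a (k - 1) @ w \<and> y \<approx> alt_word a b (k - 1) @ w)"
  by (auto simp: heads_agree_def)

lemma heads_agree_cong_right:
  assumes "heads_agree u (b # y)" "y \<approx> y'"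
  shows "heads_agree u (b # y')"
proof -
  obtain a x where u: "u = a # x" using assms(1) by (auto simp: heads_agree_def)
  show ?thesis
  proof (cases "a = b")
    case True
    then show ?thesis using assms u by (auto simp: heads_agree_Cons intro: pres_cong.trans)
  next
    case False
    have "y' \<approx> z" if "y \<approx> z" for z using that assms(2) by (blast intro: pres_cong.trans pres_cong.sym)
    then show ?thesis using assms(1) False u by (auto simp: heads_agree_Cons_neq)
  qed
qed

lemma heads_agree_append:
  assumes "heads_agree (a # x) (b # y)" "u \<approx> v"
  shows "heads_agree (a # x @ u) (b # y @ v)"
proof (cases "a = b")
  case True
  then show ?thesis using assms by (auto simp: heads_agree_Cons intro: pres_cong.mult)
next
  case False
  then obtain k w where k: "a \<in> S" "b \<in> S" "m a b = enat k" "w \<in> lists S"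
        "x \<approx> alt_word b a (k - 1) @ w" "y \<approx> alt_word a b (k - 1) @ w"
    using assms(1) heads_agree_Cons_neq by auto
  have uS: "u \<in> lists S" using braid_in_lists assms(2) by blast
  have "x @ u \<approx> alt_word b a (k - 1) @ (w @ u)"
    using pres_cong.mult[OF k(5) pres_cong.refl[OF uS]] by simp
  moreover have "y @ v \<approx> alt_word a b (k - 1) @ (w @ u)"
    using pres_cong.mult[OF k(6) pres_cong.sym[OF assms(2)]] by simp
  moreover have "w @ u \<in> lists S" using uS k by simp
  ultimately show ?thesis using k(1-3) heads_agree_Cons_neq[OF False] by blast
qed

definition heads_agree_below :: "nat \<Rightarrow> bool" where
  "heads_agree_below n \<longleftrightarrow> (\<forall>x y. length x < n \<longrightarrow> x \<approx> y \<longrightarrow> heads_agree x y)"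

lemma heads_agree_belowD: "heads_agree_below n \<Longrightarrow> length x < n \<Longrightarrow> x \<approx> y \<Longrightarrow> heads_agree x y"
  by (simp add: heads_agree_below_def)

lemma short_left_cancel:
  assumes IH: "heads_agree_below n"
  shows "length (w @ x) < n \<Longrightarrow> w @ x \<approx> w @ y \<Longrightarrow> x \<approx> y"
proof (induction w)
  case (Cons a w)
  then have "heads_agree (a # w @ x) (a # w @ y)" using heads_agree_belowD[OF IH] by simp
  then show ?case using Cons by (simp add: heads_agree_Cons)
qed simp

text \<open>Left cancellation and lcms below the length of \<open>z\<close> make the set of those prefixes \<open>x\<close> of \<open>z\<close> for which
\<open>c x\<close> is squarefree locally confluent, by \<open>squarefree_dihedral_right\<close>.\<close>

lemma greatest_extending_prefix:
  assumes IH: "heads_agree_below n"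
    and z: "length z < n" "z \<in> lists S" and c: "c \<in> S"
  obtains d f where "d \<in> lists S" "f \<in> lists S" "z \<approx> d @ f" "squarefree (c # d)"
    "\<forall>x\<in>lists S. \<forall>y\<in>lists S. z \<approx> x @ y \<longrightarrow> squarefree (c # x) \<longrightarrow> (\<exists>u\<in>lists S. d \<approx> x @ u)"
proof -
  define le where "le u w \<longleftrightarrow> (\<exists>v\<in>lists S. w \<approx> u @ v)" for u w
  define X where "X = {x \<in> lists S. le x z \<and> squarefree (c # x)}"
  have le_trans: "le u w" if uvw: "le u v" "le v w" for u v w
  proof -
    obtain p q where pq: "p \<in> lists S" "q \<in> lists S" "v \<approx> u @ p" "w \<approx> v @ q"
      using uvw by (auto simp: le_def)
    then have "w \<approx> u @ (p @ q)"
      using pres_cong.trans[OF pq(4) braid_append_right[OF pq(2,3)]] by simp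
    then show ?thesis using pq unfolding le_def by (metis append_in_lists_conv)
  qed
  have le_app: "le u (u @ v)" if "u \<in> lists S" "v \<in> lists S" for u v
    using that by (auto simp: le_def intro!: bexI[of _ v] pres_cong.refl)
  have "\<exists>g\<in>X. \<forall>x\<in>X. le x g"
  proof (rule greatest_of_locally_confluent[where rank = length and B = "length z"
        and cov = "\<lambda>x x'. \<exists>s. x' = x @ [s]" and e = "[]"])
    show "le x x" if "x \<in> X" for x using le_app[of x "[]"] that by (auto simp: X_def)
    show "le x z" if "le x y" "le y z" for x y z using that le_trans by blast
    show "length x \<le> length z" if "x \<in> X" for x
      using that braid_length by (fastforce simp: X_def le_def)
    show "[] \<in> X" using z c le_app[of "[]" z] squarefree_singleton by (auto simp: X_def)
    show "le [] x" if "x \<in> X" for x using that le_app[of "[]" x] by (auto simp: X_def)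
  next
    fix x y assume xy: "x \<in> X" "y \<in> X" "le x y" "\<not> le y x"
    then obtain v where v: "v \<in> lists S" "y \<approx> x @ v" by (auto simp: le_def)
    have "v \<noteq> []"
    proof
      assume "v = []"
      then have "x \<approx> y @ []" using v(2) pres_cong.sym by fastforce
      then show False using xy(4) unfolding le_def by (metis lists.Nil)
    qed
    then obtain s v' where sv: "v = s # v'" by (cases v) auto
    have xS: "x \<in> lists S" using xy by (auto simp: X_def)
    have le: "le (x @ [s]) y" using v sv by (auto simp: le_def intro!: bexI[of _ v'])
    have "c # y \<approx> (c # x @ [s]) @ v'" using braid_Cons[OF c v(2)] sv by simp
    then have "squarefree (c # x @ [s])"
      using xy(2) squarefree_braid squarefree_prefix unfolding X_def by blast
    moreover have "le (x @ [s]) z" using le le_trans xy(2) by (auto simp: X_def)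
    ultimately have "x @ [s] \<in> X" using xS v sv by (auto simp: X_def)
    then show "\<exists>x'\<in>X. (\<exists>s. x' = x @ [s]) \<and> le x' y" using le by blast
  next
    fix x x' assume "x \<in> X" "x' \<in> X" "\<exists>s. x' = x @ [s]"
    then obtain s where "x' = x @ [s]" "x \<in> lists S" "[s] \<in> lists S" by (auto simp: X_def)
    then show "le x x' \<and> length x < length x'" using le_app[of x "[s]"] by simp
  next
    fix x y w assume xyw: "x \<in> X" "y \<in> X" "w \<in> X" "\<exists>s. y = x @ [s]" "\<exists>s. w = x @ [s]"
    then obtain s t where st: "y = x @ [s]" "w = x @ [t]" by blast
    have xS: "x \<in> lists S" and S: "s \<in> S" "t \<in> S" using xyw st by (auto simp: X_def)
    show "\<exists>v\<in>X. le y v \<and> le w v"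
    proof (cases "s = t")
      case True
      have "w \<in> lists S" using xyw by (simp add: X_def)
      then have "le w w" using le_app[of w "[]"] by simp
      then show ?thesis using xyw st True by blast
    next
      case False
      obtain p q where pq: "p \<in> lists S" "q \<in> lists S" "z \<approx> x @ s # p" "z \<approx> x @ t # q"
        using xyw st by (auto simp: X_def le_def)
      have "x @ s # p \<approx> x @ t # q" using pq pres_cong.sym pres_cong.trans by blast
      then have "s # p \<approx> t # q"
        by (rule short_left_cancel[OF IH, rotated]) (use braid_length[OF pq(3)] z(1) in auto)
      then have "heads_agree (s # p) (t # q)" using heads_agree_belowD[OF IH] braid_length[OF pq(3)] z(1) by simp
      then obtain k r where k: "m s t = enat k" "r \<in> lists S" "p \<approx> alt_word t s (k - 1) @ r"
        using heads_agree_Cons_neq[OF False] by blast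
      have "s # p \<approx> alt_word s t k @ r"
        using braid_Cons[OF S(1) k(3)] alt_word_Cons_pred[OF S False k(1)] by simp
      then have "x @ s # p \<approx> x @ alt_word s t k @ r" by (rule braid_append_left[OF xS])
      then have zk: "z \<approx> (x @ alt_word s t k) @ r"
        using pres_cong.trans[OF pq(3)] by simp
      have altS: "alt_word s t k \<in> lists S" by (rule alt_word_in_lists[OF S])
      let ?v = "x @ alt_word s t k"
      have "squarefree ((c # x) @ alt_word s t k)"
      proof -
        have 1: "squarefree ((c # x) @ [s])" using xyw(2) unfolding st X_def by simp
        have 2: "squarefree ((c # x) @ [t])" using xyw(3) unfolding st X_def by simp
        have 3: "enat k \<le> m s t" by (simp only: k(1) order_refl)
        show ?thesis by (rule squarefree_dihedral_right[OF 1 2 False 3])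
      qed
      moreover have "le ?v z" using zk k(2) unfolding le_def by blast
      ultimately have "?v \<in> X" using xS altS by (simp add: X_def)
      moreover have "le y ?v"
        using le_app[of y "alt_word t s (k - 1)"] alt_word_Cons_pred[OF S False k(1)]
          alt_word_in_lists[OF S(2,1), of "k - 1"] xS S st by simp
      moreover have "le w ?v"
      proof -
        have "?v \<approx> x @ alt_word t s k" using braid_append_left[OF xS braid_alt] S k(1) by blast
        moreover have "m t s = enat k" using m_sym S k by simp
        ultimately have "?v \<approx> w @ alt_word s t (k - 1)"
          using alt_word_Cons_pred[of t s k] S False st by simp
        then show ?thesis unfolding le_def by (rule bexI) (rule alt_word_in_lists[OF S])
      qed
      ultimately show ?thesis by blast
    qed
  qed
  then obtain d where d: "d \<in> X" "\<forall>x\<in>X. le x d" by blast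
  then obtain f where f: "f \<in> lists S" "z \<approx> d @ f" by (auto simp: X_def le_def)
  show ?thesis
  proof (rule that[of d f])
    show "\<forall>x\<in>lists S. \<forall>y\<in>lists S. z \<approx> x @ y \<longrightarrow> squarefree (c # x) \<longrightarrow> (\<exists>u\<in>lists S. d \<approx> x @ u)"
      using d(2) by (auto simp: X_def le_def)
  qed (use d f in \<open>auto simp: X_def\<close>)
qed

text \<open>The heart of the matter: the step from \<open>a x\<close> over \<open>c z\<close> to \<open>b y\<close> with three different letters.
Let \<open>d\<close> be the greatest prefix of \<open>z\<close> such that \<open>c d\<close> is squarefree. Both braid relations used in
the two steps are part of \<open>c d\<close>, so the squarefree word \<open>c d\<close> can begin with \<open>a\<close> as well as with \<open>b\<close>,
hence with the braid relation between them.\<close>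

lemma heads_agree_trans_distinct:
  assumes IH: "heads_agree_below n"
    and ac: "heads_agree (a # x) (c # z)" and cb: "heads_agree (c # z) (b # y)"
    and len: "length z < n" and neq: "a \<noteq> b" "a \<noteq> c" "b \<noteq> c"
  shows "heads_agree (a # x) (b # y)"
proof -
  have S: "a \<in> S" "b \<in> S" "c \<in> S" using ac cb by (auto simp: heads_agree_def)
  obtain k p where k: "m a c = enat k" "p \<in> lists S"
        "x \<approx> alt_word c a (k - 1) @ p" "z \<approx> alt_word a c (k - 1) @ p"
    using ac heads_agree_Cons_neq[OF neq(2)] by auto
  obtain l q where l: "m b c = enat l" "q \<in> lists S"
        "y \<approx> alt_word c b (l - 1) @ q" "z \<approx> alt_word b c (l - 1) @ q"
    using cb heads_agree_Cons_neq[OF neq(3)[symmetric]] m_sym[of c b] S by auto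
  have zS: "z \<in> lists S" using braid_in_lists l(4) by blast
  obtain d f where d: "d \<in> lists S" "f \<in> lists S" "z \<approx> d @ f" "squarefree (c # d)"
    and dmax: "\<forall>x\<in>lists S. \<forall>y\<in>lists S. z \<approx> x @ y \<longrightarrow> squarefree (c # x) \<longrightarrow> (\<exists>u\<in>lists S. d \<approx> x @ u)"
    by (rule greatest_extending_prefix[OF IH len zS S(3)])
  \<comment> \<open>Used for \<open>e = a\<close> and for \<open>e = b\<close>: the side of the relation between \<open>c\<close> and \<open>e\<close> that begins with \<open>c\<close> is squarefree, so without its first letter it is a prefix of \<open>d\<close>.\<close>
  have part: "\<exists>v\<in>lists S. c # d \<approx> e # alt_word c e (i - 1) @ v \<and> r \<approx> v @ f"
    if e: "e \<in> S" "e \<noteq> c" "m e c = enat i" and r: "r \<in> lists S" "z \<approx> alt_word e c (i - 1) @ r" for e i r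
  proof -
    have altS: "alt_word e c (i - 1) \<in> lists S" by (rule alt_word_in_lists[OF e(1) S(3)])
    have ce: "m c e = enat i" using e m_sym S by simp
    have "squarefree ([] @ alt_word c e i)"
      using squarefree_dihedral_right[of "[]" c e i] squarefree_singleton S e ce by simp
    then have "squarefree (c # alt_word e c (i - 1))"
      using alt_word_Cons_pred[of c e i] S e ce by simp
    then obtain v where v: "v \<in> lists S" "d \<approx> alt_word e c (i - 1) @ v" using dmax altS r by blast
    have "z \<approx> alt_word e c (i - 1) @ v @ f"
      using pres_cong.trans[OF d(3) braid_append_right[OF d(2) v(2)]] by simp
    then have "alt_word e c (i - 1) @ r \<approx> alt_word e c (i - 1) @ v @ f"
      using r(2) pres_cong.sym pres_cong.trans by blast
    then have 1: "r \<approx> v @ f" 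
      by (rule short_left_cancel[OF IH, rotated]) (use braid_length[OF r(2)] len in auto)
    have "c # d \<approx> alt_word c e i @ v"
      using braid_Cons[OF S(3) v(2)] alt_word_Cons_pred[of c e i] S e ce by simp
    moreover have "alt_word c e i @ v \<approx> alt_word e c i @ v"
      using braid_append_right[OF v(1) braid_alt] S e ce by blast
    ultimately have "c # d \<approx> alt_word e c i @ v" by (rule pres_cong.trans)
    then have "c # d \<approx> e # alt_word c e (i - 1) @ v"
      using alt_word_Cons_pred[OF e(1) S(3) e(2,3)] by simp
    then show ?thesis using 1 v(1) by blast
  qed
  obtain u where u: "u \<in> lists S" "c # d \<approx> a # alt_word c a (k - 1) @ u" "p \<approx> u @ f"
    using part[OF S(1) neq(2) k(1,2,4)] by blast
  obtain v where v: "v \<in> lists S" "c # d \<approx> b # alt_word c b (l - 1) @ v" "q \<approx> v @ f"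
    using part[OF S(2) neq(3) l(1,2,4)] by blast
  have sq: "squarefree (a # alt_word c a (k - 1) @ u)" "squarefree (b # alt_word c b (l - 1) @ v)"
    using squarefree_braid d(4) u(2) v(2) by blast+
  have "a # alt_word c a (k - 1) @ u \<approx> b # alt_word c b (l - 1) @ v"
    using u(2) v(2) pres_cong.sym pres_cong.trans by blast
  then obtain j w where j: "m a b = enat j" "w \<in> lists S"
      "a # alt_word c a (k - 1) @ u \<approx> alt_word a b j @ w"
    using squarefree_two_heads[OF sq(1) _ neq(1)] by metis
  have ja: "alt_word a b j @ w = [a] @ alt_word b a (j - 1) @ w"
    using alt_word_Cons_pred[OF S(1,2) neq(1) j(1)] by simp
  have "m b a = enat j" using j m_sym S by simp
  then have jb: "alt_word b a j @ w = [b] @ alt_word a b (j - 1) @ w"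
    using alt_word_Cons_pred[of b a j] S neq by simp
  have "[a] @ (alt_word c a (k - 1) @ u) \<approx> [a] @ (alt_word b a (j - 1) @ w)" using j(3) ja by simp
  then have 1: "alt_word c a (k - 1) @ u \<approx> alt_word b a (j - 1) @ w"
    using squarefree_cancel[of "[a]"] sq(1) by simp
  have "c # d \<approx> alt_word b a j @ w"
    using u(2) j(3) braid_append_right[OF j(2) braid_alt[OF S(1,2) j(1)]] pres_cong.trans by blast
  then have "[b] @ (alt_word c b (l - 1) @ v) \<approx> [b] @ (alt_word a b (j - 1) @ w)"
    using pres_cong.trans[OF pres_cong.sym[OF v(2)]] jb by simp
  then have 2: "alt_word c b (l - 1) @ v \<approx> alt_word a b (j - 1) @ w"
    using squarefree_cancel[of "[b]"] sq(2) by simp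
  have "x \<approx> alt_word c a (k - 1) @ u @ f"
    using k(3) braid_append_left[OF alt_word_in_lists u(3)] S pres_cong.trans by blast
  then have "x \<approx> alt_word b a (j - 1) @ (w @ f)"
    using pres_cong.trans[OF _ braid_append_right[OF d(2) 1]] by simp
  moreover have "y \<approx> alt_word c b (l - 1) @ v @ f"
    using l(3) braid_append_left[OF alt_word_in_lists v(3)] S pres_cong.trans by blast
  then have "y \<approx> alt_word a b (j - 1) @ (w @ f)"
    using pres_cong.trans[OF _ braid_append_right[OF d(2) 2]] by simp
  moreover have "w @ f \<in> lists S" using j(2) d(2) by simp
  ultimately show ?thesis using heads_agree_Cons_neq[OF neq(1)] S j(1) by blast
qed

lemma heads_agree_trans:
  assumes IH: "heads_agree_below n"
    and uv: "heads_agree u v" and vw: "heads_agree v w" and len: "length v \<le> n"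
  shows "heads_agree u w"
proof (cases v)
  case Nil
  then show ?thesis using uv vw by (auto simp: heads_agree_def)
next
  case (Cons c z)
  then obtain a x b y where u: "u = a # x" and w: "w = b # y"
    using uv vw by (auto simp: heads_agree_def)
  have zlen: "length z < n" using len Cons by simp
  consider "a = c" | "b = c" | "a \<noteq> c" "b \<noteq> c" "a = b" | "a \<noteq> c" "b \<noteq> c" "a \<noteq> b" by blast
  then show ?thesis
  proof cases
    case 1
    then have "x \<approx> z" using uv u Cons by (simp add: heads_agree_Cons)
    then show ?thesis
      using heads_agree_cong_right[OF heads_agree_sym[OF vw[unfolded Cons]] pres_cong.sym] 1 u heads_agree_sym
      by blast
  next
    case 2
    then have "z \<approx> y" using vw w Cons by (simp add: heads_agree_Cons)
    then show ?thesis using heads_agree_cong_right uv 2 w Cons by blast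
  next
    case 3
    have S: "a \<in> S" "c \<in> S" using uv u Cons by (auto simp: heads_agree_def)
    obtain k p where k: "m a c = enat k" "x \<approx> alt_word c a (k - 1) @ p" "z \<approx> alt_word a c (k - 1) @ p"
      using uv heads_agree_Cons_neq[OF 3(1)] u Cons by auto
    obtain q where q: "y \<approx> alt_word c a (k - 1) @ q" "z \<approx> alt_word a c (k - 1) @ q"
      using vw heads_agree_Cons_neq[OF 3(2)[symmetric]] w Cons 3 m_sym[OF S] k(1) by auto
    have "alt_word a c (k - 1) @ p \<approx> alt_word a c (k - 1) @ q"
      using k(3) q(2) pres_cong.sym pres_cong.trans by blast
    then have "p \<approx> q" 
      by (rule short_left_cancel[OF IH, rotated]) (use braid_length[OF k(3)] zlen in auto)
    then have "x \<approx> y"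
      using k(2) q(1) braid_append_left[OF alt_word_in_lists[OF S(2,1)]] pres_cong.sym pres_cong.trans by blast
    then show ?thesis using 3 u w S by (simp add: heads_agree_Cons)
  next
    case 4
    then show ?thesis using heads_agree_trans_distinct[OF IH] uv vw u w Cons zlen by blast
  qed
qed

text \<open>Induction over the length of the words, and for a fixed length over the derivation of the equivalence; the
transitivity step is the only one that needs work.\<close>

theorem braid_heads_agree: "u \<approx> v \<Longrightarrow> heads_agree u v"
proof (induction "length u" arbitrary: u v rule: less_induct)
  case less
  have below: "heads_agree_below (length u)"
    using less.hyps by (simp add: heads_agree_below_def)
  have "heads_agree u' v'" if "u' \<approx> v'" "length u' \<le> length u" for u' v'
    using that
  proof (induction rule: pres_cong.induct)
    case (rel l r)
    then obtain a b k where ab: "l = alt_word a b k" "r = alt_word b a k" "a \<in> S" "b \<in> S" "m a b = enat k"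
      by (auto simp: artin_relations_def)
    show ?case
    proof (cases "a = b")
      case True
      then have "k = 1" using ab m_refl by (simp add: one_enat_def)
      then show ?thesis using ab True by (auto simp: heads_agree_Cons intro: pres_cong.refl)
    next
      case False
      have ba: "m b a = enat k" using ab m_sym by simp
      have "heads_agree (a # alt_word b a (k - 1)) (b # alt_word a b (k - 1))"
        using heads_agree_Cons_neq[OF False] ab alt_word_in_lists[of b S a "k - 1"]
          alt_word_in_lists[of a S b "k - 1"]
        by (auto intro!: exI[of _ k] exI[of _ "[]"] pres_cong.refl)
      then show ?thesis
        using alt_word_Cons_pred[OF ab(3,4) False ab(5)] alt_word_Cons_pred[OF ab(4,3) _ ba] ab False by simp
    qed
  next
    case (refl w)
    then show ?case by (cases w) (auto simp: heads_agree_def intro: pres_cong.refl)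
  next
    case (sym u v)
    then show ?case using braid_length heads_agree_sym by metis
  next
    case (trans u' v' w')
    then have "heads_agree u' v'" "heads_agree v' w'" "length v' \<le> length u"
      using braid_length by fastforce+
    then show ?case using heads_agree_trans[OF below] by blast
  next
    case (mult u1 v1 u2 v2)
    have l: "length u1 = length v1" using braid_length mult by blast
    have IH: "heads_agree u1 v1" "heads_agree u2 v2" using mult by auto
    show ?case
    proof (cases u1)
      case Nil
      then show ?thesis using l IH by simp
    next
      case (Cons a x)
      then obtain b y where "v1 = b # y" using l by (cases v1) auto
      then show ?thesis using heads_agree_append Cons IH(1) mult(2) by simp
    qed
  qed
  then show ?case using less.prems by simp
qed

end

section \<open>Words and submonoids\<close>

lemma lists_subsetD: "A \<subseteq> B \<Longrightarrow> w \<in> lists A \<Longrightarrow> w \<in> lists B"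
  by (rule subsetD[OF lists_mono])

lemma word_eval_Nil [simp]: "word_eval G [] = \<one>\<^bsub>G\<^esub>"
  and word_eval_Cons [simp]: "word_eval G (a # w) = a \<otimes>\<^bsub>G\<^esub> word_eval G w"
  by (simp_all add: word_eval_def)

lemma word_eval_carrier_update [simp]: "word_eval (G\<lparr>carrier := X\<rparr>) w = word_eval G w"
  by (simp add: word_eval_def)

lemma (in monoid) word_eval_closed: "w \<in> lists (carrier G) \<Longrightarrow> word_eval G w \<in> carrier G"
  by (induction w) auto

lemma (in monoid) word_eval_append:
  "u \<in> lists (carrier G) \<Longrightarrow> v \<in> lists (carrier G) \<Longrightarrow> word_eval G (u @ v) = word_eval G u \<otimes> word_eval G v"
  by (induction u) (auto simp: m_assoc word_eval_closed in_listsI)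

lemma (in submonoid) word_eval_in_submonoid: "w \<in> lists H \<Longrightarrow> word_eval G w \<in> H"
  by (induction w) auto

lemma hom_word_eval:
  assumes "monoid G" "h \<in> hom G H" "h \<one>\<^bsub>G\<^esub> = \<one>\<^bsub>H\<^esub>" "w \<in> lists (carrier G)"
  shows "h (word_eval G w) = word_eval H (map h w)"
  using assms(4)
proof (induction w)
  case (Cons a w)
  then show ?case using assms(2) monoid.word_eval_closed[OF assms(1), of w] by (auto simp: hom_mult)
qed (simp add: assms)

lemma (in monoid) submonoid_generated:
  assumes "T \<subseteq> carrier G"
  shows "submonoid (word_eval G ` lists T) G"
proof
  have T: "lists T \<subseteq> lists (carrier G)" using assms by (rule lists_mono)
  show "word_eval G ` lists T \<subseteq> carrier G" using T word_eval_closed by blast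
  show "\<one> \<in> word_eval G ` lists T" by (auto intro!: image_eqI[of _ _ "[]"])
  fix x y assume "x \<in> word_eval G ` lists T" "y \<in> word_eval G ` lists T"
  then obtain u v where "u \<in> lists T" "v \<in> lists T" "x = word_eval G u" "y = word_eval G v" by blast
  moreover from this have "word_eval G (u @ v) = x \<otimes> y" using word_eval_append T by blast
  ultimately show "x \<otimes> y \<in> word_eval G ` lists T"
    by (metis append_in_lists_conv image_eqI)
qed

lemma (in monoid) hom_eq_on_generators:
  assumes "h \<in> hom G H" "k \<in> hom G H" "h \<one> = k \<one>"
    and "carrier G = word_eval G ` lists A" "A \<subseteq> carrier G" "\<And>a. a \<in> A \<Longrightarrow> h a = k a"
    and "x \<in> carrier G"
  shows "h x = k x"
proof -
  have "h (word_eval G w) = k (word_eval G w)" if "w \<in> lists A" for w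
    using that
  proof (induction w)
    case (Cons a w)
    then have "a \<in> carrier G" "word_eval G w \<in> carrier G"
      using assms(5) word_eval_closed lists_mono[OF assms(5)] by auto
    then show ?case using Cons assms(1,2,6) by (auto simp: hom_mult)
  qed (simp add: assms(3))
  then show ?thesis using assms(4,7) by auto
qed

section \<open>Norms\<close>

locale normed_monoid = monoid G for G (structure) +
  fixes \<nu> :: "'a \<Rightarrow> nat"
  assumes norm: "monoid_norm G \<nu>"
begin

lemma norm_pos: "a \<in> carrier G \<Longrightarrow> a \<noteq> \<one> \<Longrightarrow> \<nu> a > 0"
  and norm_mult_ge: "a \<in> carrier G \<Longrightarrow> b \<in> carrier G \<Longrightarrow> \<nu> a + \<nu> b \<le> \<nu> (a \<otimes> b)"
  using norm by (auto simp: monoid_norm_def)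

lemma norm_one: "\<nu> \<one> = 0"
  using norm_mult_ge[of \<one> \<one>] by simp

lemma norm_eq_0_iff: "a \<in> carrier G \<Longrightarrow> \<nu> a = 0 \<longleftrightarrow> a = \<one>"
  using norm_pos norm_one by fastforce

lemma mult_eq_one:
  assumes "a \<in> carrier G" "b \<in> carrier G" "a \<otimes> b = \<one>"
  shows "a = \<one>" "b = \<one>"
  using norm_mult_ge[OF assms(1,2)] assms norm_one norm_eq_0_iff by auto

lemma word_eval_eq_one:
  assumes "w \<in> lists (carrier G)" "word_eval G w = \<one>"
  shows "set w \<subseteq> {\<one>}"
  using assms
proof (induction w)
  case (Cons a w)
  have "a \<in> carrier G" "w \<in> lists (carrier G)" using Cons.hyps by auto
  then have "a = \<one>" "word_eval G w = \<one>" using mult_eq_one[of a "word_eval G w"] word_eval_closed Cons.prems by auto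
  then show ?case using Cons by auto
qed simp

lemma divides_antisym:
  assumes "a \<in> carrier G" "b \<in> carrier G" "a divides b" "b divides a"
  shows "a = b"
proof -
  obtain c d where cd: "c \<in> carrier G" "b = a \<otimes> c" "d \<in> carrier G" "a = b \<otimes> d"
    using assms by (auto simp: factor_def)
  have "\<nu> a + \<nu> c \<le> \<nu> b" "\<nu> b + \<nu> d \<le> \<nu> a"
    using norm_mult_ge[OF assms(1) cd(1)] norm_mult_ge[OF assms(2) cd(3)]
    by (simp_all only: cd(2)[symmetric] cd(4)[symmetric])
  then have "c = \<one>" using norm_eq_0_iff[OF cd(1)] by simp
  then show ?thesis using cd(2) assms(1) by simp
qed

lemma divides_norm_le:
  assumes "a \<in> carrier G" "a divides b"
  shows "\<nu> a \<le> \<nu> b"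
  using assms norm_mult_ge by (fastforce simp: factor_def)

lemma divides_norm_eq:
  assumes "a \<in> carrier G" "a divides b" "\<nu> b \<le> \<nu> a"
  shows "a = b"
proof -
  obtain c where c: "c \<in> carrier G" "b = a \<otimes> c" using assms(2) by (auto simp: factor_def)
  then have "\<nu> c = 0" using norm_mult_ge[OF assms(1) c(1)] assms(3) by simp
  then have "c = \<one>" using norm_eq_0_iff[OF c(1)] by simp
  then show ?thesis using c(2) assms(1) by simp
qed

lemma generated_by_atoms:
  assumes "x \<in> carrier G"
  shows "x \<in> word_eval G ` lists (atoms G)"
  using assms
proof (induction "\<nu> x" arbitrary: x rule: less_induct)
  case less
  interpret sub: submonoid "word_eval G ` lists (atoms G)" G
    by (rule submonoid_generated) (auto simp: atoms_def)
  have "x = \<one> \<or> x \<in> atoms G \<or>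
      (\<exists>b\<in>carrier G. \<exists>c\<in>carrier G. x = b \<otimes> c \<and> b \<noteq> \<one> \<and> c \<noteq> \<one>)"
    using less.prems unfolding atoms_def by blast
  then consider "x = \<one>" | "x \<in> atoms G"
    | b c where "b \<in> carrier G" "c \<in> carrier G" "x = b \<otimes> c" "b \<noteq> \<one>" "c \<noteq> \<one>"
    by blast
  then show ?case
  proof cases
    case 1
    then show ?thesis using sub.one_closed by simp
  next
    case 2
    then show ?thesis using less.prems by (auto intro!: image_eqI[of _ _ "[x]"])
  next
    case 3
    then have "\<nu> b < \<nu> x" "\<nu> c < \<nu> x" using norm_mult_ge[of b c] norm_pos by fastforce+
    then show ?thesis using less.hyps 3 sub.m_closed by blast
  qed
qed

lemma carrier_eq_atoms: "carrier G = word_eval G ` lists (atoms G)"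
proof -
  have "lists (atoms G) \<subseteq> lists (carrier G)" by (rule lists_mono) (auto simp: atoms_def)
  then show ?thesis using generated_by_atoms word_eval_closed by blast
qed

lemma atom_divisor:
  assumes "x \<in> carrier G" "x \<noteq> \<one>"
  obtains s where "s \<in> atoms G" "s divides x"
proof -
  obtain w where w: "w \<in> lists (atoms G)" "x = word_eval G w" using generated_by_atoms assms(1) by blast
  then obtain s v where sv: "w = s # v" using assms(2) by (cases w) auto
  have "v \<in> lists (carrier G)" using w(1) sv by (auto simp: atoms_def)
  then have "word_eval G v \<in> carrier G" by (rule word_eval_closed)
  then show ?thesis using that[of s] w sv by (auto simp: factor_def)
qed

lemma atom_in_generators:
  assumes "s \<in> atoms G" "w \<in> lists A" "A \<subseteq> carrier G" "s = word_eval G w"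
  shows "s \<in> A"
  using assms
proof (induction w)
  case Nil
  then show ?case by (simp add: atoms_def)
next
  case (Cons a w)
  have c: "a \<in> carrier G" "word_eval G w \<in> carrier G"
    using Cons.prems word_eval_closed lists_mono[OF Cons.prems(3)] by auto
  then have "a = \<one> \<or> word_eval G w = \<one>" using Cons.prems by (auto simp: atoms_def)
  then show ?case using Cons c by auto
qed

lemma finite_atoms:
  assumes "fin_gen_monoid G"
  shows "finite (atoms G)"
proof -
  obtain A where A: "finite A" "A \<subseteq> carrier G" "carrier G = word_eval G ` lists A"
    using assms unfolding fin_gen_monoid_def by blast
  have "atoms G \<subseteq> A"
  proof
    fix s assume s: "s \<in> atoms G"
    then have "s \<in> carrier G" by (simp add: atoms_def)
    then obtain w where "w \<in> lists A" "s = word_eval G w" using A(3) by auto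
    then show "s \<in> A" using atom_in_generators s A(2) by blast
  qed
  then show ?thesis using A(1) by (rule finite_subset)
qed

end

section \<open>Fixed points in left preGarside monoids\<close>

lemma End_mult: "\<phi> \<in> monoid_End M \<Longrightarrow> a \<in> carrier M \<Longrightarrow> b \<in> carrier M \<Longrightarrow> \<phi> (a \<otimes>\<^bsub>M\<^esub> b) = \<phi> a \<otimes>\<^bsub>M\<^esub> \<phi> b"
  and End_one: "\<phi> \<in> monoid_End M \<Longrightarrow> \<phi> \<one>\<^bsub>M\<^esub> = \<one>\<^bsub>M\<^esub>"
  and End_closed: "\<phi> \<in> monoid_End M \<Longrightarrow> a \<in> carrier M \<Longrightarrow> \<phi> a \<in> carrier M"
  by (auto simp: monoid_End_def hom_def)

lemma End_funpow: "\<phi> \<in> monoid_End M \<Longrightarrow> \<phi> ^^ n \<in> monoid_End M"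
  by (induction n) (auto simp: monoid_End_def hom_def Pi_iff)

lemma End_word_eval:
  assumes "monoid M" "\<phi> \<in> monoid_End M" "w \<in> lists (carrier M)"
  shows "\<phi> (word_eval M w) = word_eval M (map \<phi> w)"
  using hom_word_eval[OF assms(1), of \<phi> M w] assms by (simp add: monoid_End_def)

lemma End_divides:
  assumes "\<phi> \<in> monoid_End M" "a \<in> carrier M" "a divides\<^bsub>M\<^esub> b"
  shows "\<phi> a divides\<^bsub>M\<^esub> \<phi> b"
  using assms End_closed[OF assms(1)] by (auto simp: factor_def End_mult)

lemma funpow_fixed: "f x = x \<Longrightarrow> (f ^^ n) x = x"
  by (induction n) auto

lemma submonoid_Fix:
  assumes "monoid M" "\<phi> \<in> monoid_End M"
  shows "submonoid (Fix M \<phi>) M"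
proof -
  interpret monoid M by fact
  show ?thesis by unfold_locales (use assms in \<open>auto simp: Fix_def End_mult End_one\<close>)
qed

lemma monoid_norm_submonoid: "monoid_norm M \<nu> \<Longrightarrow> X \<subseteq> carrier M \<Longrightarrow> monoid_norm (M\<lparr>carrier := X\<rparr>) \<nu>"
  unfolding monoid_norm_def by (simp add: subset_iff)

lemma left_preGarsideD:
  assumes "left_preGarside M"
  shows "monoid M" "\<exists>\<nu>. monoid_norm M \<nu>"
    "\<And>a b c. a \<in> carrier M \<Longrightarrow> b \<in> carrier M \<Longrightarrow> c \<in> carrier M \<Longrightarrow> c \<otimes>\<^bsub>M\<^esub> a = c \<otimes>\<^bsub>M\<^esub> b \<Longrightarrow> a = b"
    "\<And>a b c. a \<in> carrier M \<Longrightarrow> b \<in> carrier M \<Longrightarrow> c \<in> carrier M \<Longrightarrow> a divides\<^bsub>M\<^esub> c \<Longrightarrow> b divides\<^bsub>M\<^esub> c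
       \<Longrightarrow> \<exists>m\<in>carrier M. m lcmof\<^bsub>M\<^esub> a b"
  using assms unfolding left_preGarside_def atomic_monoid_def by blast+

lemma left_preGarside_normed:
  assumes "left_preGarside M"
  obtains \<nu> where "normed_monoid M \<nu>"
  using left_preGarsideD(1,2)[OF assms] unfolding normed_monoid_def normed_monoid_axioms_def by blast

lemma Fix_divides:
  assumes "left_preGarside M" "\<phi> \<in> monoid_End M" "a \<in> Fix M \<phi>" "b \<in> Fix M \<phi>"
  shows "a divides\<^bsub>M\<lparr>carrier := Fix M \<phi>\<rparr>\<^esub> b \<longleftrightarrow> a divides\<^bsub>M\<^esub> b"
proof
  assume "a divides\<^bsub>M\<^esub> b"
  then obtain c where c: "c \<in> carrier M" "b = a \<otimes>\<^bsub>M\<^esub> c" by (auto simp: factor_def)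
  have "a \<otimes>\<^bsub>M\<^esub> \<phi> c = a \<otimes>\<^bsub>M\<^esub> c" using c assms End_mult[OF assms(2), of a c] by (auto simp: Fix_def)
  then have "\<phi> c = c"
    using left_preGarsideD(3)[OF assms(1)] c End_closed[OF assms(2)] assms(3) by (auto simp: Fix_def)
  then show "a divides\<^bsub>M\<lparr>carrier := Fix M \<phi>\<rparr>\<^esub> b" using c by (auto simp: factor_def Fix_def)
qed (auto simp: factor_def Fix_def)

text \<open>The lcm \<open>m\<close> of two fixed points in \<open>M\<close> need not be fixed, but \<open>\<phi> m\<close> is again a common multiple. The
increasing sequence of the iterates of \<open>m\<close> stays below every fixed common multiple, so it becomes
stationary.\<close>

lemma left_preGarside_Fix:
  assumes "left_preGarside M" "\<phi> \<in> monoid_End M"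
  shows "left_preGarside (M\<lparr>carrier := Fix M \<phi>\<rparr>)"
proof -
  let ?F = "M\<lparr>carrier := Fix M \<phi>\<rparr>"
  note pG = left_preGarsideD[OF assms(1)]
  interpret monoid M by (rule pG(1))
  obtain \<nu> where norm: "monoid_norm M \<nu>" using pG(2) by blast
  interpret normed_monoid M \<nu> by unfold_locales (rule norm)
  have "\<exists>m\<in>Fix M \<phi>. m lcmof\<^bsub>?F\<^esub> a b"
    if ab: "a \<in> Fix M \<phi>" "b \<in> Fix M \<phi>" and c: "c \<in> Fix M \<phi>" "a divides\<^bsub>?F\<^esub> c" "b divides\<^bsub>?F\<^esub> c" for a b c
  proof -
    have abc: "a \<in> carrier M" "b \<in> carrier M" "c \<in> carrier M" "\<phi> a = a" "\<phi> b = b" "\<phi> c = c"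
      using ab c(1) unfolding Fix_def by simp_all
    have "a divides\<^bsub>M\<^esub> c" "b divides\<^bsub>M\<^esub> c" using Fix_divides[OF assms] ab c by auto
    then obtain m where m: "m \<in> carrier M" "m lcmof\<^bsub>M\<^esub> a b" using pG(4) abc by blast
    define f where "f k = (\<phi> ^^ k) m" for k
    have fM: "f k \<in> carrier M" for k using End_closed[OF End_funpow[OF assms(2)] m(1)] by (simp add: f_def)
    have below: "f k divides\<^bsub>M\<^esub> d" if "d \<in> Fix M \<phi>" "a divides\<^bsub>M\<^esub> d" "b divides\<^bsub>M\<^esub> d" for k d
    proof -
      have d: "d \<in> carrier M" "\<phi> d = d" using that(1) unfolding Fix_def by blast+
      have "m divides\<^bsub>M\<^esub> d" using m(2) d(1) that(2,3) unfolding islcm_def by blast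
      then have "f k divides\<^bsub>M\<^esub> (\<phi> ^^ k) d"
        unfolding f_def by (rule End_divides[OF End_funpow[OF assms(2)] m(1)])
      then show ?thesis using funpow_fixed[of \<phi> d k] d(2) by simp
    qed
    have above: "a divides\<^bsub>M\<^esub> f k" "b divides\<^bsub>M\<^esub> f k" for k
    proof -
      have "a divides\<^bsub>M\<^esub> m" "b divides\<^bsub>M\<^esub> m" using m(2) unfolding islcm_def by blast+
      then have "(\<phi> ^^ k) a divides\<^bsub>M\<^esub> f k" "(\<phi> ^^ k) b divides\<^bsub>M\<^esub> f k"
        unfolding f_def using End_divides[OF End_funpow[OF assms(2)]] abc by blast+
      then show "a divides\<^bsub>M\<^esub> f k" "b divides\<^bsub>M\<^esub> f k"
        using funpow_fixed[of \<phi> a k] funpow_fixed[of \<phi> b k] abc by simp_all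
    qed
    have step: "f k divides\<^bsub>M\<^esub> f (Suc k)" for k
    proof -
      have "m divides\<^bsub>M\<^esub> f 1" using m(2) above[of 1] fM[of 1] unfolding islcm_def by blast
      then have "f k divides\<^bsub>M\<^esub> (\<phi> ^^ k) (f 1)"
        unfolding f_def by (rule End_divides[OF End_funpow[OF assms(2)] m(1)])
      then show ?thesis by (simp add: f_def funpow_swap1)
    qed
    have bound: "\<nu> (f k) \<le> \<nu> c" for k
      using divides_norm_le[OF fM below] c(1) \<open>a divides\<^bsub>M\<^esub> c\<close> \<open>b divides\<^bsub>M\<^esub> c\<close> by blast
    have "\<exists>k. f (Suc k) = f k"
    proof (rule ccontr)
      assume ne: "\<nexists>k. f (Suc k) = f k"
      have lt: "\<nu> (f k) < \<nu> (f (Suc k))" for k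
        using divides_norm_eq[OF fM step] ne by (metis not_le_imp_less)
      have "k \<le> \<nu> (f k)" for k
      proof (induction k)
        case (Suc k)
        then show ?case using lt[of k] by simp
      qed simp
      then have "Suc (\<nu> c) \<le> \<nu> (f (Suc (\<nu> c)))" by blast
      then show False using bound[of "Suc (\<nu> c)"] by simp
    qed
    then obtain k where "f (Suc k) = f k" by blast
    then have fF: "f k \<in> Fix M \<phi>" using fM by (simp add: Fix_def f_def)
    have "f k lcmof\<^bsub>?F\<^esub> a b"
      using fF above below ab Fix_divides[OF assms] by (auto simp: islcm_def)
    then show ?thesis using fF by blast
  qed
  moreover have "monoid ?F" by (rule submonoid.submonoid_is_monoid[OF submonoid_Fix[OF monoid_axioms assms(2)] monoid_axioms])
  moreover have "monoid_norm ?F \<nu>" by (rule monoid_norm_submonoid[OF norm]) (auto simp: Fix_def)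
  moreover have "\<forall>a\<in>Fix M \<phi>. \<forall>b\<in>Fix M \<phi>. \<forall>c\<in>Fix M \<phi>. c \<otimes>\<^bsub>M\<^esub> a = c \<otimes>\<^bsub>M\<^esub> b \<longrightarrow> a = b"
    using pG(3) by (auto simp: Fix_def)
  ultimately show ?thesis
    unfolding left_preGarside_def atomic_monoid_def by auto
qed

section \<open>Orbits of atoms under an endomorphism of finite order\<close>

definition is_lub :: "('a, 'm) monoid_scheme \<Rightarrow> 'a set \<Rightarrow> 'a \<Rightarrow> bool" where
  "is_lub M A d \<longleftrightarrow> d \<in> carrier M \<and> (\<forall>a\<in>A. a divides\<^bsub>M\<^esub> d) \<and>
     (\<forall>c\<in>carrier M. (\<forall>a\<in>A. a divides\<^bsub>M\<^esub> c) \<longrightarrow> d divides\<^bsub>M\<^esub> c)"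

lemma is_lub_unique:
  assumes "left_preGarside M" "is_lub M A d" "is_lub M A e"
  shows "d = e"
proof -
  obtain \<nu> where "normed_monoid M \<nu>" using left_preGarside_normed[OF assms(1)] .
  then interpret normed_monoid M \<nu> .
  show ?thesis by (rule divides_antisym) (use assms in \<open>auto simp: is_lub_def\<close>)
qed

lemma finite_lub_exists:
  assumes "left_preGarside M" "finite A" "A \<subseteq> carrier M" "c \<in> carrier M" "\<And>a. a \<in> A \<Longrightarrow> a divides\<^bsub>M\<^esub> c"
  shows "\<exists>d. is_lub M A d"
  using assms(2,3,5)
proof (induction A)
  case empty
  interpret monoid M by (rule left_preGarsideD(1)[OF assms(1)])
  have "is_lub M {} \<one>\<^bsub>M\<^esub>" by (auto simp: is_lub_def factor_def)
  then show ?case by blast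
next
  case (insert a A)
  interpret monoid M by (rule left_preGarsideD(1)[OF assms(1)])
  obtain d where d: "is_lub M A d" using insert by auto
  have "d divides\<^bsub>M\<^esub> c" using d insert assms(4) by (auto simp: is_lub_def)
  then obtain e where e: "e \<in> carrier M" "e lcmof\<^bsub>M\<^esub> a d"
    using left_preGarsideD(4)[OF assms(1), of a d c] d insert.prems assms(4) by (auto simp: is_lub_def)
  have "is_lub M (insert a A) e"
    unfolding is_lub_def
  proof (intro conjI ballI impI)
    show "e \<in> carrier M" by fact
    show "b divides\<^bsub>M\<^esub> e" if "b \<in> insert a A" for b
      using that d e insert.prems(1) by (auto simp: is_lub_def islcm_def intro: divides_trans)
    show "e divides\<^bsub>M\<^esub> x" if "x \<in> carrier M" "\<forall>b\<in>insert a A. b divides\<^bsub>M\<^esub> x" for x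
      using that d e by (auto simp: is_lub_def islcm_def)
  qed
  then show ?case by blast
qed

definition orbit :: "('a \<Rightarrow> 'a) \<Rightarrow> 'a \<Rightarrow> 'a set" where
  "orbit \<phi> s = range (\<lambda>i. (\<phi> ^^ i) s)"

definition orbit_lubs :: "('a, 'm) monoid_scheme \<Rightarrow> ('a \<Rightarrow> 'a) \<Rightarrow> 'a set" where
  "orbit_lubs M \<phi> = {d. \<exists>s\<in>atoms M. is_lub M (orbit \<phi> s) d}"

lemma self_in_orbit: "s \<in> orbit \<phi> s"
  unfolding orbit_def by (rule range_eqI[of _ _ 0]) simp

locale finite_order_End =
  fixes M :: "('a, 'm) monoid_scheme" (structure) and \<phi> :: "'a \<Rightarrow> 'a" and N :: nat
  assumes preGarside: "left_preGarside M" and End: "\<phi> \<in> monoid_End M"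
    and N_pos: "N \<ge> 1" and order: "\<And>x. x \<in> carrier M \<Longrightarrow> (\<phi> ^^ N) x = x"
begin

lemma funpow_mod: "x \<in> carrier M \<Longrightarrow> (\<phi> ^^ i) x = (\<phi> ^^ (i mod N)) x"
  by (metis funpow_mod_eq order)

lemma finite_orbit: "x \<in> carrier M \<Longrightarrow> finite (orbit \<phi> x)"
proof -
  assume x: "x \<in> carrier M"
  have "orbit \<phi> x \<subseteq> (\<lambda>i. (\<phi> ^^ i) x) ` {..<N}"
  proof
    fix y assume "y \<in> orbit \<phi> x"
    then obtain i where "y = (\<phi> ^^ i) x" by (auto simp: orbit_def)
    then have "y = (\<phi> ^^ (i mod N)) x" using funpow_mod x by metis
    then show "y \<in> (\<lambda>i. (\<phi> ^^ i) x) ` {..<N}" using N_pos by auto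
  qed
  then show ?thesis using finite_subset by blast
qed

lemma orbit_subset: "x \<in> carrier M \<Longrightarrow> orbit \<phi> x \<subseteq> carrier M"
  using End_closed[OF End_funpow[OF End]] by (auto simp: orbit_def)

lemma orbit_preimage:
  assumes "x \<in> carrier M" "y \<in> orbit \<phi> x"
  obtains z where "z \<in> orbit \<phi> x" "\<phi> z = y"
proof -
  obtain i where i: "y = (\<phi> ^^ i) x" using assms by (auto simp: orbit_def)
  have yM: "y \<in> carrier M" using orbit_subset assms by blast
  obtain N0 where N0: "N = Suc N0" using N_pos by (cases N) auto
  let ?z = "(\<phi> ^^ N0) y"
  have "?z = (\<phi> ^^ (N0 + i)) x" by (simp add: i funpow_add)
  moreover have "\<phi> ?z = y" using order[OF yM] N0 by simp
  ultimately show ?thesis using that[of ?z] by (auto simp: orbit_def)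
qed

text \<open>If \<open>\<phi>\<close> permutes \<open>A\<close>, then \<open>d \<preceq> \<phi> d \<preceq> \<dots> \<preceq> \<phi>\<^sup>N d = d\<close> for the least upper bound \<open>d\<close> of \<open>A\<close>.\<close>

lemma lub_of_invariant_fixed:
  assumes "A \<subseteq> carrier M" "\<And>a. a \<in> A \<Longrightarrow> \<exists>b\<in>A. \<phi> b = a" "is_lub M A d"
  shows "d \<in> Fix M \<phi>"
proof -
  obtain \<nu> where "normed_monoid M \<nu>" using left_preGarside_normed[OF preGarside] .
  then interpret normed_monoid M \<nu> .
  have dM: "d \<in> carrier M" using assms(3) by (simp add: is_lub_def)
  have fM: "(\<phi> ^^ k) d \<in> carrier M" for k using End_closed[OF End_funpow[OF End] dM] .
  have "a divides \<phi> d" if a: "a \<in> A" for a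
  proof -
    obtain b where b: "b \<in> A" "\<phi> b = a" using assms(2) a by blast
    then have "b divides d" using assms(3) by (simp add: is_lub_def)
    then show ?thesis using End_divides[OF End, of b d] b assms(1) by auto
  qed
  then have le: "d divides \<phi> d" using assms(3) fM[of 1] by (simp add: is_lub_def)
  have chain: "\<phi> d divides (\<phi> ^^ Suc k) d" for k
  proof (induction k)
    case (Suc k)
    have "(\<phi> ^^ Suc k) d divides (\<phi> ^^ Suc k) (\<phi> d)"
      using End_divides[OF End_funpow[OF End] dM le] .
    then show ?case using divides_trans[OF Suc] fM[of 1] by (simp add: funpow_swap1)
  qed (use fM[of 1] in simp)
  obtain N0 where N0: "N = Suc N0" using N_pos by (cases N) auto
  then have "\<phi> d divides d" using chain[of N0] order[OF dM] by simp
  then have "\<phi> d = d" using divides_antisym le dM fM[of 1] by simp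
  then show ?thesis using dM by (simp add: Fix_def)
qed

lemma orbit_lubs_subset_Fix: "orbit_lubs M \<phi> \<subseteq> Fix M \<phi>"
proof
  fix d assume "d \<in> orbit_lubs M \<phi>"
  then obtain s where s: "s \<in> atoms M" "is_lub M (orbit \<phi> s) d" by (auto simp: orbit_lubs_def)
  then have "s \<in> carrier M" by (simp add: atoms_def)
  then show "d \<in> Fix M \<phi>"
    using lub_of_invariant_fixed[OF orbit_subset _ s(2)] orbit_preimage by metis
qed

lemma finite_orbit_lubs: 
  assumes "finite (atoms M)"
  shows "finite (orbit_lubs M \<phi>)"
proof -
  have "orbit_lubs M \<phi> \<subseteq> (\<lambda>s. THE d. is_lub M (orbit \<phi> s) d) ` atoms M"
  proof
    fix d assume "d \<in> orbit_lubs M \<phi>"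
    then obtain s where s: "s \<in> atoms M" "is_lub M (orbit \<phi> s) d" by (auto simp: orbit_lubs_def)
    then have "(THE d. is_lub M (orbit \<phi> s) d) = d"
      using is_lub_unique[OF preGarside] by blast
    then show "d \<in> (\<lambda>s. THE d. is_lub M (orbit \<phi> s) d) ` atoms M" using s by (metis image_eqI)
  qed
  then show ?thesis using assms finite_subset by blast
qed

lemma orbit_bounded:
  assumes "s \<in> carrier M" "y \<in> Fix M \<phi>" "s divides y" "t \<in> orbit \<phi> s"
  shows "t divides y"
proof -
  obtain i where "t = (\<phi> ^^ i) s" using assms(4) by (auto simp: orbit_def)
  then show ?thesis
    using End_divides[OF End_funpow[OF End] assms(1,3), of i] funpow_fixed[of \<phi> y i] assms(2) by (simp add: Fix_def)
qed

lemma orbit_lub_divisor: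
  assumes "s \<in> atoms M" "y \<in> Fix M \<phi>" "s divides y"
  obtains d where "is_lub M (orbit \<phi> s) d" "d \<in> orbit_lubs M \<phi>" "d divides y"
proof -
  have s: "s \<in> carrier M" and y: "y \<in> carrier M" using assms by (auto simp: atoms_def Fix_def)
  obtain d where d: "is_lub M (orbit \<phi> s) d"
    using finite_lub_exists[OF preGarside finite_orbit[OF s] orbit_subset[OF s] y]
      orbit_bounded[OF s assms(2,3)] by blast
  moreover have "d divides y" using d y orbit_bounded[OF s assms(2,3)] by (simp add: is_lub_def)
  ultimately show ?thesis using that assms(1) by (auto simp: orbit_lubs_def)
qed

text \<open>A fixed point divisible by an atom is divisible by the whole orbit of this atom, hence by the least upper
bound of the orbit, and the quotient is again fixed.\<close>

lemma Fix_generated_by_orbit_lubs: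
  "Fix M \<phi> = word_eval M ` lists (orbit_lubs M \<phi>)"
proof -
  obtain \<nu> where "normed_monoid M \<nu>" using left_preGarside_normed[OF preGarside] .
  then interpret normed_monoid M \<nu> .
  interpret F: submonoid "Fix M \<phi>" M by (rule submonoid_Fix[OF monoid_axioms End])
  have "y \<in> word_eval M ` lists (orbit_lubs M \<phi>)" if "y \<in> Fix M \<phi>" for y
    using that
  proof (induction "\<nu> y" arbitrary: y rule: less_induct)
    case less
    have yM: "y \<in> carrier M" using less.prems F.subset by blast
    show ?case
    proof (cases "y = \<one>")
      case True
      then show ?thesis by (auto intro!: image_eqI[of _ _ "[]"])
    next
      case False
      then obtain s where s: "s \<in> atoms M" "s divides y" using atom_divisor yM by blast
      then obtain d where d: "is_lub M (orbit \<phi> s) d" "d \<in> orbit_lubs M \<phi>" "d divides y"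
        using orbit_lub_divisor less.prems by blast
      have dF: "d \<in> Fix M \<phi>" using d orbit_lubs_subset_Fix by blast
      then have "d divides\<^bsub>M\<lparr>carrier := Fix M \<phi>\<rparr>\<^esub> y"
        using Fix_divides[OF preGarside End dF less.prems] d by simp
      then obtain z where z: "z \<in> Fix M \<phi>" "y = d \<otimes> z" by (auto simp: factor_def)
      have sc: "s \<in> carrier M" "s \<noteq> \<one>" using s by (auto simp: atoms_def)
      have "s divides d" using d(1) self_in_orbit unfolding is_lub_def by metis
      then have "0 < \<nu> d" using divides_norm_le[OF sc(1)] norm_pos[OF sc] by fastforce
      then have "\<nu> z < \<nu> y" using norm_mult_ge[of d z] z dF F.subset by auto
      then obtain w where w: "w \<in> lists (orbit_lubs M \<phi>)" "z = word_eval M w"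
        using less.hyps z(1) by blast
      have "d # w \<in> lists (orbit_lubs M \<phi>)" "y = word_eval M (d # w)" using w z(2) d(2) by simp_all
      then show ?thesis by blast
    qed
  qed
  then have "Fix M \<phi> \<subseteq> word_eval M ` lists (orbit_lubs M \<phi>)" by (rule subsetI)
  moreover have "word_eval M ` lists (orbit_lubs M \<phi>) \<subseteq> Fix M \<phi>"
  proof (rule image_subsetI)
    fix w assume "w \<in> lists (orbit_lubs M \<phi>)"
    then have "w \<in> lists (Fix M \<phi>)" using lists_mono[OF orbit_lubs_subset_Fix] by (rule rev_subsetD)
    then show "word_eval M w \<in> Fix M \<phi>" by (rule F.word_eval_in_submonoid)
  qed
  ultimately show ?thesis by (rule equalityI)
qed

lemma fin_gen_Fix:
  assumes "fin_gen_monoid M"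
  shows "fin_gen_monoid (M\<lparr>carrier := Fix M \<phi>\<rparr>)"
proof -
  obtain \<nu> where "normed_monoid M \<nu>" using left_preGarside_normed[OF preGarside] .
  then interpret normed_monoid M \<nu> .
  have "monoid (M\<lparr>carrier := Fix M \<phi>\<rparr>)"
    using submonoid.submonoid_is_monoid[OF submonoid_Fix[OF monoid_axioms End] monoid_axioms] .
  then show ?thesis
    unfolding fin_gen_monoid_def
    using finite_orbit_lubs[OF finite_atoms[OF assms]] orbit_lubs_subset_Fix Fix_generated_by_orbit_lubs
    by (auto intro!: exI[of _ "orbit_lubs M \<phi>"])
qed

end

section \<open>Periodic points\<close>

text \<open>The powers of a self-map of a finite set are eventually periodic; a large multiple of the period is
idempotent.\<close>

lemma idempotent_power:
  assumes "finite X" "f ` X \<subseteq> X"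
  obtains N where "N \<ge> 1" "N \<ge> n" "\<And>x. x \<in> X \<Longrightarrow> (f ^^ N) ((f ^^ N) x) = (f ^^ N) x"
proof -
  have fX: "f y \<in> X" if "y \<in> X" for y using assms(2) that by blast
  have X: "(f ^^ i) x \<in> X" if "x \<in> X" for i x
    by (induction i) (simp_all add: that fX)
  let ?r = "\<lambda>i. restrict (f ^^ i) X"
  have "range ?r \<subseteq> X \<rightarrow>\<^sub>E X" by (rule image_subsetI, rule restrict_PiE_iff[THEN iffD2]) (use X in blast)
  moreover have "finite (X \<rightarrow>\<^sub>E X)" using assms(1) by (intro finite_PiE)
  ultimately have "finite (range ?r)" by (rule finite_subset)
  then have "\<not> inj ?r" using finite_imageD infinite_UNIV_nat by blast
  then obtain a b where "a \<noteq> b" "?r a = ?r b" unfolding inj_on_def by blast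
  then obtain i j where ij: "i < j" "?r i = ?r j" by (cases "a < b") (metis linorder_neqE_nat)+
  define p where "p = j - i"
  have eq: "(f ^^ i) x = (f ^^ (i + p)) x" if "x \<in> X" for x
    using fun_cong[OF ij(2), of x] that ij(1) by (simp add: p_def)
  have per: "(f ^^ (a + p)) x = (f ^^ a) x" if "x \<in> X" "a \<ge> i" for a x
  proof -
    define b where "b = a - i"
    then have b: "a = b + i" using that(2) by simp
    have "(f ^^ (a + p)) x = (f ^^ b) ((f ^^ (i + p)) x)" unfolding b by (simp add: funpow_add)
    then show ?thesis using eq[OF that(1)] b by (simp add: funpow_add)
  qed
  have per': "(f ^^ (a + q * p)) x = (f ^^ a) x" if "x \<in> X" "a \<ge> i" for a q x
  proof (induction q)
    case (Suc q)
    then show ?case using per[OF that(1), of "a + q * p"] that by (simp add: algebra_simps)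
  qed simp
  \<comment> \<open>A multiple of the period \<open>p\<close> beyond the preperiod \<open>i\<close> and beyond the prescribed bound \<open>n\<close>.\<close>
  define N where "N = (i + n + 1) * p"
  have p: "p \<ge> 1" using ij by (simp add: p_def)
  have "i + n + 1 \<le> N" unfolding N_def using mult_le_mono2[OF p, of "i + n + 1"] by simp
  then have N: "N \<ge> i" "N \<ge> n" "N \<ge> 1" by simp_all
  show ?thesis
  proof (rule that[of N])
    fix x assume "x \<in> X"
    then have "(f ^^ (N + N)) x = (f ^^ N) x" using per'[of x N "i + n + 1"] N(1) by (simp add: N_def)
    then show "(f ^^ N) ((f ^^ N) x) = (f ^^ N) x" by (simp add: funpow_add)
  qed (use N in auto)
qed

lemma End_eq_on_generators:
  assumes "monoid M" "h \<in> monoid_End M" "k \<in> monoid_End M" "carrier M = word_eval M ` lists A" "A \<subseteq> carrier M"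
    "\<And>a. a \<in> A \<Longrightarrow> h a = k a" "x \<in> carrier M"
  shows "h x = k x"
  by (rule monoid.hom_eq_on_generators[OF assms(1) _ _ _ assms(4,5,6,7)])
     (use assms(2,3) in \<open>auto simp: monoid_End_def\<close>)

lemma End_comp: "h \<in> monoid_End M \<Longrightarrow> k \<in> monoid_End M \<Longrightarrow> (\<lambda>x. h (k x)) \<in> monoid_End M"
  by (auto simp: monoid_End_def hom_def Pi_iff)

text \<open>The power with exponent \<open>n_index\<close> kills every atom that some power kills. If no atom is sent
to \<open>1\<close>, then no element other than \<open>1\<close> is, and nothing is ever killed.\<close>

lemma (in normed_monoid) eventually_killed_in_S1:
  assumes End: "\<phi> \<in> monoid_End G" and fin: "finite (atoms G)"
    and s: "s \<in> atoms G" and k: "(\<phi> ^^ k) s = \<one>"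
  shows "s \<in> S1 G \<phi>"
proof (cases "\<one> \<in> \<phi> ` atoms G")
  case True
  let ?K = "{k. k \<ge> 1 \<and> (\<exists>s\<in>atoms G. (\<phi> ^^ k) s = \<one> \<and> (\<phi> ^^ (k - 1)) s \<noteq> \<one>)}"
  have stay: "(\<phi> ^^ j) s = \<one>" if "(\<phi> ^^ i) s = \<one>" "i \<le> j" for i j s
  proof -
    have "j = (j - i) + i" using that(2) by simp
    then have "(\<phi> ^^ j) s = (\<phi> ^^ (j - i)) ((\<phi> ^^ i) s)" by (metis comp_apply funpow_add)
    then show ?thesis using that(1) End_one[OF End_funpow[OF End]] by (simp add: funpow_add)
  qed
  have "?K \<subseteq> (\<lambda>s. THE k. k \<ge> 1 \<and> (\<phi> ^^ k) s = \<one> \<and> (\<phi> ^^ (k - 1)) s \<noteq> \<one>) ` atoms G"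
  proof
    fix k assume "k \<in> ?K"
    then obtain s where s: "s \<in> atoms G" "k \<ge> 1" "(\<phi> ^^ k) s = \<one>" "(\<phi> ^^ (k - 1)) s \<noteq> \<one>" by blast
    have "(THE k. k \<ge> 1 \<and> (\<phi> ^^ k) s = \<one> \<and> (\<phi> ^^ (k - 1)) s \<noteq> \<one>) = k"
    proof (rule the_equality)
      fix l assume l: "l \<ge> 1 \<and> (\<phi> ^^ l) s = \<one> \<and> (\<phi> ^^ (l - 1)) s \<noteq> \<one>"
      show "l = k"
      proof (rule ccontr)
        assume "l \<noteq> k"
        then have "l \<le> k - 1 \<or> k \<le> l - 1" by linarith
        then show False using stay[of l s "k - 1"] stay[of k s "l - 1"] l s by blast
      qed
    qed (use s in auto)
    then show "k \<in> (\<lambda>s. THE k. k \<ge> 1 \<and> (\<phi> ^^ k) s = \<one> \<and> (\<phi> ^^ (k - 1)) s \<noteq> \<one>) ` atoms G"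
      using s(1) by (metis (lifting) image_eqI)
  qed
  then have finK: "finite ?K" using fin finite_subset by blast
  define l where "l = (LEAST k. (\<phi> ^^ k) s = \<one>)"
  have l: "(\<phi> ^^ l) s = \<one>" unfolding l_def by (rule LeastI[of _ k]) (rule k)
  have l1: "l \<ge> 1"
  proof (rule ccontr)
    assume "\<not> l \<ge> 1"
    then have "l = 0" by simp
    then show False using l s by (simp add: atoms_def)
  qed
  then have "l - 1 < (LEAST k. (\<phi> ^^ k) s = \<one>)" by (simp flip: l_def)
  then have "(\<phi> ^^ (l - 1)) s \<noteq> \<one>" by (rule not_less_Least)
  then have "\<exists>s\<in>atoms G. (\<phi> ^^ l) s = \<one> \<and> (\<phi> ^^ (l - 1)) s \<noteq> \<one>" using s l by blast
  then have "l \<in> ?K" using l1 by simp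
  then have "l \<le> Max ?K" using finK by (rule Max_ge[rotated])
  then have "(\<phi> ^^ n_index G \<phi>) s = \<one>" using stay[OF l] True by (simp add: n_index_def)
  then show ?thesis using s by (simp add: S1_def)
next
  case False
  have step: "\<phi> x \<noteq> \<one>" if x: "x \<in> carrier G" "x \<noteq> \<one>" for x
  proof
    assume e: "\<phi> x = \<one>"
    obtain t where t: "t \<in> atoms G" "t divides x" using atom_divisor x by blast
    then obtain z where z: "z \<in> carrier G" "x = t \<otimes> z" by (auto simp: factor_def)
    have tc: "t \<in> carrier G" using t by (simp add: atoms_def)
    have "\<phi> t \<otimes> \<phi> z = \<one>" using e End_mult[OF End tc z(1)] z(2) by simp
    then have "\<phi> t = \<one>" using mult_eq_one End_closed[OF End] tc z(1) by blast
    then show False using False t(1) by force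
  qed
  have sc: "s \<in> carrier G" "s \<noteq> \<one>" using s by (auto simp: atoms_def)
  have "(\<phi> ^^ i) s \<noteq> \<one>" for i
  proof (induction i)
    case (Suc i)
    then show ?case using step End_closed[OF End_funpow[OF End] sc(1)] by simp
  qed (use sc in simp)
  then show ?thesis using k by blast
qed

text \<open>The setting in which the periodic points can be described: deleting the letters of \<open>S1\<close> is a morphism, and the
norm counts the letters of words in the atoms up to a factor.\<close>

locale deletion = normed_monoid M \<nu> for M :: "('a, 'm) monoid_scheme" (structure) and \<nu> +
  fixes \<phi> :: "'a \<Rightarrow> 'a"
  assumes End: "\<phi> \<in> monoid_End M"
    and finite_atoms: "finite (atoms M)"
    and additive: "additive_norm M \<nu>"
    and homogeneous: "homogeneous_norm M \<nu>"
    and pi: "pi_well_defined M (S2 M \<phi>)"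
begin

lemma atoms_carrier: "atoms M \<subseteq> carrier M"
  by (auto simp: atoms_def)

lemma S2_atoms: "S2 M \<phi> \<subseteq> atoms M"
  by (auto simp: S2_def)

lemma S2_carrier: "S2 M \<phi> \<subseteq> carrier M"
  using atoms_carrier S2_atoms by blast

lemma atom_norm: obtains c where "c > 0" "\<And>s. s \<in> atoms M \<Longrightarrow> \<nu> s = c"
proof (cases "atoms M = {}")
  case False
  then obtain a where a: "a \<in> atoms M" by blast
  show ?thesis
  proof (rule that[of "\<nu> a"])
    show "\<nu> a > 0" using a norm_pos by (auto simp: atoms_def)
    show "\<nu> s = \<nu> a" if "s \<in> atoms M" for s
      using homogeneous a that unfolding homogeneous_norm_def by blast
  qed
qed (use that[of 1] in auto)

lemma norm_mult: "a \<in> carrier M \<Longrightarrow> b \<in> carrier M \<Longrightarrow> \<nu> (a \<otimes> b) = \<nu> a + \<nu> b"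
  using additive by (auto simp: additive_norm_def)

lemma norm_word_eval:
  assumes "\<And>s. s \<in> atoms M \<Longrightarrow> \<nu> s = c" "w \<in> lists (atoms M)"
  shows "\<nu> (word_eval M w) = c * length w"
  using assms(2)
proof (induction w)
  case (Cons a w)
  have "w \<in> lists (carrier M)" "a \<in> carrier M" using Cons.hyps lists_mono[OF atoms_carrier] atoms_carrier by auto
  then show ?case using Cons assms(1) norm_mult[OF _ word_eval_closed] by simp
qed (simp add: norm_one)

text \<open>The morphism \<open>\<pi>\<close> induced by deleting the letters of \<open>S1\<close>.\<close>

definition proj :: "'a \<Rightarrow> 'a" where
  "proj x = word_eval M (pi_word (S2 M \<phi>) (SOME w. w \<in> lists (atoms M) \<and> word_eval M w = x))"

lemma proj_word_eval:
  assumes "w \<in> lists (atoms M)"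
  shows "proj (word_eval M w) = word_eval M (pi_word (S2 M \<phi>) w)"
proof -
  let ?v = "SOME v. v \<in> lists (atoms M) \<and> word_eval M v = word_eval M w"
  have "?v \<in> lists (atoms M) \<and> word_eval M ?v = word_eval M w"
    by (rule someI[of _ w]) (use assms in simp)
  then show ?thesis using pi assms unfolding pi_well_defined_def proj_def by blast
qed

lemma proj_in_S2: 
  assumes "x \<in> carrier M"
  shows "proj x \<in> word_eval M ` lists (S2 M \<phi>)"
proof -
  obtain w where w: "w \<in> lists (atoms M)" "x = word_eval M w" using generated_by_atoms assms by blast
  have "pi_word (S2 M \<phi>) w \<in> lists (S2 M \<phi>)" by (auto simp: pi_word_def)
  then show ?thesis using proj_word_eval w by auto
qed

lemma generated_S2_closed: "w \<in> lists (S2 M \<phi>) \<Longrightarrow> word_eval M w \<in> carrier M"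
  by (rule word_eval_closed) (rule lists_subsetD[OF S2_carrier])

lemma S2_span_closed: "y \<in> word_eval M ` lists (S2 M \<phi>) \<Longrightarrow> y \<in> carrier M"
  by (erule imageE) (simp only: generated_S2_closed)

lemma proj_closed: "x \<in> carrier M \<Longrightarrow> proj x \<in> carrier M"
  by (rule S2_span_closed[OF proj_in_S2])

lemma proj_on_S2: "w \<in> lists (S2 M \<phi>) \<Longrightarrow> proj (word_eval M w) = word_eval M w"
proof -
  assume w: "w \<in> lists (S2 M \<phi>)"
  then have "w \<in> lists (atoms M)" by (rule lists_subsetD[OF S2_atoms])
  moreover have "pi_word (S2 M \<phi>) w = w" using w by (auto simp: pi_word_def filter_id_conv)
  ultimately show ?thesis using proj_word_eval by simp
qed

lemma proj_S1: "s \<in> S1 M \<phi> \<Longrightarrow> proj s = \<one>"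
proof -
  assume s: "s \<in> S1 M \<phi>"
  then have "s \<in> atoms M" "s \<in> carrier M" "s \<notin> S2 M \<phi>" by (auto simp: S1_def S2_def atoms_def)
  then show ?thesis using proj_word_eval[of "[s]"] by (simp add: pi_word_def)
qed

lemma proj_End: "proj \<in> monoid_End M"
proof -
  have "proj (x \<otimes> y) = proj x \<otimes> proj y" if xy: "x \<in> carrier M" "y \<in> carrier M" for x y
  proof -
    obtain u where u: "u \<in> lists (atoms M)" "x = word_eval M u" using generated_by_atoms[OF xy(1)] by blast
    obtain v where v: "v \<in> lists (atoms M)" "y = word_eval M v" using generated_by_atoms[OF xy(2)] by blast
    note uv = u(1) v(1) u(2) v(2)
    have c: "u \<in> lists (carrier M)" "v \<in> lists (carrier M)"
      by (rule lists_subsetD[OF atoms_carrier uv(1)], rule lists_subsetD[OF atoms_carrier uv(2)])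
    have f: "pi_word (S2 M \<phi>) u \<in> lists (carrier M)" "pi_word (S2 M \<phi>) v \<in> lists (carrier M)"
      using c by (auto simp: pi_word_def)
    have "proj (x \<otimes> y) = word_eval M (pi_word (S2 M \<phi>) (u @ v))"
      using proj_word_eval[of "u @ v"] uv word_eval_append[OF c] by simp
    also have "\<dots> = proj x \<otimes> proj y"
      using word_eval_append[OF f] proj_word_eval uv by (simp add: pi_word_def)
    finally show ?thesis .
  qed
  moreover have "proj \<one> = \<one>" using proj_on_S2[of "[]"] by simp
  ultimately show ?thesis using proj_closed by (auto simp: monoid_End_def hom_def)
qed

abbreviation kill_time :: nat where "kill_time \<equiv> n_index M \<phi>"

lemma funpow_n_proj:
  assumes "x \<in> carrier M"
  shows "(\<phi> ^^ kill_time) (proj x) = (\<phi> ^^ kill_time) x"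
proof (rule End_eq_on_generators[OF monoid_axioms End_comp[OF End_funpow[OF End] proj_End]
      End_funpow[OF End] carrier_eq_atoms atoms_carrier _ assms])
  fix a assume a: "a \<in> atoms M"
  show "(\<phi> ^^ kill_time) (proj a) = (\<phi> ^^ kill_time) a"
  proof (cases "a \<in> S1 M \<phi>")
    case True
    then show ?thesis using proj_S1 End_one[OF End_funpow[OF End]] by (simp add: S1_def)
  next
    case False
    then have "proj a = a" using proj_on_S2[of "[a]"] a atoms_carrier by (auto simp: S2_def)
    then show ?thesis by simp
  qed
qed

lemma funpow_proj:
  assumes "x \<in> carrier M" "j \<ge> kill_time"
  shows "(\<phi> ^^ j) (proj x) = (\<phi> ^^ j) x"
proof -
  obtain b where "j = b + kill_time" using assms(2) by (metis add.commute le_Suc_ex)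
  then show ?thesis using funpow_n_proj[OF assms(1)] by (simp add: funpow_add)
qed

lemma proj_phi_S1:
  assumes "s \<in> S1 M \<phi>"
  shows "proj (\<phi> s) = \<one>"
proof -
  have s: "s \<in> carrier M" "(\<phi> ^^ kill_time) s = \<one>" using assms by (auto simp: S1_def atoms_def)
  obtain w where w: "w \<in> lists (atoms M)" "\<phi> s = word_eval M w"
    using generated_by_atoms End_closed[OF End s(1)] by blast
  have wc: "w \<in> lists (carrier M)" by (rule lists_subsetD[OF atoms_carrier w(1)])
  have "(\<phi> ^^ kill_time) (\<phi> s) = \<one>" using s(2) End_one[OF End] by (simp add: funpow_swap1[symmetric])
  then have "word_eval M (map (\<phi> ^^ kill_time) w) = \<one>"
    using End_word_eval[OF monoid_axioms End_funpow[OF End] wc] w(2) by simp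
  moreover have "map (\<phi> ^^ kill_time) w \<in> lists (carrier M)"
    using wc End_closed[OF End_funpow[OF End]] by auto
  ultimately have "set (map (\<phi> ^^ kill_time) w) \<subseteq> {\<one>}" by (rule word_eval_eq_one[rotated])
  then have "set w \<subseteq> S1 M \<phi>" using eventually_killed_in_S1[OF End finite_atoms] w(1) by auto
  then have "pi_word (S2 M \<phi>) w = []" by (auto simp: pi_word_def filter_empty_conv S2_def)
  then show ?thesis using proj_word_eval[OF w(1)] w(2) by simp
qed

definition \<psi> :: "'a \<Rightarrow> 'a" where
  "\<psi> x = proj (\<phi> x)"

lemma psi_End: "\<psi> \<in> monoid_End M"
  using End_comp[OF proj_End End] by (simp add: \<psi>_def[abs_def])

lemma psi_proj:
  assumes "x \<in> carrier M"
  shows "\<psi> (proj x) = proj (\<phi> x)"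
  unfolding \<psi>_def
proof (rule End_eq_on_generators[OF monoid_axioms End_comp[OF proj_End End_comp[OF End proj_End]]
      End_comp[OF proj_End End] carrier_eq_atoms atoms_carrier _ assms])
  fix a assume a: "a \<in> atoms M"
  show "proj (\<phi> (proj a)) = proj (\<phi> a)"
  proof (cases "a \<in> S1 M \<phi>")
    case True
    then show ?thesis using proj_S1 proj_phi_S1 End_one[OF End] End_one[OF proj_End] by simp
  next
    case False
    then have "proj a = a" using proj_on_S2[of "[a]"] a atoms_carrier by (auto simp: S2_def)
    then show ?thesis by simp
  qed
qed

lemma proj_funpow:
  assumes "x \<in> carrier M"
  shows "proj ((\<phi> ^^ j) x) = (\<psi> ^^ j) (proj x)"
proof (induction j)
  case (Suc j)
  have "proj ((\<phi> ^^ Suc j) x) = \<psi> (proj ((\<phi> ^^ j) x))"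
    using psi_proj[OF End_closed[OF End_funpow[OF End] assms]] by simp
  then show ?case using Suc by simp
qed simp

lemma psi_S2_neq_one:
  assumes "s \<in> S2 M \<phi>"
  shows "\<psi> s \<noteq> \<one>"
proof
  assume e: "\<psi> s = \<one>"
  have s: "s \<in> atoms M" "s \<in> carrier M" "s \<notin> S1 M \<phi>" using assms by (auto simp: S2_def atoms_def)
  have "(\<phi> ^^ kill_time) (\<phi> s) = \<one>"
    using funpow_n_proj[OF End_closed[OF End s(2)]] e End_one[OF End_funpow[OF End]] by (simp add: \<psi>_def)
  then have "(\<phi> ^^ Suc kill_time) s = \<one>" by (simp add: funpow_swap1)
  then show False using eventually_killed_in_S1[OF End finite_atoms s(1)] s(3) by blast
qed

lemma psi_in_S2: "x \<in> carrier M \<Longrightarrow> \<psi> x \<in> word_eval M ` lists (S2 M \<phi>)"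
  unfolding \<psi>_def by (rule proj_in_S2) (rule End_closed[OF End])

text \<open>Since \<open>\<psi>\<close> kills no surviving atom, every letter contributes at least its own norm. When nothing is
gained, each letter is mapped to an element of minimal norm, that is, to a letter.\<close>

lemma psi_norm:
  assumes c: "c > 0" "\<And>s. s \<in> atoms M \<Longrightarrow> \<nu> s = c" and w: "w \<in> lists (S2 M \<phi>)"
  shows "c * length w \<le> \<nu> (\<psi> (word_eval M w))"
    and "\<nu> (\<psi> (word_eval M w)) \<le> c * length w \<Longrightarrow> \<psi> ` set w \<subseteq> S2 M \<phi>"
proof -
  have letter: "c \<le> \<nu> (\<psi> s)" "\<nu> (\<psi> s) \<le> c \<Longrightarrow> \<psi> s \<in> S2 M \<phi>" if s: "s \<in> S2 M \<phi>" for s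
  proof -
    have "s \<in> carrier M" using s S2_carrier by blast
    then obtain v where v: "v \<in> lists (S2 M \<phi>)" "\<psi> s = word_eval M v" using psi_in_S2 by blast
    have "v \<in> lists (atoms M)" by (rule lists_subsetD[OF S2_atoms v(1)])
    then have nv: "\<nu> (\<psi> s) = c * length v" using norm_word_eval[OF c(2)] v(2) by simp
    have "v \<noteq> []" using v(2) psi_S2_neq_one[OF s] by auto
    then show "c \<le> \<nu> (\<psi> s)" using nv by (cases v) auto
    assume "\<nu> (\<psi> s) \<le> c"
    then have "length v \<le> 1" using nv c(1) by simp
    then obtain t where "v = [t]" using \<open>v \<noteq> []\<close> by (cases v) auto
    then show "\<psi> s \<in> S2 M \<phi>" using v S2_carrier by auto
  qed
  have "c * length w \<le> \<nu> (\<psi> (word_eval M w)) \<and>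
    (\<nu> (\<psi> (word_eval M w)) \<le> c * length w \<longrightarrow> \<psi> ` set w \<subseteq> S2 M \<phi>)"
    using w
  proof (induction w)
    case (Cons s w)
    have s: "s \<in> carrier M" using Cons.hyps S2_carrier by blast
    have "w \<in> lists (S2 M \<phi>)" using Cons.hyps by simp
    then have wc: "word_eval M w \<in> carrier M" by (rule generated_S2_closed)
    have "\<nu> (\<psi> (word_eval M (s # w))) = \<nu> (\<psi> s) + \<nu> (\<psi> (word_eval M w))"
      using End_mult[OF psi_End s wc] norm_mult[OF End_closed[OF psi_End s] End_closed[OF psi_End wc]] by simp
    then show ?case using letter[of s] Cons by auto
  qed simp
  then show "c * length w \<le> \<nu> (\<psi> (word_eval M w))"
    and "\<nu> (\<psi> (word_eval M w)) \<le> c * length w \<Longrightarrow> \<psi> ` set w \<subseteq> S2 M \<phi>" by blast+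
qed

text \<open>Along a period the norm cannot grow, because it cannot come back down.\<close>

lemma psi_periodic_letters:
  assumes "w \<in> lists (S2 M \<phi>)" "k \<ge> 1" "(\<psi> ^^ k) (word_eval M w) = word_eval M w" "s \<in> set w"
  shows "(\<psi> ^^ j) s \<in> S2 M \<phi>"
  using assms
proof (induction j arbitrary: w s)
  case (Suc j)
  obtain c where c: "c > 0" "\<And>s. s \<in> atoms M \<Longrightarrow> \<nu> s = c" using atom_norm by blast
  let ?y = "word_eval M w"
  have grow: "\<nu> x \<le> \<nu> (\<psi> x)" if x: "x \<in> word_eval M ` lists (S2 M \<phi>)" for x
  proof -
    obtain v where v: "v \<in> lists (S2 M \<phi>)" "x = word_eval M v" using x by blast
    have "v \<in> lists (atoms M)" by (rule lists_subsetD[OF S2_atoms v(1)])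
    then show ?thesis using psi_norm(1)[OF c v(1)] norm_word_eval[OF c(2)] v(2) by simp
  qed
  have yc: "?y \<in> carrier M" using Suc.prems(1) by (rule generated_S2_closed)
  have "\<nu> (\<psi> ?y) \<le> \<nu> ((\<psi> ^^ i) (\<psi> ?y)) \<and> (\<psi> ^^ i) (\<psi> ?y) \<in> word_eval M ` lists (S2 M \<phi>)" for i
  proof (induction i)
    case (Suc i)
    then have "(\<psi> ^^ i) (\<psi> ?y) \<in> carrier M" using S2_span_closed by blast
    then show ?case using Suc grow psi_in_S2 order_trans by fastforce
  qed (use psi_in_S2[OF yc] in simp)
  from this[of "k - 1"] have "\<nu> (\<psi> ?y) \<le> \<nu> ?y"
    using Suc.prems(2,3) by (cases k) (auto simp: funpow_swap1)
  moreover have "w \<in> lists (atoms M)" by (rule lists_subsetD[OF S2_atoms Suc.prems(1)])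
  ultimately have "\<nu> (\<psi> ?y) \<le> c * length w" using norm_word_eval[OF c(2)] by simp
  then have img: "\<psi> ` set w \<subseteq> S2 M \<phi>" using psi_norm(2)[OF c Suc.prems(1)] by blast
  have wc: "w \<in> lists (carrier M)" by (rule lists_subsetD[OF S2_carrier Suc.prems(1)])
  have e: "word_eval M (map \<psi> w) = \<psi> ?y" using End_word_eval[OF monoid_axioms psi_End wc] by simp
  have "map \<psi> w \<in> lists (S2 M \<phi>)" using img by auto
  moreover have "(\<psi> ^^ k) (word_eval M (map \<psi> w)) = word_eval M (map \<psi> w)"
    unfolding e using Suc.prems(3) by (metis funpow_swap1)
  moreover have "\<psi> s \<in> set (map \<psi> w)" using Suc.prems(4) by simp
  ultimately have "(\<psi> ^^ j) (\<psi> s) \<in> S2 M \<phi>" using Suc.IH Suc.prems(2) by blast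
  then show ?case by (simp add: funpow_swap1)
qed auto

text \<open>\<open>X\<close> collects the atoms that stay atoms under all powers of \<open>\<psi>\<close>; by \<open>psi_periodic_letters\<close> all
\<open>\<psi>\<close>-periodic elements are words over \<open>X\<close>. A power \<open>\<psi>\<^sup>N\<close> that is idempotent on \<open>X\<close> fixes them, so they
are words over \<open>T = \<psi>\<^sup>N X\<close>. Since \<open>\<phi>\<^sup>N\<close> does not see the letters that \<open>\<pi>\<close> deletes, \<open>\<phi>\<^sup>N\<close> and \<open>\<pi>\<close>
are mutually inverse between the submonoid generated by \<open>T\<close> and \<open>Per \<phi>\<close>.\<close>

theorem Per_structure:
  obtains N T where "N \<ge> 1" "T \<subseteq> atoms M" "Per M \<phi> = Fix M (\<phi> ^^ N)"
    "bij_betw (\<phi> ^^ N) (word_eval M ` lists T) (Per M \<phi>)"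
proof -
  define X where "X = {s \<in> S2 M \<phi>. \<forall>j. (\<psi> ^^ j) s \<in> S2 M \<phi>}"
  have finX: "finite X" using finite_atoms S2_atoms by (auto simp: X_def intro: finite_subset)
  have XS2: "X \<subseteq> S2 M \<phi>" by (auto simp: X_def)
  have invX: "\<psi> ` X \<subseteq> X"
  proof
    fix y assume "y \<in> \<psi> ` X"
    then obtain s where s: "s \<in> X" "y = \<psi> s" by blast
    have "(\<psi> ^^ j) y \<in> S2 M \<phi>" for j
      using s(1) s(2) funpow_swap1[of \<psi> j s] unfolding X_def by (metis (mono_tags, lifting) funpow.simps(2) mem_Collect_eq o_apply)
    from this this[of 0] show "y \<in> X" by (simp add: X_def)
  qed
  obtain N where N: "N \<ge> 1" "N \<ge> kill_time" "\<And>x. x \<in> X \<Longrightarrow> (\<psi> ^^ N) ((\<psi> ^^ N) x) = (\<psi> ^^ N) x"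
    using idempotent_power[OF finX invX] by blast
  define T where "T = (\<psi> ^^ N) ` X"
  have "(\<psi> ^^ j) ` X \<subseteq> X" for j using invX by (induction j) auto
  then have TX: "T \<subseteq> X" by (simp add: T_def)
  have Xc: "lists X \<subseteq> lists (carrier M)" by (rule lists_mono[OF subset_trans[OF XS2 S2_carrier]])
  have Tc: "lists T \<subseteq> lists X" using TX by (rule lists_mono)
  have idT: "(\<psi> ^^ N) (word_eval M w) = word_eval M w" if w: "w \<in> lists T" for w
  proof -
    have "map (\<psi> ^^ N) w = w" using w N(3) by (intro map_idI) (auto simp: T_def)
    moreover have "w \<in> lists (carrier M)" by (rule subsetD[OF Xc subsetD[OF Tc w]])
    ultimately show ?thesis using End_word_eval[OF monoid_axioms End_funpow[OF psi_End]] by metis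
  qed
  have toT: "(\<psi> ^^ N) (word_eval M w) \<in> word_eval M ` lists T" if w: "w \<in> lists X" for w
  proof -
    have "map (\<psi> ^^ N) w \<in> lists T" using w by (auto simp: T_def)
    then show ?thesis
      by (rule rev_image_eqI)
         (rule End_word_eval[OF monoid_axioms End_funpow[OF psi_End] subsetD[OF Xc w]])
  qed
  have periodic: "proj x \<in> word_eval M ` lists T" "(\<psi> ^^ N) (proj x) = proj x" "(\<phi> ^^ N) x = x"
    if x: "x \<in> Fix M (\<phi> ^^ k)" "k \<ge> 1" for x k
  proof -
    have xc: "x \<in> carrier M" and xk: "(\<phi> ^^ k) x = x" using x by (auto simp: Fix_def)
    have per: "(\<psi> ^^ k) (proj x) = proj x" using proj_funpow[OF xc, of k] xk by simp
    obtain w where w: "w \<in> lists (S2 M \<phi>)" "proj x = word_eval M w" using proj_in_S2[OF xc] by blast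
    have "set w \<subseteq> X" using psi_periodic_letters[OF w(1) x(2)] per w by (auto simp: X_def)
    then have wX: "w \<in> lists X" by auto
    obtain v where v: "v \<in> lists T" "(\<psi> ^^ N) (proj x) = word_eval M v" using toT[OF wX] w(2) by auto
    have pow: "((\<psi> ^^ N) ^^ Suc i) (proj x) = (\<psi> ^^ N) (proj x)" for i
    proof (induction i)
      case (Suc i)
      then show ?case using v idT by simp
    qed simp
    have "(\<psi> ^^ (N * k)) (proj x) = proj x"
      using funpow_fixed[of "\<psi> ^^ k" "proj x" N] per by (simp add: funpow_mult mult.commute)
    then have "((\<psi> ^^ N) ^^ k) (proj x) = proj x" by (simp add: funpow_mult mult.commute)
    then have fixN: "(\<psi> ^^ N) (proj x) = proj x" using pow[of "k - 1"] x(2) by simp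
    show "(\<psi> ^^ N) (proj x) = proj x" by (rule fixN)
    show "proj x \<in> word_eval M ` lists T" using v fixN by auto
    \<comment> \<open>The exponent \<open>N * k\<close> is a period of \<open>x\<close> and large enough for \<open>\<phi>\<close> not to see the letters deleted by \<open>proj\<close>.\<close>
    have kN: "kill_time \<le> N * k" using order_trans[OF N(2), of "N * k"] mult_le_mono2[OF x(2), of N] by linarith
    have big: "(\<phi> ^^ (N * k)) x = x" using funpow_fixed[of "\<phi> ^^ k" x N] xk by (simp add: funpow_mult mult.commute)
    have Nx: "(\<phi> ^^ N) x \<in> carrier M" using End_closed[OF End_funpow[OF End] xc] .
    have "x = (\<phi> ^^ (N * k)) (proj x)" using big funpow_proj[OF xc kN] by simp
    also have "proj x = proj ((\<phi> ^^ N) x)" using proj_funpow[OF xc, of N] fixN by simp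
    also have "(\<phi> ^^ (N * k)) (proj ((\<phi> ^^ N) x)) = (\<phi> ^^ (N * k)) ((\<phi> ^^ N) x)" using funpow_proj[OF Nx kN] .
    also have "\<dots> = (\<phi> ^^ N) ((\<phi> ^^ (N * k)) x)" by (metis add.commute comp_apply funpow_add)
    finally show "(\<phi> ^^ N) x = x" using big by simp
  qed
  have Per: "Per M \<phi> = Fix M (\<phi> ^^ N)"
  proof
    show "Fix M (\<phi> ^^ N) \<subseteq> Per M \<phi>" using N(1) by (auto simp: Per_def)
    show "Per M \<phi> \<subseteq> Fix M (\<phi> ^^ N)"
    proof
      fix x assume "x \<in> Per M \<phi>"
      then obtain k where "k \<ge> 1" "x \<in> Fix M (\<phi> ^^ k)" by (auto simp: Per_def)
      then show "x \<in> Fix M (\<phi> ^^ N)" using periodic(3) by (auto simp: Fix_def)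
    qed
  qed
  have projT: "proj ((\<phi> ^^ N) y) = y" "y \<in> carrier M" if y: "y \<in> word_eval M ` lists T" for y
  proof -
    obtain w where w: "w \<in> lists T" "y = word_eval M w" using y by blast
    have wS: "w \<in> lists (S2 M \<phi>)" using w(1) TX XS2 by auto
    show yc: "y \<in> carrier M" using generated_S2_closed[OF wS] w by simp
    show "proj ((\<phi> ^^ N) y) = y" using proj_funpow[OF yc] proj_on_S2[OF wS] idT w by simp
  qed
  have "bij_betw (\<phi> ^^ N) (word_eval M ` lists T) (Per M \<phi>)"
  proof (rule bij_betw_byWitness[where f' = proj])
    show "\<forall>y\<in>word_eval M ` lists T. proj ((\<phi> ^^ N) y) = y" using projT by blast
    show "\<forall>x\<in>Per M \<phi>. (\<phi> ^^ N) (proj x) = x"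
    proof
      fix x assume "x \<in> Per M \<phi>"
      then have "x \<in> carrier M" "(\<phi> ^^ N) x = x" using Per by (auto simp: Fix_def)
      then show "(\<phi> ^^ N) (proj x) = x" using funpow_proj N(2) by simp
    qed
    show "proj ` Per M \<phi> \<subseteq> word_eval M ` lists T" using periodic(1) N(1) Per by blast
    show "(\<phi> ^^ N) ` (word_eval M ` lists T) \<subseteq> Per M \<phi>"
    proof (rule image_subsetI)
      fix y assume y: "y \<in> word_eval M ` lists T"
      have Ny: "(\<phi> ^^ N) y \<in> carrier M" using End_closed[OF End_funpow[OF End] projT(2)[OF y]] .
      have "(\<phi> ^^ N) ((\<phi> ^^ N) y) = (\<phi> ^^ N) y"
        using funpow_proj[OF Ny N(2)] projT(1)[OF y] by simp
      then show "(\<phi> ^^ N) y \<in> Per M \<phi>" using Per Ny by (simp add: Fix_def)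
    qed
  qed
  moreover have "T \<subseteq> atoms M" using TX XS2 S2_atoms by blast
  ultimately show ?thesis using that[OF N(1) _ Per] by blast
qed

end

section \<open>Presentations\<close>

lemma pres_cong_in_lists: "pres_cong X R u v \<Longrightarrow> u \<in> lists X \<and> v \<in> lists X"
  by (induction rule: pres_cong.induct) auto

lemma pres_rel_equiv: "equiv (lists X) (pres_rel X R)"
proof (rule equivI)
  show "pres_rel X R \<subseteq> lists X \<times> lists X" using pres_cong_in_lists by (fastforce simp: pres_rel_def)
  show "refl_on (lists X) (pres_rel X R)"
    by (rule refl_onI) (auto simp: pres_rel_def intro: pres_cong.refl)
  show "sym (pres_rel X R)" by (rule symI) (auto simp: pres_rel_def intro: pres_cong.sym)
  show "trans (pres_rel X R)" by (rule transI) (auto simp: pres_rel_def intro: pres_cong.trans)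
qed

lemma pres_class_eq_iff:
  "u \<in> lists X \<Longrightarrow> v \<in> lists X \<Longrightarrow> pres_rel X R `` {u} = pres_rel X R `` {v} \<longleftrightarrow> pres_cong X R u v"
  using eq_equiv_class_iff[OF pres_rel_equiv, of u X v R] by (simp add: pres_rel_def)

lemma presented_mult_class:
  assumes "u \<in> lists X" "v \<in> lists X"
  shows "(pres_rel X R `` {u}) \<otimes>\<^bsub>presented_monoid X R\<^esub> (pres_rel X R `` {v}) = pres_rel X R `` {u @ v}"
proof -
  have eq: "pres_rel X R `` {u' @ v'} = pres_rel X R `` {u @ v}"
    if "u' \<in> pres_rel X R `` {u}" "v' \<in> pres_rel X R `` {v}" for u' v'
  proof -
    have c: "pres_cong X R u u'" "pres_cong X R v v'" using that by (auto simp: pres_rel_def)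
    then have "pres_cong X R (u @ v) (u' @ v')" by (rule pres_cong.mult)
    then have "pres_cong X R (u' @ v') (u @ v)" by (rule pres_cong.sym)
    then show ?thesis using pres_class_eq_iff[of "u' @ v'" X "u @ v" R] pres_cong_in_lists by blast
  qed
  have ne: "u \<in> pres_rel X R `` {u}" "v \<in> pres_rel X R `` {v}"
    using assms by (auto simp: pres_rel_def intro: pres_cong.refl)
  have "(\<Union>u'\<in>pres_rel X R `` {u}. \<Union>v'\<in>pres_rel X R `` {v}. pres_rel X R `` {u' @ v'})
     = (\<Union>u'\<in>pres_rel X R `` {u}. \<Union>v'\<in>pres_rel X R `` {v}. pres_rel X R `` {u @ v})"
    by (rule SUP_cong[OF HOL.refl], rule SUP_cong[OF HOL.refl], rule eq)
  also have "\<dots> = pres_rel X R `` {u @ v}" using ne by blast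
  finally show ?thesis by (simp add: presented_monoid_def)
qed

text \<open>A presentation given by an evaluation map on words rather than by an isomorphism onto equivalence classes; this
is equivalent (\<open>presents_if_iso\<close>, \<open>iso_if_presents\<close>) and composes easily.\<close>

definition presents :: "('a, 'm) monoid_scheme \<Rightarrow> 'b set \<Rightarrow> ('b list \<times> 'b list) set \<Rightarrow> ('b list \<Rightarrow> 'a) \<Rightarrow> bool" where
  "presents M X R e \<longleftrightarrow> e ` lists X = carrier M \<and> e [] = \<one>\<^bsub>M\<^esub> \<and>
     (\<forall>u\<in>lists X. \<forall>v\<in>lists X. e (u @ v) = e u \<otimes>\<^bsub>M\<^esub> e v) \<and>
     (\<forall>u\<in>lists X. \<forall>v\<in>lists X. e u = e v \<longleftrightarrow> pres_cong X R u v)"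

lemma presents_if_iso:
  assumes "monoid M" "M \<cong> presented_monoid X R"
  shows "\<exists>e. presents M X R e"
proof -
  interpret monoid M by fact
  let ?P = "presented_monoid X R"
  obtain h where h: "h \<in> hom M ?P" "bij_betw h (carrier M) (carrier ?P)"
    using assms(2) by (auto simp: is_iso_def iso_def)
  define cl where "cl w = pres_rel X R `` {w}" for w
  have clP: "cl w \<in> carrier ?P" if "w \<in> lists X" for w
    using that by (auto simp: cl_def presented_monoid_def quotient_def)
  define e where "e w = inv_into (carrier M) h (cl w)" for w
  have he: "h (e w) = cl w" and eM: "e w \<in> carrier M" if "w \<in> lists X" for w
    using bij_betw_inv_into_right[OF h(2) clP[OF that]] bij_betwE[OF bij_betw_inv_into[OF h(2)]] clP[OF that]
    by (auto simp: e_def)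
  have inj: "x = y" if "h x = h y" "x \<in> carrier M" "y \<in> carrier M" for x y
    using h(2) that by (auto simp: bij_betw_def inj_on_def)
  have mult: "e (u @ v) = e u \<otimes>\<^bsub>M\<^esub> e v" if uv: "u \<in> lists X" "v \<in> lists X" for u v
  proof (rule inj)
    have uvl: "u @ v \<in> lists X" using uv by simp
    show "e (u @ v) \<in> carrier M" by (rule eM[OF uvl])
    show "e u \<otimes>\<^bsub>M\<^esub> e v \<in> carrier M" using eM uv by simp
    have "h (e u \<otimes>\<^bsub>M\<^esub> e v) = cl u \<otimes>\<^bsub>?P\<^esub> cl v" using hom_mult[OF h(1) eM[OF uv(1)] eM[OF uv(2)]] he uv by simp
    also have "\<dots> = cl (u @ v)" using presented_mult_class[OF uv] by (simp add: cl_def)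
    finally show "h (e (u @ v)) = h (e u \<otimes>\<^bsub>M\<^esub> e v)" using he[OF uvl] by simp
  qed
  have surj: "\<exists>w\<in>lists X. x = e w" if x: "x \<in> carrier M" for x
  proof -
    have "h x \<in> carrier ?P" using bij_betwE[OF h(2)] x by blast
    then obtain w where w: "w \<in> lists X" "h x = cl w" by (auto simp: presented_monoid_def quotient_def cl_def)
    then have "x = e w" using inj[of x "e w"] he[of w] eM[of w] x by simp
    then show ?thesis using w(1) by blast
  qed
  \<comment> \<open>A map in \<open>hom\<close> may move the unit; here surjectivity shows that \<open>e []\<close> is a left unit.\<close>
  have one: "e [] = \<one>\<^bsub>M\<^esub>"
  proof -
    obtain w where w: "w \<in> lists X" "\<one>\<^bsub>M\<^esub> = e w" using surj[OF one_closed] by blast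
    have "e [] \<otimes>\<^bsub>M\<^esub> e w = e w" using mult[of "[]" w] w(1) by simp
    moreover have "e [] \<in> carrier M" by (rule eM) simp
    ultimately show ?thesis by (simp add: w(2)[symmetric])
  qed
  have "e u = e v \<longleftrightarrow> pres_cong X R u v" if uv: "u \<in> lists X" "v \<in> lists X" for u v
  proof -
    have "e u = e v \<longleftrightarrow> cl u = cl v" using inj he eM uv by metis
    then show ?thesis using pres_class_eq_iff[OF uv] by (simp add: cl_def)
  qed
  moreover have "e ` lists X = carrier M" using surj eM by blast
  ultimately have "presents M X R e" using mult one by (simp add: presents_def)
  then show ?thesis by blast
qed

lemma iso_if_presents:
  assumes "presents M X R e"
  shows "M \<cong> presented_monoid X R"
proof -
  let ?P = "presented_monoid X R"
  define cl where "cl w = pres_rel X R `` {w}" for w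
  have e: "e ` lists X = carrier M" "\<And>u v. u \<in> lists X \<Longrightarrow> v \<in> lists X \<Longrightarrow> e (u @ v) = e u \<otimes>\<^bsub>M\<^esub> e v"
    "\<And>u v. u \<in> lists X \<Longrightarrow> v \<in> lists X \<Longrightarrow> e u = e v \<longleftrightarrow> cl u = cl v"
    using assms by (simp_all only: presents_def cl_def pres_class_eq_iff)
  define h where "h x = cl (SOME w. w \<in> lists X \<and> e w = x)" for x
  have he: "h (e w) = cl w" if w: "w \<in> lists X" for w
  proof -
    let ?v = "SOME v. v \<in> lists X \<and> e v = e w"
    have "?v \<in> lists X \<and> e ?v = e w" by (rule someI[of _ w]) (use w in simp)
    then show ?thesis using e(3) w unfolding h_def by metis
  qed
  have carP: "carrier ?P = cl ` lists X" by (auto simp: presented_monoid_def quotient_def cl_def)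
  have "h \<in> hom M ?P"
  proof (rule homI)
    fix x assume "x \<in> carrier M"
    then obtain w where "w \<in> lists X" "x = e w" using e(1) by blast
    then show "h x \<in> carrier ?P" using he carP by simp
  next
    fix x y assume "x \<in> carrier M" "y \<in> carrier M"
    then obtain u v where uv: "u \<in> lists X" "x = e u" "v \<in> lists X" "y = e v"
      using e(1) by (metis imageE)
    have "h (x \<otimes>\<^bsub>M\<^esub> y) = cl (u @ v)" using he[of "u @ v"] uv e(2) by simp
    also have "\<dots> = cl u \<otimes>\<^bsub>?P\<^esub> cl v" using presented_mult_class[OF uv(1,3)] by (simp add: cl_def)
    finally show "h (x \<otimes>\<^bsub>M\<^esub> y) = h x \<otimes>\<^bsub>?P\<^esub> h y" using he uv by simp
  qed
  moreover have "inj_on h (carrier M)"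
  proof (rule inj_onI)
    fix x y assume xy: "x \<in> carrier M" "y \<in> carrier M" "h x = h y"
    then obtain u v where uv: "u \<in> lists X" "x = e u" "v \<in> lists X" "y = e v"
      using e(1) by (metis imageE)
    then show "x = y" using xy(3) he e(3) by simp
  qed
  moreover have "h ` carrier M = carrier ?P"
  proof -
    have "h ` carrier M = (\<lambda>w. h (e w)) ` lists X" using e(1) by (metis image_image)
    also have "\<dots> = cl ` lists X" using he by (intro image_cong HOL.refl)
    finally show ?thesis using carP by simp
  qed
  ultimately show ?thesis by (auto simp: is_iso_def iso_def bij_betw_def)
qed

lemma pres_cong_map:
  assumes "pres_cong X R u v" "f ` X \<subseteq> Y" "\<And>l r. (l, r) \<in> R \<Longrightarrow> l \<in> lists X \<Longrightarrow> (map f l, map f r) \<in> Q"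
  shows "pres_cong Y Q (map f u) (map f v)"
  using assms(1)
proof (induction rule: pres_cong.induct)
  case (rel l r)
  then have "map f l \<in> lists Y" "map f r \<in> lists Y" using assms(2) by (auto simp: in_lists_conv_set)
  then show ?case using assms(3) rel pres_cong.rel by blast
next
  case (refl w)
  then have "map f w \<in> lists Y" using assms(2) by (auto simp: in_lists_conv_set)
  then show ?case by (rule pres_cong.refl)
next
  case (sym u v)
  then show ?case by (blast intro: pres_cong.sym)
next
  case (trans u v w)
  then show ?case by (blast intro: pres_cong.trans)
next
  case (mult u v u' v')
  then show ?case by (simp add: pres_cong.mult)
qed

lemma artin_cong_map:
  assumes "pres_cong X (artin_relations X m) u v" "f ` X \<subseteq> Y"
    "\<And>a b. a \<in> X \<Longrightarrow> b \<in> X \<Longrightarrow> m' (f a) (f b) = m a b"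
  shows "pres_cong Y (artin_relations Y m') (map f u) (map f v)"
proof (rule pres_cong_map[OF assms(1,2)])
  fix l r assume "(l, r) \<in> artin_relations X m"
  then obtain a b k where ab: "l = alt_word a b k" "r = alt_word b a k" "a \<in> X" "b \<in> X" "m a b = enat k"
    by (auto simp: artin_relations_def)
  then have "f a \<in> Y" "f b \<in> Y" "m' (f a) (f b) = enat k" using assms(2,3) by auto
  then show "(map f l, map f r) \<in> artin_relations Y m'"
    using ab by (auto simp: artin_relations_def map_alt_word)
qed

section \<open>Artin monoids with their generators inside\<close>

text \<open>An Artin monoid whose generators are elements of the monoid, so that words can be evaluated directly.\<close>

definition artin_on :: "('a, 'm) monoid_scheme \<Rightarrow> 'a set \<Rightarrow> ('a \<Rightarrow> 'a \<Rightarrow> enat) \<Rightarrow> bool" where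
  "artin_on M A m \<longleftrightarrow> monoid M \<and> finite A \<and> A \<subseteq> carrier M \<and> coxeter_matrix A m \<and>
     carrier M = word_eval M ` lists A \<and>
     (\<forall>u\<in>lists A. \<forall>v\<in>lists A. word_eval M u = word_eval M v \<longleftrightarrow> pres_cong A (artin_relations A m) u v)"

lemma artin_onD:
  assumes "artin_on M A m"
  shows "monoid M" "finite A" "A \<subseteq> carrier M" "coxeter_matrix A m" "carrier M = word_eval M ` lists A"
    "\<And>u v. u \<in> lists A \<Longrightarrow> v \<in> lists A \<Longrightarrow>
       word_eval M u = word_eval M v \<longleftrightarrow> pres_cong A (artin_relations A m) u v"
proof -
  note a = assms[unfolded artin_on_def]
  show "monoid M" "finite A" "A \<subseteq> carrier M" "coxeter_matrix A m" "carrier M = word_eval M ` lists A"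
    by (rule conjunct1[OF a], rule conjunct1[OF conjunct2[OF a]],
        rule conjunct1[OF conjunct2[OF conjunct2[OF a]]],
        rule conjunct1[OF conjunct2[OF conjunct2[OF conjunct2[OF a]]]],
        rule conjunct1[OF conjunct2[OF conjunct2[OF conjunct2[OF conjunct2[OF a]]]]])
  show "word_eval M u = word_eval M v \<longleftrightarrow> pres_cong A (artin_relations A m) u v"
    if "u \<in> lists A" "v \<in> lists A" for u v
    using a that by blast
qed

lemma artin_on_presents:
  assumes "artin_on M A m"
  shows "presents M A (artin_relations A m) (word_eval M)"
proof -
  note a = artin_onD[OF assms]
  interpret monoid M by (rule a(1))
  have "word_eval M (u @ v) = word_eval M u \<otimes>\<^bsub>M\<^esub> word_eval M v" if "u \<in> lists A" "v \<in> lists A" for u v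
    by (rule word_eval_append) (rule lists_subsetD[OF a(3) that(1)], rule lists_subsetD[OF a(3) that(2)])
  then show ?thesis
    unfolding presents_def using a(5,6) by simp
qed

lemma (in coxeter) braid_singleton:
  assumes "[s] \<approx> [t]"
  shows "s = t"
proof (rule ccontr)
  assume ne: "s \<noteq> t"
  have "heads_agree [s] [t]" using braid_heads_agree assms .
  then obtain k w where k: "s \<in> S" "t \<in> S" "m s t = enat k" "[] \<approx> alt_word t s (k - 1) @ w"
    using heads_agree_Cons_neq[OF ne] by blast
  then show False using m_enat_ge2[OF k(1,2) ne k(3)] braid_length[OF k(4)] by simp
qed

text \<open>Renaming the generators along an injection transports the Coxeter matrix and the presentation. It is used in both
directions: from numbers to elements of the monoid and back.\<close>

lemma presents_relabel:
  fixes g :: "'b \<Rightarrow> 'c" and X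
  defines "f \<equiv> inv_into X g"
  defines "m' \<equiv> \<lambda>m a b. m (f a) (f b)"
  assumes cox: "coxeter_matrix X m" and e: "presents M X (artin_relations X m) e" and inj: "inj_on g X"
  shows "coxeter_matrix (g ` X) (m' m)"
    and "presents M (g ` X) (artin_relations (g ` X) (m' m)) (\<lambda>w. e (map f w))"
proof -
  let ?Y = "g ` X"
  have fg: "f (g s) = s" if "s \<in> X" for s using inj that by (simp add: f_def)
  have fY: "f ` ?Y \<subseteq> X" using fg by auto
  show "coxeter_matrix ?Y (m' m)"
    using cox fg unfolding coxeter_matrix_def m'_def by auto
  have mapf: "map g (map f w) = w" "map f w \<in> lists X" if w: "w \<in> lists ?Y" for w
  proof -
    have "map (\<lambda>a. g (f a)) w = w" by (rule map_idI) (use w fg in auto)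
    then show "map g (map f w) = w" by (simp add: comp_def)
    show "map f w \<in> lists X" using w fY by (auto simp: in_lists_conv_set)
  qed
  have mapg: "map f (map g w) = w" "map g w \<in> lists ?Y" if w: "w \<in> lists X" for w
  proof -
    have "map (\<lambda>a. f (g a)) w = w" by (rule map_idI) (use w fg in auto)
    then show "map f (map g w) = w" by (simp add: comp_def)
    show "map g w \<in> lists ?Y" using w by (auto simp: in_lists_conv_set)
  qed
  have e: "e ` lists X = carrier M" "e [] = \<one>\<^bsub>M\<^esub>"
    "\<And>u v. u \<in> lists X \<Longrightarrow> v \<in> lists X \<Longrightarrow> e (u @ v) = e u \<otimes>\<^bsub>M\<^esub> e v"
    "\<And>u v. u \<in> lists X \<Longrightarrow> v \<in> lists X \<Longrightarrow> e u = e v \<longleftrightarrow> pres_cong X (artin_relations X m) u v"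
    using e by (simp_all add: presents_def)
  show "presents M ?Y (artin_relations ?Y (m' m)) (\<lambda>w. e (map f w))"
    unfolding presents_def
  proof (intro conjI ballI)
    have "map f ` lists ?Y = lists X"
    proof
      show "map f ` lists ?Y \<subseteq> lists X" using mapf(2) by (rule image_subsetI)
      show "lists X \<subseteq> map f ` lists ?Y"
      proof
        fix w assume "w \<in> lists X"
        note w = mapg[OF this]
        show "w \<in> map f ` lists ?Y" using imageI[OF w(2), of "map f"] by (simp only: w(1))
      qed
    qed
    then show "(\<lambda>w. e (map f w)) ` lists ?Y = carrier M" using e(1) by (metis image_image)
    show "e (map f []) = \<one>\<^bsub>M\<^esub>" by (simp add: e(2))
    fix u v assume uv: "u \<in> lists ?Y" "v \<in> lists ?Y"
    show "e (map f (u @ v)) = e (map f u) \<otimes>\<^bsub>M\<^esub> e (map f v)"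
      unfolding map_append by (rule e(3)[OF mapf(2)[OF uv(1)] mapf(2)[OF uv(2)]])
    have "e (map f u) = e (map f v) \<longleftrightarrow> pres_cong X (artin_relations X m) (map f u) (map f v)"
      by (rule e(4)[OF mapf(2)[OF uv(1)] mapf(2)[OF uv(2)]])
    also have "\<dots> \<longleftrightarrow> pres_cong ?Y (artin_relations ?Y (m' m)) u v"
    proof
      assume "pres_cong X (artin_relations X m) (map f u) (map f v)"
      then have "pres_cong ?Y (artin_relations ?Y (m' m)) (map g (map f u)) (map g (map f v))"
        by (rule artin_cong_map[OF _ order_refl]) (simp add: m'_def fg)
      then show "pres_cong ?Y (artin_relations ?Y (m' m)) u v"
        by (simp only: mapf(1)[OF uv(1)] mapf(1)[OF uv(2)])
    next
      assume "pres_cong ?Y (artin_relations ?Y (m' m)) u v"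
      then show "pres_cong X (artin_relations X m) (map f u) (map f v)"
        by (rule artin_cong_map[OF _ fY]) (simp add: m'_def)
    qed
    finally show "e (map f u) = e (map f v) \<longleftrightarrow> pres_cong ?Y (artin_relations ?Y (m' m)) u v" .
  qed
qed

lemma artin_monoid_imp_artin_on:
  assumes "artin_monoid M"
  shows "\<exists>A m. artin_on M A m"
proof -
  obtain X :: "nat set" and m where M: "monoid M" "finite X" "coxeter_matrix X m"
      "M \<cong> presented_monoid X (artin_relations X m)"
    using assms by (auto simp: artin_monoid_def)
  interpret coxeter X m by unfold_locales (rule M(3))
  obtain e where e: "presents M X (artin_relations X m) e" using presents_if_iso M by blast
  then have e': "e [] = \<one>\<^bsub>M\<^esub>" "e ` lists X = carrier M"
    "\<And>u v. u \<in> lists X \<Longrightarrow> v \<in> lists X \<Longrightarrow> e (u @ v) = e u \<otimes>\<^bsub>M\<^esub> e v"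
    "\<And>u v. u \<in> lists X \<Longrightarrow> v \<in> lists X \<Longrightarrow> e u = e v \<Longrightarrow> pres_cong X (artin_relations X m) u v"
    by (simp_all add: presents_def)
  define g where "g s = e [s]" for s
  define f where "f = inv_into X g"
  have inj: "inj_on g X"
  proof (rule inj_onI)
    fix s t assume "s \<in> X" "t \<in> X" "g s = g t"
    then show "s = t" using e'(4)[of "[s]" "[t]"] braid_singleton by (simp add: g_def)
  qed
  note rel = presents_relabel[OF M(3) e inj, folded f_def]
  have f: "f a \<in> X" "e [f a] = a" if "a \<in> g ` X" for a
    using that inj by (auto simp: f_def g_def[symmetric])
  have ev: "e (map f w) = word_eval M w" if "w \<in> lists (g ` X)" for w
    using that
  proof (induction w)
    case (Cons a w)
    have "map f w \<in> lists X" using Cons.hyps f(1) by auto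
    then show ?case using e'(3)[of "[f a]" "map f w"] Cons f[of a] by simp
  qed (simp add: e'(1))
  have "g ` X \<subseteq> carrier M" using e'(2) by (auto simp: g_def)
  then have "artin_on M (g ` X) (\<lambda>a b. m (f a) (f b))"
    using M(1,2) rel ev image_cong[OF HOL.refl ev, of "lists (g ` X)"]
    unfolding artin_on_def presents_def by simp
  then show ?thesis by blast
qed

lemma presents_imp_artin_monoid:
  assumes M: "monoid M" and A: "finite A" "coxeter_matrix A m" and e: "presents M A (artin_relations A m) e"
  shows "artin_monoid M"
proof -
  obtain g :: "_ \<Rightarrow> nat" where inj: "inj_on g A" using finite_imp_inj_to_nat_seg[OF A(1)] by blast
  note rel = presents_relabel[OF A(2) e inj]
  show ?thesis
    unfolding artin_monoid_def using M A(1) rel(1) iso_if_presents[OF rel(2)] by blast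
qed

lemma artin_on_imp_artin_monoid:
  assumes "artin_on M A m"
  shows "artin_monoid M"
  using presents_imp_artin_monoid[OF _ _ _ artin_on_presents[OF assms]] artin_onD[OF assms] by blast

lemma artin_monoid_transfer:
  assumes "artin_on M A m" "monoid N" "h \<in> hom M N" "h \<one>\<^bsub>M\<^esub> = \<one>\<^bsub>N\<^esub>" "bij_betw h (carrier M) (carrier N)"
  shows "artin_monoid N"
proof (rule presents_imp_artin_monoid[OF assms(2)])
  show "finite A" "coxeter_matrix A m" by (fact artin_onD[OF assms(1)])+
  have e: "word_eval M ` lists A = carrier M" "word_eval M [] = \<one>\<^bsub>M\<^esub>"
    "\<And>u v. u \<in> lists A \<Longrightarrow> v \<in> lists A \<Longrightarrow> word_eval M (u @ v) = word_eval M u \<otimes>\<^bsub>M\<^esub> word_eval M v"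
    "\<And>u v. u \<in> lists A \<Longrightarrow> v \<in> lists A \<Longrightarrow> word_eval M u = word_eval M v \<longleftrightarrow> pres_cong A (artin_relations A m) u v"
    using artin_on_presents[OF assms(1)] by (simp_all add: presents_def)
  have c: "word_eval M w \<in> carrier M" if "w \<in> lists A" for w using e(1) that by (metis imageI)
  show "presents N A (artin_relations A m) (\<lambda>w. h (word_eval M w))"
    unfolding presents_def
  proof (intro conjI ballI)
    have "(\<lambda>w. h (word_eval M w)) ` lists A = h ` (word_eval M ` lists A)" by (rule image_image[symmetric])
    then show "(\<lambda>w. h (word_eval M w)) ` lists A = carrier N" using e(1) assms(5) by (simp add: bij_betw_def)
    show "h (word_eval M []) = \<one>\<^bsub>N\<^esub>" by (simp add: assms(4))
    fix u v assume uv: "u \<in> lists A" "v \<in> lists A"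
    show "h (word_eval M (u @ v)) = h (word_eval M u) \<otimes>\<^bsub>N\<^esub> h (word_eval M v)"
      using e(3)[OF uv] hom_mult[OF assms(3) c[OF uv(1)] c[OF uv(2)]] by simp
    have "inj_on h (carrier M)" using assms(5) by (simp add: bij_betw_def)
    then have "h (word_eval M u) = h (word_eval M v) \<longleftrightarrow> word_eval M u = word_eval M v"
      using c[OF uv(1)] c[OF uv(2)] by (rule inj_on_eq_iff)
    then show "h (word_eval M u) = h (word_eval M v) \<longleftrightarrow> pres_cong A (artin_relations A m) u v"
      using e(4)[OF uv] by simp
  qed
qed

section \<open>Artin monoids are left preGarside\<close>

locale artin_in = monoid M + coxeter A m
  for M :: "('a, 'm) monoid_scheme" (structure) and A :: "'a set" and m +
  assumes finite_gen: "finite A"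
    and gen_carrier: "A \<subseteq> carrier M"
    and carrier_eq: "carrier M = word_eval M ` lists A"
    and eval_eq_iff: "\<And>u v. u \<in> lists A \<Longrightarrow> v \<in> lists A \<Longrightarrow> 
      word_eval M u = word_eval M v \<longleftrightarrow> pres_cong A (artin_relations A m) u v"

lemma artin_inI: "artin_on M A m \<Longrightarrow> artin_in M A m"
  using artin_onD[of M A m]
  by (simp add: artin_in_def artin_in_axioms_def coxeter_def)

context artin_in
begin

abbreviation gen_eq :: "'a list \<Rightarrow> 'a list \<Rightarrow> bool" (infix "\<approx>" 50) where
  "u \<approx> v \<equiv> pres_cong A (artin_relations A m) u v"

lemma word_of:
  assumes "x \<in> carrier M"
  obtains w where "w \<in> lists A" "x = word_eval M w"
  using assms unfolding carrier_eq by (rule imageE) (rule that)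

lemma eval_closed: "w \<in> lists A \<Longrightarrow> word_eval M w \<in> carrier M"
  unfolding carrier_eq by (rule imageI)

lemma eval_append: "u \<in> lists A \<Longrightarrow> v \<in> lists A \<Longrightarrow> word_eval M (u @ v) = word_eval M u \<otimes> word_eval M v"
  by (rule word_eval_append) (rule lists_subsetD[OF gen_carrier], assumption)+

definition word_length :: "'a \<Rightarrow> nat" where
  "word_length x = length (SOME w. w \<in> lists A \<and> word_eval M w = x)"

lemma word_length_eval:
  assumes w: "w \<in> lists A"
  shows "word_length (word_eval M w) = length w"
proof -
  let ?v = "SOME v. v \<in> lists A \<and> word_eval M v = word_eval M w"
  have v: "?v \<in> lists A \<and> word_eval M ?v = word_eval M w" by (rule someI[of _ w]) (use w in simp)
  then have "?v \<approx> w" using eval_eq_iff w by blast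
  then show ?thesis unfolding word_length_def by (rule braid_length)
qed

lemma word_length_mult:
  assumes "x \<in> carrier M" "y \<in> carrier M"
  shows "word_length (x \<otimes> y) = word_length x + word_length y"
proof -
  obtain u where u: "u \<in> lists A" "x = word_eval M u" using word_of assms(1) .
  obtain v where v: "v \<in> lists A" "y = word_eval M v" using word_of assms(2) .
  have "x \<otimes> y = word_eval M (u @ v)" using eval_append u v by simp
  then show ?thesis using word_length_eval[of "u @ v"] word_length_eval u v by simp
qed

lemma word_length_pos:
  assumes "x \<in> carrier M" "x \<noteq> \<one>"
  shows "word_length x > 0"
proof -
  obtain u where u: "u \<in> lists A" "x = word_eval M u" using word_of assms(1) .
  have "u \<noteq> []" using u(2) assms(2) by auto
  then show ?thesis using word_length_eval[OF u(1)] u(2) by simp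
qed

lemma word_length_norm: "monoid_norm M word_length"
  unfolding monoid_norm_def using word_length_pos word_length_mult by simp

sublocale normed_monoid M word_length
  by unfold_locales (rule word_length_norm)

lemma word_length_gen: "a \<in> A \<Longrightarrow> word_length a = 1"
  using word_length_eval[of "[a]"] gen_carrier by auto

lemma atoms_eq: "atoms M = A"
proof
  show "atoms M \<subseteq> A"
  proof
    fix a assume a: "a \<in> atoms M"
    then have "a \<in> carrier M" by (simp add: atoms_def)
    then obtain w where "w \<in> lists A" "a = word_eval M w" by (rule word_of)
    then show "a \<in> A" using atom_in_generators a gen_carrier by blast
  qed
  show "A \<subseteq> atoms M"
  proof
    fix a assume a: "a \<in> A"
    have "a \<in> carrier M" using a gen_carrier by blast
    moreover have "a \<noteq> \<one>" using word_length_gen[OF a] norm_one by auto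
    moreover have "b = \<one> \<or> c = \<one>" if "b \<in> carrier M" "c \<in> carrier M" "a = b \<otimes> c" for b c
    proof -
      have "word_length b + word_length c = 1" using word_length_mult[OF that(1,2)] that(3) word_length_gen[OF a] by simp
      then have "word_length b = 0 \<or> word_length c = 0" by linarith
      then show ?thesis using norm_eq_0_iff that(1,2) by blast
    qed
    ultimately show "a \<in> atoms M" unfolding atoms_def by blast
  qed
qed

lemma word_length_additive: "additive_norm M word_length"
  using word_length_norm word_length_mult by (simp add: additive_norm_def)

lemma word_length_homogeneous: "homogeneous_norm M word_length"
  using word_length_norm word_length_gen by (simp add: homogeneous_norm_def atoms_eq)

lemma fin_gen: "fin_gen_monoid M"
  unfolding fin_gen_monoid_def using monoid_axioms finite_gen gen_carrier carrier_eq by blast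

lemma braid_cancel_left: "u @ x \<approx> u @ y \<Longrightarrow> x \<approx> y"
proof (induction u)
  case (Cons a u)
  then have "heads_agree (a # (u @ x)) (a # (u @ y))" using braid_heads_agree by simp
  then show ?case using Cons.IH by (simp add: heads_agree_Cons)
qed simp

lemma left_cancel:
  assumes "x \<in> carrier M" "y \<in> carrier M" "z \<in> carrier M" "z \<otimes> x = z \<otimes> y"
  shows "x = y"
proof -
  obtain u where u: "u \<in> lists A" "x = word_eval M u" using word_of assms(1) .
  obtain v where v: "v \<in> lists A" "y = word_eval M v" using word_of assms(2) .
  obtain w where w: "w \<in> lists A" "z = word_eval M w" using word_of assms(3) .
  have "word_eval M (w @ u) = word_eval M (w @ v)"
    using assms(4) u v w eval_append by simp
  then have "w @ u \<approx> w @ v" using eval_eq_iff[of "w @ u" "w @ v"] u v w by simp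
  then have "u \<approx> v" by (rule braid_cancel_left)
  then show ?thesis using eval_eq_iff u v by simp
qed

text \<open>The lcm of \<open>s\<close> and \<open>t\<close> when \<open>k = m s t\<close>.\<close>

definition gen_lcm :: "'a \<Rightarrow> 'a \<Rightarrow> nat \<Rightarrow> 'a" where
  "gen_lcm s t k = word_eval M (alt_word s t k)"

lemma gen_lcm_closed: "s \<in> A \<Longrightarrow> t \<in> A \<Longrightarrow> gen_lcm s t k \<in> carrier M"
  unfolding gen_lcm_def by (rule eval_closed) (rule alt_word_in_lists)

lemma gen_lcm_factor:
  assumes "s \<in> A" "t \<in> A" "s \<noteq> t" "m s t = enat k"
  shows "gen_lcm s t k = s \<otimes> word_eval M (alt_word t s (k - 1))"
    and "gen_lcm s t k = t \<otimes> word_eval M (alt_word s t (k - 1))"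
proof -
  have ts: "m t s = enat k" using assms m_sym by simp
  show "gen_lcm s t k = s \<otimes> word_eval M (alt_word t s (k - 1))"
    unfolding gen_lcm_def alt_word_Cons_pred[OF assms] by simp
  have "gen_lcm s t k = word_eval M (alt_word t s k)"
    unfolding gen_lcm_def
    using eval_eq_iff[OF alt_word_in_lists[OF assms(1,2)] alt_word_in_lists[OF assms(2,1)]]
      braid_alt[OF assms(1,2,4)] by simp
  then show "gen_lcm s t k = t \<otimes> word_eval M (alt_word s t (k - 1))"
    using alt_word_Cons_pred[OF assms(2,1) assms(3)[symmetric] ts] by simp
qed

lemma gen_lcm_divides:
  assumes "x \<in> carrier M" "g \<in> carrier M" "s \<in> A" "t \<in> A" "s \<noteq> t"
    "(x \<otimes> s) divides g" "(x \<otimes> t) divides g"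
  obtains k where "m s t = enat k" "(x \<otimes> gen_lcm s t k) divides g"
proof -
  have st: "s \<in> carrier M" "t \<in> carrier M" using assms gen_carrier by auto
  obtain p where p: "p \<in> carrier M" "g = x \<otimes> s \<otimes> p" using assms(6) by (auto simp: factor_def)
  obtain q where q: "q \<in> carrier M" "g = x \<otimes> t \<otimes> q" using assms(7) by (auto simp: factor_def)
  have "x \<otimes> (s \<otimes> p) = x \<otimes> (t \<otimes> q)" using p q assms(1) st by (metis m_assoc)
  then have eq: "s \<otimes> p = t \<otimes> q" using left_cancel assms(1) p(1) q(1) st by blast
  obtain u where u: "u \<in> lists A" "p = word_eval M u" using word_of p(1) .
  obtain v where v: "v \<in> lists A" "q = word_eval M v" using word_of q(1) .
  have "s # u \<approx> t # v" using eval_eq_iff[of "s # u" "t # v"] u v eq assms(3,4) by simp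
  then have "heads_agree (s # u) (t # v)" by (rule braid_heads_agree)
  then obtain k w where k: "m s t = enat k" "w \<in> lists A" "u \<approx> alt_word t s (k - 1) @ w"
    using heads_agree_Cons_neq[OF assms(5)] by blast
  have altA: "alt_word t s (k - 1) \<in> lists A" by (rule alt_word_in_lists[OF assms(4,3)])
  have "p = word_eval M (alt_word t s (k - 1)) \<otimes> word_eval M w"
    using eval_eq_iff[of u "alt_word t s (k - 1) @ w"] k(2,3) u altA eval_append[OF altA k(2)] by simp
  then have "g = x \<otimes> gen_lcm s t k \<otimes> word_eval M w"
    unfolding p(2) gen_lcm_factor(1)[OF assms(3,4,5) k(1)]
    using assms(1) st eval_closed[OF altA] eval_closed[OF k(2)] by (simp add: m_assoc)
  then have "(x \<otimes> gen_lcm s t k) divides g" using eval_closed[OF k(2)] unfolding factor_def by blast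
  then show ?thesis using that k(1) by blast
qed

text \<open>Divisors of a fixed element \<open>c\<close> form a bounded set; closure under lcms of two generators is the local
confluence that \<open>greatest_of_locally_confluent\<close> asks for.\<close>

lemma greatest_element:
  assumes X: "X \<subseteq> carrier M" "\<one> \<in> X" and c: "c \<in> carrier M" "\<And>x. x \<in> X \<Longrightarrow> x divides c"
    and down: "\<And>x y. x \<in> carrier M \<Longrightarrow> y \<in> X \<Longrightarrow> x divides y \<Longrightarrow> x \<in> X"
    and lcm: "\<And>x s t k. x \<in> carrier M \<Longrightarrow> s \<in> A \<Longrightarrow> t \<in> A \<Longrightarrow> s \<noteq> t \<Longrightarrow> m s t = enat k \<Longrightarrow>
      x \<otimes> s \<in> X \<Longrightarrow> x \<otimes> t \<in> X \<Longrightarrow> x \<otimes> gen_lcm s t k \<in> X"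
  shows "\<exists>g\<in>X. \<forall>x\<in>X. x divides g"
proof (rule greatest_of_locally_confluent[where rank = word_length and B = "word_length c"
      and cov = "\<lambda>x x'. \<exists>s\<in>A. x' = x \<otimes> s" and e = \<one>])
  show "x divides x" if "x \<in> X" for x using X that by (intro divides_refl) blast
  show "x divides z" if "x \<in> X" "y \<in> X" "z \<in> X" "x divides y" "y divides z" for x y z
    using that X by (meson divides_trans subsetD)
  show "word_length x \<le> word_length c" if "x \<in> X" for x
    using divides_norm_le[of x c] X c that by blast
  show "\<one> divides x" if "x \<in> X" for x using that X unfolding factor_def by (metis l_one subsetD)
  show "\<one> \<in> X" by fact
next
  fix x y assume xy: "x \<in> X" "y \<in> X" "x divides y" "\<not> y divides x"
  have xc: "x \<in> carrier M" using X xy by blast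
  obtain z where z: "z \<in> carrier M" "y = x \<otimes> z" using xy(3) by (auto simp: factor_def)
  obtain w where w: "w \<in> lists A" "z = word_eval M w" using word_of z(1) .
  have "w \<noteq> []"
  proof
    assume "w = []"
    then have "y = x" using z w xc by simp
    then show False using xy(4) xc divides_refl by blast
  qed
  then obtain s v where sv: "w = s # v" by (cases w) auto
  have s: "s \<in> A" "s \<in> carrier M" "word_eval M v \<in> carrier M" using w(1) sv gen_carrier eval_closed by auto
  have "y = (x \<otimes> s) \<otimes> word_eval M v" using z w sv s xc by (simp add: m_assoc)
  then have d: "(x \<otimes> s) divides y" using s(3) unfolding factor_def by blast
  then have "x \<otimes> s \<in> X" using down[OF _ xy(2) d] xc s(2) by blast
  then show "\<exists>x'\<in>X. (\<exists>s\<in>A. x' = x \<otimes> s) \<and> x' divides y" using d s(1) by blast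
next
  fix x x' assume x: "x \<in> X" "x' \<in> X" "\<exists>s\<in>A. x' = x \<otimes> s"
  then obtain s where s: "s \<in> A" "x' = x \<otimes> s" by blast
  have xs: "x \<in> carrier M" "s \<in> carrier M" using X x(1) s(1) gen_carrier by auto
  have "word_length x' = word_length x + 1" using word_length_mult[OF xs] word_length_gen s by simp
  moreover have "x divides x'" using s(2) xs unfolding factor_def by blast
  ultimately show "x divides x' \<and> word_length x < word_length x'" by simp
next
  fix x y z assume xyz: "x \<in> X" "y \<in> X" "z \<in> X" "\<exists>s\<in>A. y = x \<otimes> s" "\<exists>s\<in>A. z = x \<otimes> s"
  then obtain s t where st: "s \<in> A" "y = x \<otimes> s" "t \<in> A" "z = x \<otimes> t" by blast
  have xc: "x \<in> carrier M" and stc: "s \<in> carrier M" "t \<in> carrier M" using X xyz(1) st gen_carrier by auto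
  show "\<exists>w\<in>X. y divides w \<and> z divides w"
  proof (cases "s = t")
    case True
    then have "z divides z" "y = z" using st xc stc by (auto intro: divides_refl)
    then show ?thesis using xyz(3) by blast
  next
    case False
    obtain k where k: "m s t = enat k" "(x \<otimes> gen_lcm s t k) divides c"
      using gen_lcm_divides[OF xc c(1) st(1,3) False] c(2) xyz(2,3) st(2,4) by blast
    have "x \<otimes> gen_lcm s t k \<in> X" using lcm[OF xc st(1,3) False k(1)] xyz(2,3) st(2,4) by blast
    moreover
    have r: "word_eval M (alt_word t s (k - 1)) \<in> carrier M" "word_eval M (alt_word s t (k - 1)) \<in> carrier M"
      by (rule eval_closed[OF alt_word_in_lists[OF st(3,1)]], rule eval_closed[OF alt_word_in_lists[OF st(1,3)]])
    have e: "\<exists>r\<in>carrier M. x \<otimes> gen_lcm s t k = x \<otimes> s \<otimes> r" "\<exists>r\<in>carrier M. x \<otimes> gen_lcm s t k = x \<otimes> t \<otimes> r"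
      by (rule bexI[OF _ r(1)], simp only: gen_lcm_factor(1)[OF st(1,3) False k(1)] m_assoc[OF xc stc(1) r(1)])
         (rule bexI[OF _ r(2)], simp only: gen_lcm_factor(2)[OF st(1,3) False k(1)] m_assoc[OF xc stc(2) r(2)])
    have "y divides (x \<otimes> gen_lcm s t k)" "z divides (x \<otimes> gen_lcm s t k)"
      unfolding st(2,4) factor_def by (rule e(1), rule e(2))
    ultimately show ?thesis by blast
  qed
qed

text \<open>A common multiple \<open>g\<close> of minimal length divides every other common multiple \<open>d\<close>: the greatest
common divisor of \<open>g\<close> and \<open>d\<close>, which exists by \<open>greatest_element\<close>, is itself a common multiple.\<close>

theorem artin_left_preGarside: "left_preGarside M"
proof -
  have "\<exists>g\<in>carrier M. g lcmof a b"
    if abc: "a \<in> carrier M" "b \<in> carrier M" "c0 \<in> carrier M" "a divides c0" "b divides c0" for a b c0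
  proof -
    let ?U = "\<lambda>g. g \<in> carrier M \<and> a divides g \<and> b divides g"
    have "?U c0" using abc by blast
    then obtain g where g: "?U g" and gmin: "\<And>h. ?U h \<Longrightarrow> word_length g \<le> word_length h"
      using ex_has_least_nat[of ?U c0 word_length] by blast
    have "g divides d" if d: "?U d" for d
    proof -
      define X where "X = {z \<in> carrier M. z divides g \<and> z divides d}"
      have "\<exists>h\<in>X. \<forall>x\<in>X. x divides h"
      proof (rule greatest_element[where c = g])
        show "X \<subseteq> carrier M" by (auto simp: X_def)
        have "\<one> divides e" if "e \<in> carrier M" for e
          unfolding factor_def by (rule bexI[OF _ that]) (simp add: that)
        then show "\<one> \<in> X" using g d by (simp add: X_def)
        show "g \<in> carrier M" using g by blast
        show "x divides g" if "x \<in> X" for x using that by (simp add: X_def)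
        show "x \<in> X" if "x \<in> carrier M" "y \<in> X" "x divides y" for x y
          using that divides_trans unfolding X_def by blast
        fix x s t k assume x: "x \<in> carrier M" "s \<in> A" "t \<in> A" "s \<noteq> t" "m s t = enat k" "x \<otimes> s \<in> X" "x \<otimes> t \<in> X"
        have *: "(x \<otimes> gen_lcm s t k) divides e" if e: "e \<in> carrier M" "(x \<otimes> s) divides e" "(x \<otimes> t) divides e" for e
          by (rule gen_lcm_divides[OF x(1) e(1) x(2,3,4) e(2,3)]) (simp add: x(5))
        show "x \<otimes> gen_lcm s t k \<in> X"
          using *[of g] *[of d] x(6,7) g d gen_lcm_closed[OF x(2,3)] x(1) unfolding X_def by blast
      qed
      then obtain h where h: "h \<in> X" "\<forall>x\<in>X. x divides h" by blast
      have "a \<in> X" "b \<in> X" using abc g d by (auto simp: X_def)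
      then have "?U h" using h by (auto simp: X_def)
      then have "word_length g \<le> word_length h" by (rule gmin)
      moreover have "h divides g" "h \<in> carrier M" "h divides d" using h(1) by (auto simp: X_def)
      ultimately show ?thesis using divides_norm_eq[of h g] by simp
    qed
    then have "g lcmof a b" using g by (simp add: islcm_def)
    then show ?thesis using g by blast
  qed
  then show ?thesis
    unfolding left_preGarside_def atomic_monoid_def
    using monoid_axioms word_length_norm left_cancel by blast
qed

section \<open>Deleting and restricting generators of an Artin monoid\<close>

text \<open>Deleting one letter from the two sides of a braid relation of even length leaves the same power of the
other letter on both sides. For odd length the exponents would differ by one.\<close>

lemma eval_filter_braid:
  assumes "u \<approx> v" "\<And>a b k. a \<in> A - T \<Longrightarrow> b \<in> A \<inter> T \<Longrightarrow> m a b = enat k \<Longrightarrow> even k"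
  shows "filter (\<lambda>t. t \<in> T) u \<approx> filter (\<lambda>t. t \<in> T) v"
  using assms(1)
proof (induction rule: pres_cong.induct)
  case (rel l r)
  then obtain a b k where ab: "l = alt_word a b k" "r = alt_word b a k" "a \<in> A" "b \<in> A" "m a b = enat k"
    by (auto simp: artin_relations_def)
  have both: "filter (\<lambda>t. t \<in> T) (alt_word c d j) = alt_word c d j" if "c \<in> T" "d \<in> T" for c d j
    using that set_alt_word_subset[of c d j] by (intro filter_True) blast
  have none: "filter (\<lambda>t. t \<in> T) (alt_word c d j) = []" if "c \<notin> T" "d \<notin> T" for c d j
    using that set_alt_word_subset[of c d j] by (intro filter_False) blast
  have one: "filter (\<lambda>t. t \<in> T) (alt_word c d (2 * j)) = replicate j d \<and>
      filter (\<lambda>t. t \<in> T) (alt_word d c (2 * j)) = replicate j d" if "c \<notin> T" "d \<in> T" for c d j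
    by (induction j) (simp_all add: that)
  show ?case
  proof (cases "a \<in> T \<longleftrightarrow> b \<in> T")
    case True
    then show ?thesis using both[of a b k] both[of b a k] none[of a b k] none[of b a k] ab braid_alt[OF ab(3,4,5)]
      by (cases "a \<in> T") (auto intro: pres_cong.refl)
  next
    case False
    have "even k" using assms(2)[of a b k] assms(2)[of b a k] ab m_sym[OF ab(3,4)] False by auto
    then obtain j where "k = 2 * j" by (rule evenE)
    then have "filter (\<lambda>t. t \<in> T) l = filter (\<lambda>t. t \<in> T) r" using one[of a b j] one[of b a j] ab False by auto
    moreover have "filter (\<lambda>t. t \<in> T) l \<in> lists A" using rel by auto
    ultimately show ?thesis by (simp add: pres_cong.refl)
  qed
next
  case (refl w)
  then show ?case by (auto intro: pres_cong.refl)
next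
  case (sym u v)
  then show ?case by (blast intro: pres_cong.sym)
next
  case (trans u v w)
  then show ?case by (blast intro: pres_cong.trans)
next
  case (mult u v u' v')
  then show ?case by (simp add: pres_cong.mult)
qed

text \<open>Apply the killing power of \<open>\<phi>\<close> to a braid relation of odd length between \<open>a\<close> and \<open>b\<close>: what remains says that two
consecutive powers of the image of \<open>b\<close> agree, so this image has length \<open>0\<close>.\<close>

lemma S1_odd_neighbour:
  assumes End: "\<phi> \<in> monoid_End M" and a: "a \<in> S1 M \<phi>" and b: "b \<in> A" and k: "m a b = enat k" "odd k"
  shows "b \<in> S1 M \<phi>"
proof -
  let ?f = "\<phi> ^^ n_index M \<phi>"
  have fE: "?f \<in> monoid_End M" by (rule End_funpow[OF End])
  have aA: "a \<in> A" and fa: "?f a = \<one>" using a by (auto simp: S1_def atoms_eq)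
  have bc: "?f b \<in> carrier M" using End_closed[OF fE] b gen_carrier by blast
  obtain j where j: "k = 2 * j + 1" using k(2) by (rule oddE)
  have ev: "?f (word_eval M w) = word_eval M (map ?f w)" if "w \<in> lists A" for w
    by (rule End_word_eval[OF monoid_axioms fE lists_subsetD[OF gen_carrier that]])
  have "alt_word a b k \<approx> alt_word b a k" by (rule braid_alt[OF aA b k(1)])
  then have "word_eval M (alt_word a b k) = word_eval M (alt_word b a k)"
    using eval_eq_iff[OF alt_word_in_lists[OF aA b] alt_word_in_lists[OF b aA]] by simp
  then have eq: "word_eval M (alt_word \<one> (?f b) k) = word_eval M (alt_word (?f b) \<one> k)"
    using ev[OF alt_word_in_lists[OF aA b], of k] ev[OF alt_word_in_lists[OF b aA], of k]
    by (simp only: map_alt_word fa)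
  have len: "word_length (word_eval M (alt_word \<one> (?f b) (2 * i))) = i * word_length (?f b) \<and>
      word_eval M (alt_word \<one> (?f b) (2 * i)) \<in> carrier M \<and>
      word_length (word_eval M (alt_word (?f b) \<one> (2 * i))) = i * word_length (?f b) \<and>
      word_eval M (alt_word (?f b) \<one> (2 * i)) \<in> carrier M" for i
    by (induction i) (simp_all add: norm_one bc word_length_mult)
  have "word_eval M (alt_word \<one> (?f b) k) = word_eval M (alt_word (?f b) \<one> (2 * j))"
    using len[of j] by (simp add: j)
  moreover have "word_eval M (alt_word (?f b) \<one> k) = ?f b \<otimes> word_eval M (alt_word \<one> (?f b) (2 * j))"
    by (simp add: j)
  ultimately have "?f b \<otimes> word_eval M (alt_word \<one> (?f b) (2 * j)) = word_eval M (alt_word (?f b) \<one> (2 * j))"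
    using eq by (simp only:)
  then have "word_length (?f b) + word_length (word_eval M (alt_word \<one> (?f b) (2 * j)))
      = word_length (word_eval M (alt_word (?f b) \<one> (2 * j)))"
    using word_length_mult[OF bc] len[of j] by metis
  then have "word_length (?f b) = 0" using len[of j] by simp
  then have "?f b = \<one>" using norm_eq_0_iff bc by blast
  then show ?thesis using b by (simp add: S1_def atoms_eq)
qed

lemma artin_pi_well_defined:
  assumes End: "\<phi> \<in> monoid_End M"
  shows "pi_well_defined M (S2 M \<phi>)"
  unfolding pi_well_defined_def
proof (intro ballI impI)
  fix u v assume uv: "u \<in> lists (atoms M)" "v \<in> lists (atoms M)" "word_eval M u = word_eval M v"
  then have "u \<approx> v" using eval_eq_iff by (simp add: atoms_eq)
  then have "pi_word (S2 M \<phi>) u \<approx> pi_word (S2 M \<phi>) v"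
    unfolding pi_word_def
  proof (rule eval_filter_braid)
    fix a b k assume "a \<in> A - S2 M \<phi>" "b \<in> A \<inter> S2 M \<phi>" "m a b = enat k"
    then show "even k" using S1_odd_neighbour[OF End, of a b k] by (auto simp: S2_def atoms_eq)
  qed
  then show "word_eval M (pi_word (S2 M \<phi>) u) = word_eval M (pi_word (S2 M \<phi>) v)"
    using eval_eq_iff braid_in_lists[of "pi_word (S2 M \<phi>) u" "pi_word (S2 M \<phi>) v"] by simp
qed

text \<open>Both sides of a braid relation contain the same letters, because \<open>m a b \<ge> 2\<close> for \<open>a \<noteq> b\<close>. So a
derivation that starts in \<open>T\<close> never leaves \<open>T\<close>.\<close>

lemma braid_restrict:
  assumes "u \<approx> v"
  shows "set u = set v \<and> (\<forall>T. T \<subseteq> A \<longrightarrow> set u \<subseteq> T \<longrightarrow> pres_cong T (artin_relations T m) u v)"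
  using assms
proof (induction rule: pres_cong.induct)
  case (rel l r)
  then obtain a b k where ab: "l = alt_word a b k" "r = alt_word b a k" "a \<in> A" "b \<in> A" "m a b = enat k"
    by (auto simp: artin_relations_def)
  show ?case
  proof (cases "a = b")
    case True
    then show ?thesis using ab by (auto intro: pres_cong.refl)
  next
    case False
    then have "k \<ge> 2" using m_enat_ge2 ab by blast
    then obtain j where j: "k = Suc (Suc j)" by (metis One_nat_def Suc_1 Suc_le_D Suc_le_mono)
    have set: "set (alt_word c d k) = {c, d}" for c d :: 'a
      using set_alt_word_subset[of c d k] by (auto simp: j)
    have "pres_cong T (artin_relations T m) l r" if "set l \<subseteq> T" for T
    proof (rule pres_cong.rel)
      have "set l = {a, b}" using set ab(1) by (simp only:)
      then have "a \<in> T" "b \<in> T" using that by simp_all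
      then show "(l, r) \<in> artin_relations T m" "l \<in> lists T" "r \<in> lists T"
        using ab alt_word_in_lists[of _ T] by (auto simp: artin_relations_def)
    qed
    then show ?thesis using set ab by auto
  qed
next
  case (refl w)
  then show ?case by (auto intro: pres_cong.refl)
next
  case (sym u v)
  then show ?case by (blast intro: pres_cong.sym)
next
  case (trans u v w)
  then show ?case by (blast intro: pres_cong.trans)
next
  case (mult u v u' v')
  then show ?case by (auto intro!: pres_cong.mult)
qed

lemma braid_set: "u \<approx> v \<Longrightarrow> set u = set v"
  using braid_restrict by blast

theorem artin_parabolic:
  assumes T: "T \<subseteq> A"
  shows "artin_on (M\<lparr>carrier := word_eval M ` lists T\<rparr>) T m"
  unfolding artin_on_def
proof (intro conjI ballI)
  let ?P = "M\<lparr>carrier := word_eval M ` lists T\<rparr>"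
  have Tc: "T \<subseteq> carrier M" using T gen_carrier by (rule subset_trans)
  show "monoid ?P"
    by (rule submonoid.submonoid_is_monoid[OF submonoid_generated[OF Tc] monoid_axioms])
  show "finite T" by (rule finite_subset[OF T finite_gen])
  show "T \<subseteq> carrier ?P"
  proof
    fix t assume t: "t \<in> T"
    then have "word_eval M [t] = t" using Tc by auto
    then show "t \<in> carrier ?P" using t by (auto intro!: image_eqI[of _ _ "[t]"])
  qed
  show "coxeter_matrix T m" using coxeter T unfolding coxeter_matrix_def by blast
  show "carrier ?P = word_eval ?P ` lists T" by simp
  fix u v assume uv: "u \<in> lists T" "v \<in> lists T"
  have uvA: "u \<in> lists A" "v \<in> lists A" by (rule lists_subsetD[OF T uv(1)], rule lists_subsetD[OF T uv(2)])
  show "word_eval ?P u = word_eval ?P v \<longleftrightarrow> pres_cong T (artin_relations T m) u v"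
  proof
    assume "word_eval ?P u = word_eval ?P v"
    then have "u \<approx> v" using eval_eq_iff[OF uvA] by simp
    moreover have "set u \<subseteq> T" using uv(1) by auto
    ultimately show "pres_cong T (artin_relations T m) u v" using braid_restrict T by blast
  next
    assume "pres_cong T (artin_relations T m) u v"
    then have "pres_cong A (artin_relations A m) (map id u) (map id v)"
      by (rule artin_cong_map) (use T in auto)
    then show "word_eval ?P u = word_eval ?P v" using eval_eq_iff[OF uvA] by simp
  qed
qed

end

section \<open>Monoids with alternating least common multiples\<close>

text \<open>Two words with the same value and first letters \<open>a \<noteq> b\<close> represent a common multiple of \<open>a\<close> and \<open>b\<close>, so
one can rewrite each of them, by induction on the norm, into a word that begins with the corresponding side
of the relation between \<open>a\<close> and \<open>b\<close>. The entry of the Coxeter matrix is the number of factors of the lcm, or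
\<open>\<infinity>\<close> if there is no common multiple.\<close>

lemma artin_on_if_alternating_lcms:
  assumes pG: "left_preGarside F" and D: "finite D" "D \<subseteq> carrier F" "\<one>\<^bsub>F\<^esub> \<notin> D"
    and gen: "carrier F = word_eval F ` lists D"
    and alt: "\<And>a b c. a \<in> D \<Longrightarrow> b \<in> D \<Longrightarrow> a \<noteq> b \<Longrightarrow> c \<in> carrier F \<Longrightarrow> a divides\<^bsub>F\<^esub> c \<Longrightarrow> b divides\<^bsub>F\<^esub> c \<Longrightarrow>
      \<exists>k\<ge>2. word_eval F (alt_word a b k) = word_eval F (alt_word b a k) \<and>
        (\<forall>c\<in>carrier F. a divides\<^bsub>F\<^esub> c \<longrightarrow> b divides\<^bsub>F\<^esub> c \<longrightarrow> word_eval F (alt_word a b k) divides\<^bsub>F\<^esub> c)"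
  shows "\<exists>m. artin_on F D m"
proof -
  note pGD = left_preGarsideD[OF pG]
  obtain \<nu> where "normed_monoid F \<nu>" using left_preGarside_normed[OF pG] .
  then interpret normed_monoid F \<nu> .
  define Q where "Q a b k \<longleftrightarrow> k \<ge> 2 \<and> word_eval F (alt_word a b k) = word_eval F (alt_word b a k) \<and>
        (\<forall>c\<in>carrier F. a divides\<^bsub>F\<^esub> c \<longrightarrow> b divides\<^bsub>F\<^esub> c \<longrightarrow> word_eval F (alt_word a b k) divides\<^bsub>F\<^esub> c)"
    for a b k
  have Qsym: "Q a b = Q b a" for a b by (rule ext) (auto simp: Q_def)
  define m where "m a b = (if a = b then 1 else if \<exists>k. Q a b k then enat (LEAST k. Q a b k) else \<infinity>)" for a b
  have mQ: "Q a b k" if "a \<noteq> b" "m a b = enat k" for a b k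
    using that LeastI_ex[of "Q a b"] by (auto simp: m_def split: if_splits)
  have "coxeter_matrix D m"
    unfolding coxeter_matrix_def
  proof (intro conjI ballI impI)
    show "m a b = m b a" for a b unfolding m_def Qsym[of a b] by (simp add: eq_commute)
    show "m a a = 1" for a by (simp add: m_def)
    show "2 \<le> m a b" if "a \<noteq> b" for a b
    proof (cases "m a b")
      case (enat k)
      then have "k \<ge> 2" using mQ[OF that] by (simp add: Q_def)
      then show ?thesis using enat by (simp add: numeral_eq_enat)
    qed simp
  qed
  then interpret coxeter D m by (rule coxeter.intro)
  have DC: "lists D \<subseteq> lists (carrier F)" using D(2) by (rule lists_mono)
  have closed: "word_eval F w \<in> carrier F" if "w \<in> lists D" for w
    using subsetD[OF DC that] by (rule word_eval_closed)
  have app: "word_eval F (u @ v) = word_eval F u \<otimes>\<^bsub>F\<^esub> word_eval F v" if "u \<in> lists D" "v \<in> lists D" for u v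
    using subsetD[OF DC that(1)] subsetD[OF DC that(2)] by (rule word_eval_append)
  have sound: "word_eval F u = word_eval F v" if "pres_cong D (artin_relations D m) u v" for u v
    using that
  proof (induction rule: pres_cong.induct)
    case (rel l r)
    then obtain a b k where ab: "l = alt_word a b k" "r = alt_word b a k" "m a b = enat k"
      by (auto simp: artin_relations_def)
    then show ?case using mQ[of a b k] by (cases "a = b") (auto simp: Q_def)
  next
    case (mult u v u' v')
    then show ?case using app pres_cong_in_lists by metis
  qed auto
  have complete: "pres_cong D (artin_relations D m) u v"
    if "u \<in> lists D" "v \<in> lists D" "word_eval F u = word_eval F v" for u v
    using that
  proof (induction "\<nu> (word_eval F u)" arbitrary: u v rule: less_induct)
    case less
    have nil: "w = []" if "w \<in> lists D" "word_eval F w = \<one>\<^bsub>F\<^esub>" for w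
      using word_eval_eq_one[OF subsetD[OF DC that(1)] that(2)] that(1) D(3) by (cases w) auto
    show ?case
    proof (cases "u = [] \<or> v = []")
      case True
      then have "word_eval F u = \<one>\<^bsub>F\<^esub>" "word_eval F v = \<one>\<^bsub>F\<^esub>" using less.prems(3) by auto
      then have "u = []" "v = []" using nil less.prems(1,2) by simp_all
      then show ?thesis by (simp add: pres_cong.refl)
    next
      case False
      then obtain a x b y where uv: "u = a # x" "v = b # y" by (meson neq_Nil_conv)
      have D': "a \<in> D" "b \<in> D" "x \<in> lists D" "y \<in> lists D" using less.prems uv by auto
      have c: "a \<in> carrier F" "b \<in> carrier F" "word_eval F x \<in> carrier F" "word_eval F y \<in> carrier F"
        using D' D(2) closed by auto
      have pos: "\<nu> a > 0" "\<nu> b > 0" using norm_pos D' D(3) c by metis+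
      let ?z = "word_eval F u"
      have z: "?z = a \<otimes>\<^bsub>F\<^esub> word_eval F x" "?z = b \<otimes>\<^bsub>F\<^esub> word_eval F y"
        using less.prems(3) by (simp_all add: uv)
      have smaller: "\<nu> (word_eval F x) < \<nu> ?z" "\<nu> (word_eval F y) < \<nu> ?z"
        using norm_mult_ge[OF c(1,3)] norm_mult_ge[OF c(2,4)] pos unfolding z(1)[symmetric] z(2)[symmetric] by simp_all
      have zc: "?z \<in> carrier F" using closed less.prems(1) by blast
      show ?thesis
      proof (cases "a = b")
        case True
        then have "word_eval F x = word_eval F y" using z pGD(3)[OF c(3,4,1)] by simp
        then have "pres_cong D (artin_relations D m) x y" by (rule less.hyps[OF smaller(1) D'(3,4)])
        then show ?thesis using braid_Cons[OF D'(1)] uv True by simp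
      next
        case False
        have dz: "a divides\<^bsub>F\<^esub> ?z" "b divides\<^bsub>F\<^esub> ?z" using z c unfolding factor_def by blast+
        have "\<exists>k. Q a b k" using alt[OF D'(1,2) False zc dz] unfolding Q_def by blast
        then obtain k where k: "m a b = enat k" using False by (simp add: m_def)
        have kb: "m b a = enat k" using k m_sym D' by simp
        have "word_eval F (alt_word a b k) divides\<^bsub>F\<^esub> ?z"
          using mQ[OF False k] zc dz unfolding Q_def by blast
        then obtain r where r: "r \<in> carrier F" "?z = word_eval F (alt_word a b k) \<otimes>\<^bsub>F\<^esub> r"
          by (auto simp: factor_def)
        obtain w where w: "w \<in> lists D" "r = word_eval F w" using r(1) unfolding gen by blast
        have part: "pres_cong D (artin_relations D m) (a' # x') (alt_word a' b' k @ w)"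
          if ab': "a' \<in> D" "b' \<in> D" "a' \<noteq> b'" "m a' b' = enat k" and x': "x' \<in> lists D" "?z = a' \<otimes>\<^bsub>F\<^esub> word_eval F x'"
            "\<nu> (word_eval F x') < \<nu> ?z" and e: "?z = word_eval F (alt_word a' b' k) \<otimes>\<^bsub>F\<^esub> r" for a' b' x'
        proof -
          have alt': "alt_word a' b' k = a' # alt_word b' a' (k - 1)" by (rule alt_word_Cons_pred[OF ab'])
          have altD': "alt_word b' a' (k - 1) \<in> lists D" by (rule alt_word_in_lists[OF ab'(2,1)])
          have ac: "a' \<in> carrier F" using ab'(1) D(2) by blast
          have rest: "alt_word b' a' (k - 1) @ w \<in> lists D" using altD' w(1) by simp
          have "?z = a' \<otimes>\<^bsub>F\<^esub> word_eval F (alt_word b' a' (k - 1) @ w)"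
            unfolding app[OF altD' w(1)] using e ac closed[OF altD'] closed[OF w(1)]
            by (simp add: alt' w(2) m_assoc)
          then have "word_eval F x' = word_eval F (alt_word b' a' (k - 1) @ w)"
            using pGD(3)[OF closed[OF x'(1)] closed[OF rest] ac] x'(2) by simp
          then have "pres_cong D (artin_relations D m) x' (alt_word b' a' (k - 1) @ w)"
            by (rule less.hyps[OF x'(3) x'(1) rest])
          then show ?thesis using braid_Cons[OF ab'(1)] alt' by simp
        qed
        have "word_eval F (alt_word a b k) = word_eval F (alt_word b a k)"
          using mQ[OF False k] by (simp add: Q_def)
        then have e': "?z = word_eval F (alt_word b a k) \<otimes>\<^bsub>F\<^esub> r" using r(2) by simp
        have 1: "pres_cong D (artin_relations D m) u (alt_word a b k @ w)"
          using part[OF D'(1,2) False k D'(3) z(1) smaller(1) r(2)] uv by simp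
        have 2: "pres_cong D (artin_relations D m) v (alt_word b a k @ w)"
          using part[OF D'(2,1) False[symmetric] kb D'(4) z(2) smaller(2) e'] uv by simp
        have 3: "pres_cong D (artin_relations D m) (alt_word a b k @ w) (alt_word b a k @ w)"
          by (rule braid_append_right[OF w(1) braid_alt[OF D'(1,2) k]])
        show ?thesis by (rule pres_cong.trans[OF 1 pres_cong.trans[OF 3 pres_cong.sym[OF 2]]])
      qed
    qed
  qed
  have "artin_on F D m"
    unfolding artin_on_def
    using pGD(1) D(1,2) gen coxeter sound complete by blast
  then show ?thesis by blast
qed

section \<open>Fixed points of automorphisms of finite order of Artin monoids\<close>

context finite_order_End
begin

lemma End_inverse: "x \<in> carrier M \<Longrightarrow> (\<phi> ^^ (N - 1)) (\<phi> x) = x"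
  using order[of x] N_pos by (cases N) (simp_all add: funpow_swap1)

lemma End_atoms: 
  assumes "s \<in> atoms M"
  shows "\<phi> s \<in> atoms M"
proof -
  have sc: "s \<in> carrier M" "s \<noteq> \<one>" using assms by (auto simp: atoms_def)
  let ?g = "\<phi> ^^ (N - 1)"
  have g: "?g \<in> monoid_End M" by (rule End_funpow[OF End])
  have g_one: "x = \<one>" if "x \<in> carrier M" "?g x = \<one>" for x
  proof -
    have "\<phi> (?g x) = x" using order[OF that(1)] N_pos by (cases N) simp_all
    then show ?thesis using that(2) End_one[OF End] by simp
  qed
  have "b = \<one> \<or> c = \<one>" if bc: "b \<in> carrier M" "c \<in> carrier M" "\<phi> s = b \<otimes> c" for b c
  proof -
    have "s = ?g b \<otimes> ?g c" using End_inverse[OF sc(1)] End_mult[OF g bc(1,2)] bc(3) by simp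
    then have "?g b = \<one> \<or> ?g c = \<one>" using assms End_closed[OF g] bc(1,2) unfolding atoms_def by blast
    then show ?thesis using g_one bc(1,2) by blast
  qed
  moreover have "\<phi> s \<noteq> \<one>" using End_inverse[OF sc(1)] End_one[OF g] sc(2) by auto
  ultimately show ?thesis using End_closed[OF End sc(1)] unfolding atoms_def by blast
qed

lemma orbit_atoms: "s \<in> atoms M \<Longrightarrow> orbit \<phi> s \<subseteq> atoms M"
proof -
  assume s: "s \<in> atoms M"
  have "(\<phi> ^^ i) s \<in> atoms M" for i using s End_atoms by (induction i) simp_all
  then show ?thesis by (auto simp: orbit_def)
qed

lemma orbit_sym:
  assumes "s \<in> carrier M" "t \<in> orbit \<phi> s"
  shows "s \<in> orbit \<phi> t"
proof -
  obtain i where i: "t = (\<phi> ^^ i) s" using assms(2) by (auto simp: orbit_def)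
  have "i + (N - 1) * i = N * i" using N_pos by (cases N) simp_all
  then have "(\<phi> ^^ ((N - 1) * i)) t = (\<phi> ^^ (N * i)) s"
    unfolding i by (metis add.commute comp_apply funpow_add)
  also have "\<dots> = s" using funpow_fixed[of "\<phi> ^^ N" s i] order[OF assms(1)] by (simp add: funpow_mult mult.commute)
  finally show ?thesis unfolding orbit_def by (metis rangeI)
qed

lemma orbit_trans: "t \<in> orbit \<phi> s \<Longrightarrow> u \<in> orbit \<phi> t \<Longrightarrow> u \<in> orbit \<phi> s"
proof -
  assume "t \<in> orbit \<phi> s" "u \<in> orbit \<phi> t"
  then obtain i j where "u = (\<phi> ^^ j) ((\<phi> ^^ i) s)" by (auto simp: orbit_def)
  then have "u = (\<phi> ^^ (j + i)) s" by (simp add: funpow_add)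
  then show ?thesis by (auto simp: orbit_def)
qed

end

context artin_in
begin

lemma span_factors:
  assumes "x \<in> carrier M" "y \<in> carrier M" "x \<otimes> y \<in> word_eval M ` lists I" "I \<subseteq> A"
  shows "x \<in> word_eval M ` lists I" "y \<in> word_eval M ` lists I"
proof -
  obtain u where u: "u \<in> lists A" "x = word_eval M u" using word_of assms(1) .
  obtain v where v: "v \<in> lists A" "y = word_eval M v" using word_of assms(2) .
  obtain w where w: "w \<in> lists I" "x \<otimes> y = word_eval M w" using assms(3) by blast
  have wA: "w \<in> lists A" by (rule lists_subsetD[OF assms(4) w(1)])
  have "u @ v \<approx> w" using eval_eq_iff[of "u @ v" w] u v w(2) wA eval_append by simp
  then have "set (u @ v) = set w" by (rule braid_set)
  then have "u \<in> lists I" "v \<in> lists I" using w(1) by auto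
  then show "x \<in> word_eval M ` lists I" "y \<in> word_eval M ` lists I" using u v by blast+
qed

text \<open>The squarefree divisors of \<open>c\<close> with letters in \<open>I\<close> have a greatest element, since they are closed under
lcms of generators. It is an upper bound of \<open>I\<close>, so the least upper bound divides it and inherits both
properties.\<close>

lemma lub_squarefree:
  assumes I: "I \<subseteq> A" and c: "c \<in> carrier M" "\<And>s. s \<in> I \<Longrightarrow> s divides c" and L: "is_lub M I L"
  shows "\<exists>w\<in>lists I. squarefree w \<and> L = word_eval M w"
proof -
  define X where "X = {x \<in> carrier M. x divides c \<and> (\<exists>w\<in>lists I. squarefree w \<and> x = word_eval M w)}"
  have down: "x \<in> X" if xy: "x \<in> carrier M" "y \<in> X" "x divides y" for x y
  proof -
    obtain z where z: "z \<in> carrier M" "y = x \<otimes> z" using xy(3) by (auto simp: factor_def)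
    obtain w where w: "w \<in> lists I" "squarefree w" "y = word_eval M w" using xy(2) by (auto simp: X_def)
    obtain u where u: "u \<in> lists A" "x = word_eval M u" using word_of xy(1) .
    obtain v where v: "v \<in> lists A" "z = word_eval M v" using word_of z(1) .
    have wA: "w \<in> lists A" by (rule lists_subsetD[OF I w(1)])
    have eq: "w \<approx> u @ v" using eval_eq_iff[of w "u @ v"] u v z(2) w(3) wA eval_append by simp
    then have "set w = set (u @ v)" by (rule braid_set)
    then have "u \<in> lists I" using w(1) by auto
    moreover have "squarefree u" by (rule squarefree_prefix[OF squarefree_braid[OF w(2) eq]])
    moreover have "x divides c" using xy divides_trans unfolding X_def by blast
    ultimately show ?thesis using xy(1) u(2) unfolding X_def by blast
  qed
  have single: "s \<in> X" if "s \<in> I" for s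
  proof -
    have s: "s \<in> A" "s \<in> carrier M" using that I gen_carrier by auto
    have "[s] \<in> lists I" "s = word_eval M [s]" "squarefree [s]"
      using that s squarefree_singleton by simp_all
    then show ?thesis using c(2)[OF that] s(2) unfolding X_def by blast
  qed
  have "\<exists>g\<in>X. \<forall>x\<in>X. x divides g"
  proof (rule greatest_element[where c = c])
    show "X \<subseteq> carrier M" by (auto simp: X_def)
    have "squarefree []" unfolding squarefree_def using braid_length by fastforce
    moreover have "\<one> divides c" unfolding factor_def by (rule bexI[OF _ c(1)]) (simp add: c(1))
    ultimately show "\<one> \<in> X" unfolding X_def by (auto intro!: bexI[of _ "[]"])
    show "c \<in> carrier M" by fact
    show "x divides c" if "x \<in> X" for x using that by (simp add: X_def)
    show "x \<in> X" if "x \<in> carrier M" "y \<in> X" "x divides y" for x y by (rule down[OF that])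
    fix x s t k assume x: "x \<in> carrier M" "s \<in> A" "t \<in> A" "s \<noteq> t" "m s t = enat k" "x \<otimes> s \<in> X" "x \<otimes> t \<in> X"
    obtain w where w: "w \<in> lists A" "x = word_eval M w" using word_of x(1) .
    have sq: "squarefree (w @ [r]) \<and> w @ [r] \<in> lists I" if r: "r \<in> A" "x \<otimes> r \<in> X" for r
    proof -
      obtain v where v: "v \<in> lists I" "squarefree v" "x \<otimes> r = word_eval M v" using r(2) by (auto simp: X_def)
      have vA: "v \<in> lists A" by (rule lists_subsetD[OF I v(1)])
      have "word_eval M (w @ [r]) = x \<otimes> r" using eval_append[OF w(1), of "[r]"] w(2) r(1) gen_carrier by auto
      then have eq: "v \<approx> w @ [r]" using eval_eq_iff[of v "w @ [r]"] vA w(1) r(1) v(3) by simp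
      have "set v = set (w @ [r])" by (rule braid_set[OF eq])
      then show ?thesis using v(1) squarefree_braid[OF v(2) eq] by auto
    qed
    have sqs: "squarefree (w @ [s])" "squarefree (w @ [t])" and wI: "w @ [s] \<in> lists I" "w @ [t] \<in> lists I"
      using sq[OF x(2,6)] sq[OF x(3,7)] by blast+
    have "squarefree (w @ alt_word s t k)"
      by (rule squarefree_dihedral_right[OF sqs x(4)]) (simp add: x(5))
    moreover have "w @ alt_word s t k \<in> lists I"
      using wI alt_word_in_lists[of s I t k] by simp
    moreover have "x \<otimes> gen_lcm s t k = word_eval M (w @ alt_word s t k)"
      unfolding gen_lcm_def w(2) by (rule eval_append[OF w(1) alt_word_in_lists[OF x(2,3)], symmetric])
    moreover have "(x \<otimes> gen_lcm s t k) divides c"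
    proof (rule gen_lcm_divides[OF x(1) c(1) x(2,3,4)])
      show "(x \<otimes> s) divides c" "(x \<otimes> t) divides c" using x(6,7) by (simp_all add: X_def)
    qed (simp add: x(5))
    moreover have "x \<otimes> gen_lcm s t k \<in> carrier M" using x(1) gen_lcm_closed[OF x(2,3)] by simp
    ultimately show "x \<otimes> gen_lcm s t k \<in> X" unfolding X_def by blast
  qed
  then obtain g where g: "g \<in> X" "\<forall>x\<in>X. x divides g" by blast
  have "L divides g" using L g single unfolding is_lub_def X_def by blast
  then have "L \<in> X" using down[OF _ g(1)] L unfolding is_lub_def by blast
  then show ?thesis by (auto simp: X_def)
qed

end

locale artin_automorphism = artin_in M A m + finite_order_End M \<phi> N
  for M :: "('a, 'm) monoid_scheme" (structure) and A :: "'a set" and m and \<phi> and N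
begin

lemma orbit_lub_cases:
  assumes "d \<in> orbit_lubs M \<phi>"
  obtains s where "s \<in> A" "orbit \<phi> s \<subseteq> A" "is_lub M (orbit \<phi> s) d" "d \<in> Fix M \<phi>" "d \<noteq> \<one>"
    "d \<in> word_eval M ` lists (orbit \<phi> s)"
proof -
  obtain s where s: "s \<in> atoms M" "is_lub M (orbit \<phi> s) d" using assms by (auto simp: orbit_lubs_def)
  have sA: "s \<in> A" "orbit \<phi> s \<subseteq> A" using s orbit_atoms by (auto simp: atoms_eq)
  have dc: "d \<in> carrier M" using s(2) by (simp add: is_lub_def)
  have sd: "t divides d" if "t \<in> orbit \<phi> s" for t using s(2) that by (simp add: is_lub_def)
  have sc: "s \<in> carrier M" "s \<noteq> \<one>" using s(1) by (auto simp: atoms_def)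
  have "d \<noteq> \<one>" using divides_norm_le[OF sc(1) sd[OF self_in_orbit]] norm_pos[OF sc] norm_one by auto
  moreover have "d \<in> word_eval M ` lists (orbit \<phi> s)"
    using lub_squarefree[OF sA(2) dc sd s(2)] by blast
  ultimately show ?thesis using that sA s(2) assms orbit_lubs_subset_Fix by blast
qed

text \<open>Let \<open>d\<close> and \<open>e\<close> belong to the orbits of \<open>s\<close> and \<open>t\<close>. The least upper bound \<open>L\<close> of the union \<open>I\<close> of the
orbits is fixed, it is the lcm of \<open>d\<close> and \<open>e\<close>, and it is squarefree with letters in \<open>I\<close>. Hence after
any fixed prefix of \<open>L\<close> the remaining factor is divisible by \<open>d\<close> or by \<open>e\<close>, but never twice in a row by the
same one. So \<open>L\<close> is an alternating product starting with \<open>d\<close>, and also one starting with \<open>e\<close>.\<close>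

lemma orbit_lubs_alternating:
  assumes d: "d \<in> orbit_lubs M \<phi>" "e \<in> orbit_lubs M \<phi>" "d \<noteq> e"
    and c: "c \<in> Fix M \<phi>" "d divides c" "e divides c"
  shows "\<exists>k\<ge>2. word_eval M (alt_word d e k) = word_eval M (alt_word e d k) \<and>
        (\<forall>c\<in>carrier M. d divides c \<longrightarrow> e divides c \<longrightarrow> word_eval M (alt_word d e k) divides c)"
proof -
  obtain s where s: "s \<in> A" "orbit \<phi> s \<subseteq> A" "is_lub M (orbit \<phi> s) d" "d \<in> Fix M \<phi>" "d \<noteq> \<one>"
    "d \<in> word_eval M ` lists (orbit \<phi> s)" using orbit_lub_cases[OF d(1)] .
  obtain t where t: "t \<in> A" "orbit \<phi> t \<subseteq> A" "is_lub M (orbit \<phi> t) e" "e \<in> Fix M \<phi>" "e \<noteq> \<one>"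
    "e \<in> word_eval M ` lists (orbit \<phi> t)" using orbit_lub_cases[OF d(2)] .
  define I where "I = orbit \<phi> s \<union> orbit \<phi> t"
  have IA: "I \<subseteq> A" using s(2) t(2) by (simp add: I_def)
  have Ic: "I \<subseteq> carrier M" using IA gen_carrier by (rule subset_trans)
  have dec: "d \<in> carrier M" "e \<in> carrier M" using s(3) t(3) by (simp_all add: is_lub_def)
  have stc: "s \<in> carrier M" "t \<in> carrier M" using s(1) t(1) gen_carrier by auto
  have bound: "i divides x" if x: "x \<in> carrier M" "d divides x" "e divides x" and i: "i \<in> I" for x i
  proof -
    have "i divides d \<or> i divides e" using i s(3) t(3) unfolding I_def is_lub_def by blast
    moreover have "i \<in> carrier M" using i Ic by blast
    ultimately show ?thesis using divides_trans x(2,3) by blast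
  qed
  have cc: "c \<in> carrier M" using c(1) by (simp add: Fix_def)
  have finI: "finite I" using finite_orbit stc by (simp add: I_def)
  obtain L where L: "is_lub M I L"
    using finite_lub_exists[OF preGarside finI Ic cc bound[OF cc c(2,3)]] by blast
  have "\<exists>b\<in>I. \<phi> b = a" if "a \<in> I" for a
    using that orbit_preimage[OF stc(1)] orbit_preimage[OF stc(2)] unfolding I_def by blast
  then have LF: "L \<in> Fix M \<phi>" by (rule lub_of_invariant_fixed[OF Ic _ L])
  have Lc: "L \<in> carrier M" using L by (simp add: is_lub_def)
  have Lmin: "L divides x" if "x \<in> carrier M" "d divides x" "e divides x" for x
    using L bound[OF that] that(1) unfolding is_lub_def by blast
  have dL: "d divides L" "e divides L" using L s(3) t(3) unfolding is_lub_def I_def by blast+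
  obtain wL where wL: "wL \<in> lists I" "squarefree wL" "L = word_eval M wL"
    using lub_squarefree[OF IA cc bound[OF cc c(2,3)] L] by blast
  have wLA: "wL \<in> lists A" by (rule lists_subsetD[OF IA wL(1)])
  \<comment> \<open>The factor \<open>f\<close> ends with a letter of its orbit and, being an upper bound of the orbit, can be rewritten to begin with the same letter; so \<open>f f\<close> contains the square of a letter.\<close>
  have no_square: False
    if f: "f = d \<or> f = e" and xy: "x \<in> carrier M" "y \<in> carrier M" "L = x \<otimes> f \<otimes> (f \<otimes> y)" for f x y
  proof -
    obtain r where r: "orbit \<phi> r \<subseteq> A" "is_lub M (orbit \<phi> r) f" "f \<noteq> \<one>" "f \<in> word_eval M ` lists (orbit \<phi> r)"
      using f s t by blast
    obtain w where w: "w \<in> lists (orbit \<phi> r)" "f = word_eval M w" using r(4) by blast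
    have wA: "w \<in> lists A" by (rule lists_subsetD[OF r(1) w(1)])
    have "w \<noteq> []" using w(2) r(3) by auto
    then obtain w0 a where wa: "w = w0 @ [a]" by (metis append_butlast_last_id)
    have a: "a \<in> orbit \<phi> r" "a \<in> A" and w0: "w0 \<in> lists A" using w(1) wa r(1) wA by auto
    have "a divides f" using r(2) a(1) by (simp add: is_lub_def)
    then obtain z where z: "z \<in> carrier M" "f = a \<otimes> z" by (auto simp: factor_def)
    obtain v where v: "v \<in> lists A" "z = word_eval M v" using word_of z(1) .
    obtain ux where ux: "ux \<in> lists A" "x = word_eval M ux" using word_of xy(1) .
    obtain uy where uy: "uy \<in> lists A" "y = word_eval M uy" using word_of xy(2) .
    have av: "a # v \<in> lists A" using a(2) v(1) by simp
    have wl: "ux @ w \<in> lists A" "(a # v) @ uy \<in> lists A" "(ux @ w) @ ((a # v) @ uy) \<in> lists A"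
      using ux(1) wA av uy(1) by simp_all
    have f': "f = word_eval M (a # v)" using z(2) v(2) by simp
    have "word_eval M ((ux @ w) @ ((a # v) @ uy)) = (x \<otimes> f) \<otimes> (f \<otimes> y)"
      unfolding eval_append[OF wl(1,2)] eval_append[OF ux(1) wA] eval_append[OF av uy(1)]
      by (simp only: ux(2)[symmetric] w(2)[symmetric] f'[symmetric] uy(2)[symmetric])
    then have "word_eval M wL = word_eval M ((ux @ w) @ ((a # v) @ uy))" using xy(3) wL(3) by simp
    then have "wL \<approx> (ux @ w) @ ((a # v) @ uy)" using eval_eq_iff[OF wLA wl(3)] by simp
    then have "wL \<approx> (ux @ w0) @ [a, a] @ (v @ uy)" by (simp add: wa)
    then show False using wL(2) unfolding squarefree_def by blast
  qed
  \<comment> \<open>The first letter of the rest lies in one of the two orbits, and the fixed rest is then divisible by that whole orbit.\<close>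
  have next_factor: "\<exists>f\<in>{d, e}. \<exists>y'\<in>Fix M \<phi>. y = f \<otimes> y'"
    if xy: "x \<in> carrier M" "y \<in> Fix M \<phi>" "L = x \<otimes> y" "y \<noteq> \<one>" for x y
  proof -
    have yc: "y \<in> carrier M" using xy(2) by (simp add: Fix_def)
    have "x \<otimes> y \<in> word_eval M ` lists I" unfolding xy(3)[symmetric] wL(3) by (rule imageI[OF wL(1)])
    then have "y \<in> word_eval M ` lists I" by (rule span_factors(2)[OF xy(1) yc _ IA])
    then obtain w where w: "w \<in> lists I" "y = word_eval M w" by blast
    then obtain i v where iv: "w = i # v" using xy(4) by (cases w) auto
    have i: "i \<in> I" and "v \<in> lists I" using w(1) iv by auto
    then have "v \<in> lists A" by (simp add: lists_subsetD[OF IA])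
    then have "i divides y" using w(2) iv eval_closed unfolding factor_def by auto
    have ic: "i \<in> carrier M" using i Ic by blast
    have gen: "f divides y" if r: "r \<in> carrier M" "is_lub M (orbit \<phi> r) f" "i \<in> orbit \<phi> r" for r f
    proof -
      have "j divides y" if "j \<in> orbit \<phi> r" for j
        using orbit_bounded[OF ic xy(2) \<open>i divides y\<close>] orbit_trans[OF orbit_sym[OF r(1,3)] that] by blast
      then show ?thesis using r(2) yc unfolding is_lub_def by blast
    qed
    have "d divides y \<or> e divides y"
      using i gen[OF stc(1) s(3)] gen[OF stc(2) t(3)] unfolding I_def by blast
    then obtain f where f: "f \<in> {d, e}" "f divides y" by blast
    then have fF: "f \<in> Fix M \<phi>" using s(4) t(4) by blast
    have "f divides\<^bsub>M\<lparr>carrier := Fix M \<phi>\<rparr>\<^esub> y" using Fix_divides[OF preGarside End fF xy(2)] f(2) by simp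
    then obtain y' where "y' \<in> Fix M \<phi>" "y = f \<otimes> y'" by (auto simp: factor_def)
    then show ?thesis using f(1) by blast
  qed
  have alternating: "\<exists>k. y = word_eval M (alt_word g f k)"
    if "{f, g} = {d, e}" "x \<in> carrier M" "y \<in> Fix M \<phi>" "L = x \<otimes> f \<otimes> y" for f g x y
    using that
  proof (induction "word_length y" arbitrary: f g x y rule: less_induct)
    case less
    have yc: "y \<in> carrier M" using less.prems(3) by (simp add: Fix_def)
    have fg: "f \<in> {d, e}" "g \<in> {d, e}" "{g, f} = {d, e}" using less.prems(1) by blast+
    have fgc: "f \<in> carrier M" "g \<in> carrier M" using fg dec by blast+
    show ?case
    proof (cases "y = \<one>")
      case True
      then show ?thesis by (intro exI[of _ 0]) simp
    next
      case False
      have xf: "x \<otimes> f \<in> carrier M" using less.prems(2) fgc(1) by simp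
      obtain h y' where h: "h \<in> {d, e}" "y' \<in> Fix M \<phi>" "y = h \<otimes> y'"
        using next_factor[OF xf less.prems(3,4) False] by blast
      have y'c: "y' \<in> carrier M" using h(2) by (simp add: Fix_def)
      have "h \<noteq> f" using no_square[of f x y'] fg(1) less.prems(2,4) h(3) y'c by blast
      then have hg: "h = g" using h(1) less.prems(1) by blast
      have "g \<noteq> \<one>" using fg(2) s(5) t(5) by blast
      then have lt: "word_length y' < word_length y"
        using word_length_mult[OF fgc(2) y'c] norm_pos[OF fgc(2)] h(3) hg by simp
      have "L = x \<otimes> f \<otimes> g \<otimes> y'" using less.prems(4) h(3) hg m_assoc[OF xf fgc(2) y'c] by simp
      then obtain k where "y' = word_eval M (alt_word f g k)"
        using less.hyps[OF lt fg(3) xf h(2)] by blast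
      then have "y = word_eval M (alt_word g f (Suc k))" using h(3) hg by simp
      then show ?thesis by blast
    qed
  qed
  have whole: "\<exists>k. L = word_eval M (alt_word f g (Suc k))" if fg: "{f, g} = {d, e}" for f g
  proof -
    have f: "f \<in> {d, e}" using fg by blast
    then have fF: "f \<in> Fix M \<phi>" "f divides L" "f \<in> carrier M" using s(4) t(4) dL dec by blast+
    have "f divides\<^bsub>M\<lparr>carrier := Fix M \<phi>\<rparr>\<^esub> L" using Fix_divides[OF preGarside End fF(1) LF] fF(2) by simp
    then obtain y where y: "y \<in> Fix M \<phi>" "L = f \<otimes> y" by (auto simp: factor_def)
    then have "L = \<one> \<otimes> f \<otimes> y" using fF(3) by simp
    then obtain k where "y = word_eval M (alt_word g f k)" using alternating[OF fg one_closed y(1)] by blast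
    then have "L = word_eval M (alt_word f g (Suc k))" using y(2) by simp
    then show ?thesis by blast
  qed
  obtain k where k: "L = word_eval M (alt_word d e (Suc k))" using whole[of d e] by blast
  obtain l where l: "L = word_eval M (alt_word e d (Suc l))" using whole[of e d] by blast
  let ?a = "word_length d" and ?b = "word_length e"
  have len: "word_length (word_eval M (alt_word f g (2 * i))) = i * (word_length f + word_length g)"
    "word_length (word_eval M (alt_word f g (2 * i + 1))) = i * (word_length f + word_length g) + word_length f"
    if fg: "f \<in> carrier M" "g \<in> carrier M" for f g i
  proof -
    have alt_c: "word_eval M (alt_word f g j) \<in> carrier M" "word_eval M (alt_word g f j) \<in> carrier M" for j
      using word_eval_closed alt_word_in_lists[of f "carrier M" g j] alt_word_in_lists[of g "carrier M" f j] fg by simp_all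
    have even: "word_length (word_eval M (alt_word f g (2 * i))) = i * (word_length f + word_length g)"
      if "f \<in> carrier M" "g \<in> carrier M" "\<And>j. word_eval M (alt_word f g j) \<in> carrier M"
        "\<And>j. word_eval M (alt_word g f j) \<in> carrier M" for f g i
    proof (induction i)
      case (Suc i)
      have "alt_word f g (2 * Suc i) = f # g # alt_word f g (2 * i)" by simp
      then show ?case using Suc that by (simp add: word_length_mult)
    qed (simp add: norm_one)
    show "word_length (word_eval M (alt_word f g (2 * i))) = i * (word_length f + word_length g)"
      by (rule even[OF fg alt_c])
    have "alt_word f g (2 * i + 1) = f # alt_word g f (2 * i)" by simp
    then show "word_length (word_eval M (alt_word f g (2 * i + 1))) = i * (word_length f + word_length g) + word_length f"
      using even[OF fg(2,1) alt_c(2,1), of i] word_length_mult[OF fg(1) alt_c(2)] by (simp add: add.commute)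
  qed
  have pos: "?a > 0" "?b > 0" using norm_pos dec s(5) t(5) by blast+
  have grow: "p * (?a + ?b) + (?a + ?b) \<le> q * (?a + ?b)" if "p < q" for p q
    using mult_le_mono1[of "Suc p" q "?a + ?b"] that by simp
  \<comment> \<open>With \<open>a, b > 0\<close> the lengths of \<open>d\<close> and \<open>e\<close>, the two products have lengths \<open>p (a + b)\<close> or \<open>p (a + b) + a\<close>, and \<open>q (a + b)\<close> or \<open>q (a + b) + b\<close>; equality forces equal numbers of factors.\<close>
  have kl: "Suc k = Suc l"
  proof -
    have eq: "word_length (word_eval M (alt_word d e (Suc k))) = word_length (word_eval M (alt_word e d (Suc l)))"
      using k l by simp
    obtain p where p: "Suc k = 2 * p \<or> Suc k = 2 * p + 1" by (metis evenE oddE)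
    obtain q where q: "Suc l = 2 * q \<or> Suc l = 2 * q + 1" by (metis evenE oddE)
    have sw: "?b + ?a = ?a + ?b" by simp
    have K: "word_length (word_eval M (alt_word d e (Suc k))) = p * (?a + ?b) + (if Suc k = 2 * p then 0 else ?a)"
    proof (cases "Suc k = 2 * p")
      case True
      show ?thesis unfolding if_P[OF True] add_0_right unfolding True by (rule len(1)[OF dec])
    next
      case False
      then have odd: "Suc k = 2 * p + 1" using p by blast
      show ?thesis unfolding if_not_P[OF False] unfolding odd by (rule len(2)[OF dec])
    qed
    have L: "word_length (word_eval M (alt_word e d (Suc l))) = q * (?a + ?b) + (if Suc l = 2 * q then 0 else ?b)"
    proof (cases "Suc l = 2 * q")
      case True
      show ?thesis unfolding if_P[OF True] add_0_right unfolding True sw[symmetric] by (rule len(1)[OF dec(2,1)])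
    next
      case False
      then have odd: "Suc l = 2 * q + 1" using q by blast
      show ?thesis unfolding if_not_P[OF False] unfolding odd sw[symmetric] by (rule len(2)[OF dec(2,1)])
    qed
    have e': "p * (?a + ?b) + (if Suc k = 2 * p then 0 else ?a) = q * (?a + ?b) + (if Suc l = 2 * q then 0 else ?b)"
      using eq unfolding K L .
    have "p = q"
    proof (rule ccontr)
      assume "p \<noteq> q"
      then consider "p < q" | "q < p" by linarith
      then show False using grow[of p q] grow[of q p] e' pos by cases (auto split: if_splits)
    qed
    then show ?thesis using e' p q pos by (auto split: if_splits)
  qed
  then have L2: "word_eval M (alt_word d e (Suc k)) = word_eval M (alt_word e d (Suc k))" using k l by simp
  have "Suc k \<ge> 2"
  proof (rule ccontr)
    assume "\<not> Suc k \<ge> 2"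
    then have "k = 0" by simp
    then show False using L2 dec d(3) by simp
  qed
  moreover have "word_eval M (alt_word d e (Suc k)) divides x" if "x \<in> carrier M" "d divides x" "e divides x" for x
    using Lmin[OF that] k by simp
  ultimately show ?thesis using L2 by blast
qed

theorem artin_Fix: "artin_monoid (M\<lparr>carrier := Fix M \<phi>\<rparr>)"
proof -
  let ?F = "M\<lparr>carrier := Fix M \<phi>\<rparr>" and ?D = "orbit_lubs M \<phi>"
  have "\<exists>n. artin_on ?F ?D n"
  proof (rule artin_on_if_alternating_lcms)
    show "left_preGarside ?F" by (rule left_preGarside_Fix[OF preGarside End])
    show "finite ?D" by (rule finite_orbit_lubs) (simp add: atoms_eq finite_gen)
    show "?D \<subseteq> carrier ?F" using orbit_lubs_subset_Fix by simp
    have "\<one> \<notin> ?D"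
    proof
      assume "\<one> \<in> ?D"
      then show False by (rule orbit_lub_cases) blast
    qed
    then show "\<one>\<^bsub>?F\<^esub> \<notin> ?D" by simp
    show "carrier ?F = word_eval ?F ` lists ?D" using Fix_generated_by_orbit_lubs by simp
    fix a b c assume abc: "a \<in> ?D" "b \<in> ?D" "a \<noteq> b" "c \<in> carrier ?F" "a divides\<^bsub>?F\<^esub> c" "b divides\<^bsub>?F\<^esub> c"
    have F: "a \<in> Fix M \<phi>" "b \<in> Fix M \<phi>" "c \<in> Fix M \<phi>" using abc(1,2,4) orbit_lubs_subset_Fix by auto
    have FM: "Fix M \<phi> \<subseteq> carrier M" by (auto simp: Fix_def)
    note Fd = Fix_divides[OF preGarside End]
    obtain k where k: "k \<ge> 2" "word_eval M (alt_word a b k) = word_eval M (alt_word b a k)"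
        "\<forall>c\<in>carrier M. a divides c \<longrightarrow> b divides c \<longrightarrow> word_eval M (alt_word a b k) divides c"
      using orbit_lubs_alternating[OF abc(1,2,3) F(3)] abc(5,6) Fd F by blast
    have wF: "word_eval M (alt_word a b k) \<in> Fix M \<phi>"
      by (rule submonoid.word_eval_in_submonoid[OF submonoid_Fix[OF monoid_axioms End] alt_word_in_lists[OF F(1,2)]])
    have "\<forall>c\<in>carrier ?F. a divides\<^bsub>?F\<^esub> c \<longrightarrow> b divides\<^bsub>?F\<^esub> c \<longrightarrow> word_eval ?F (alt_word a b k) divides\<^bsub>?F\<^esub> c"
    proof (intro ballI impI)
      fix c assume c: "c \<in> carrier ?F" "a divides\<^bsub>?F\<^esub> c" "b divides\<^bsub>?F\<^esub> c"
      then have cF: "c \<in> Fix M \<phi>" by simp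
      then have "word_eval M (alt_word a b k) divides c"
        using k(3) c(2,3) Fd[OF F(1) cF] Fd[OF F(2) cF] FM by blast
      then show "word_eval ?F (alt_word a b k) divides\<^bsub>?F\<^esub> c" using Fd[OF wF cF] by simp
    qed
    then show "\<exists>k\<ge>2. word_eval ?F (alt_word a b k) = word_eval ?F (alt_word b a k) \<and>
        (\<forall>c\<in>carrier ?F. a divides\<^bsub>?F\<^esub> c \<longrightarrow> b divides\<^bsub>?F\<^esub> c \<longrightarrow> word_eval ?F (alt_word a b k) divides\<^bsub>?F\<^esub> c)"
      using k(1,2) by auto
  qed
  then show ?thesis using artin_on_imp_artin_monoid by blast
qed

end

section \<open>Fixed and periodic points\<close>

lemma Fix_Per_restrict:
  "Fix (M\<lparr>carrier := Per M \<phi>\<rparr>) \<phi> = Fix M \<phi>"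
proof -
  have "Fix M \<phi> \<subseteq> Per M \<phi>"
  proof
    fix x assume x: "x \<in> Fix M \<phi>"
    then have "x \<in> Fix M (\<phi> ^^ 1)" by (simp add: Fix_def)
    then show "x \<in> Per M \<phi>" unfolding Per_def by (intro UN_I[of 1]) simp_all
  qed
  moreover have "Per M \<phi> \<subseteq> carrier M" by (auto simp: Per_def Fix_def)
  ultimately show ?thesis by (auto simp: Fix_def)
qed

lemma finite_order_on_Per:
  assumes pG: "left_preGarside M" and End: "\<phi> \<in> monoid_End M" and N: "N \<ge> 1" "Per M \<phi> = Fix M (\<phi> ^^ N)"
  shows "finite_order_End (M\<lparr>carrier := Per M \<phi>\<rparr>) \<phi> N"
proof
  let ?P = "M\<lparr>carrier := Per M \<phi>\<rparr>"
  have EN: "\<phi> ^^ N \<in> monoid_End M" by (rule End_funpow[OF End])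
  show "left_preGarside ?P" unfolding N(2) by (rule left_preGarside_Fix[OF pG EN])
  have sub: "Per M \<phi> \<subseteq> carrier M" by (auto simp: Per_def Fix_def)
  have "\<phi> x \<in> Per M \<phi>" if "x \<in> Per M \<phi>" for x
  proof -
    have "x \<in> carrier M" "(\<phi> ^^ N) x = x" using that unfolding N(2) by (auto simp: Fix_def)
    then show ?thesis unfolding N(2) using End_closed[OF End] by (simp add: Fix_def funpow_swap1[symmetric])
  qed
  then show "\<phi> \<in> monoid_End ?P" using End sub by (auto simp: monoid_End_def hom_def Pi_iff subset_iff)
  show "1 \<le> N" by (rule N(1))
  show "(\<phi> ^^ N) x = x" if "x \<in> carrier ?P" for x
    using that N(2) by (simp add: Fix_def)
qed

lemma deletionI:
  assumes "fin_gen_monoid M" "additive_norm M \<nu>" "homogeneous_norm M \<nu>" "\<phi> \<in> monoid_End M"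
    "pi_well_defined M (S2 M \<phi>)"
  shows "deletion M \<nu> \<phi>"
proof -
  have "monoid M" "monoid_norm M \<nu>" using assms(1,2) by (auto simp: fin_gen_monoid_def additive_norm_def)
  then interpret normed_monoid M \<nu> by (simp add: normed_monoid_def normed_monoid_axioms_def)
  show ?thesis by unfold_locales (use assms finite_atoms in auto)
qed

lemma preGarside_Fix_Per:
  assumes End: "\<phi> \<in> monoid_End M" and fg: "fin_gen_monoid M" and pG: "left_preGarside M"
    and \<nu>: "additive_norm M \<nu>" "homogeneous_norm M \<nu>" and pi: "pi_well_defined M (S2 M \<phi>)"
  shows "fin_gen_monoid (M\<lparr>carrier := Fix M \<phi>\<rparr>)" "left_preGarside (M\<lparr>carrier := Fix M \<phi>\<rparr>)"
    "fin_gen_monoid (M\<lparr>carrier := Per M \<phi>\<rparr>)" "left_preGarside (M\<lparr>carrier := Per M \<phi>\<rparr>)"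
proof -
  interpret deletion M \<nu> \<phi> by (rule deletionI[OF fg \<nu> End pi])
  let ?P = "M\<lparr>carrier := Per M \<phi>\<rparr>"
  obtain N T where N: "N \<ge> 1" "T \<subseteq> atoms M" "Per M \<phi> = Fix M (\<phi> ^^ N)"
    "bij_betw (\<phi> ^^ N) (word_eval M ` lists T) (Per M \<phi>)" by (rule Per_structure)
  interpret fo: finite_order_End ?P \<phi> N by (rule finite_order_on_Per[OF pG End N(1,3)])
  have EN: "\<phi> ^^ N \<in> monoid_End M" by (rule End_funpow[OF End])
  have Tc: "T \<subseteq> carrier M" using N(2) atoms_carrier by (rule subset_trans)
  have PM: "monoid ?P" using left_preGarsideD(1)[OF fo.preGarside] .
  show fgP: "fin_gen_monoid ?P"
    unfolding fin_gen_monoid_def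
  proof (intro conjI exI[of _ "(\<phi> ^^ N) ` T"])
    show "monoid ?P" by (rule PM)
    show "finite ((\<phi> ^^ N) ` T)" using finite_subset[OF N(2) finite_atoms] by simp
    have Per: "Per M \<phi> = (\<phi> ^^ N) ` (word_eval M ` lists T)" using N(4) by (simp add: bij_betw_def)
    have ev: "(\<phi> ^^ N) (word_eval M w) = word_eval M (map (\<phi> ^^ N) w)" if "w \<in> lists T" for w
      by (rule End_word_eval[OF monoid_axioms EN lists_subsetD[OF Tc that]])
    have "(\<phi> ^^ N) ` T \<subseteq> Per M \<phi>"
    proof (rule image_subsetI)
      fix t assume t: "t \<in> T"
      then have "t = word_eval M [t]" "[t] \<in> lists T" using Tc by auto
      then show "(\<phi> ^^ N) t \<in> Per M \<phi>" unfolding Per by blast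
    qed
    then show "(\<phi> ^^ N) ` T \<subseteq> carrier ?P" by simp
    have "Per M \<phi> = word_eval M ` (map (\<phi> ^^ N) ` lists T)"
      unfolding Per image_image using ev by (intro image_cong HOL.refl)
    then show "carrier ?P = word_eval ?P ` lists ((\<phi> ^^ N) ` T)"
      by (simp add: lists_image)
  qed
  show "left_preGarside ?P" by (rule fo.preGarside)
  show "left_preGarside (M\<lparr>carrier := Fix M \<phi>\<rparr>)" by (rule left_preGarside_Fix[OF pG End])
  have "fin_gen_monoid (?P\<lparr>carrier := Fix ?P \<phi>\<rparr>)" by (rule fo.fin_gen_Fix[OF fgP])
  then show "fin_gen_monoid (M\<lparr>carrier := Fix M \<phi>\<rparr>)" by (simp add: Fix_Per_restrict)
qed

lemma artin_Fix_Per: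
  assumes End: "\<phi> \<in> monoid_End M" and art: "artin_monoid M"
  shows "artin_monoid (M\<lparr>carrier := Fix M \<phi>\<rparr>)" "artin_monoid (M\<lparr>carrier := Per M \<phi>\<rparr>)"
proof -
  obtain A m where "artin_on M A m" using artin_monoid_imp_artin_on[OF art] by blast
  then interpret artin_in M A m by (rule artin_inI)
  interpret del: deletion M word_length \<phi>
    by (rule deletionI[OF fin_gen word_length_additive word_length_homogeneous End artin_pi_well_defined[OF End]])
  let ?P = "M\<lparr>carrier := Per M \<phi>\<rparr>"
  obtain N T where N: "N \<ge> 1" "T \<subseteq> atoms M" "Per M \<phi> = Fix M (\<phi> ^^ N)"
    "bij_betw (\<phi> ^^ N) (word_eval M ` lists T) (Per M \<phi>)" by (rule del.Per_structure)
  have EN: "\<phi> ^^ N \<in> monoid_End M" by (rule End_funpow[OF End])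
  have foE: "finite_order_End ?P \<phi> N"
    by (rule finite_order_on_Per[OF artin_left_preGarside End N(1,3)])
  interpret fo: finite_order_End ?P \<phi> N by (rule foE)
  have TA: "T \<subseteq> A" using N(2) by (simp add: atoms_eq)
  have Tc: "T \<subseteq> carrier M" using TA gen_carrier by (rule subset_trans)
  let ?T = "M\<lparr>carrier := word_eval M ` lists T\<rparr>"
  show artP: "artin_monoid ?P"
  proof (rule artin_monoid_transfer[OF artin_parabolic[OF TA]])
    show "monoid ?P" by (rule left_preGarsideD(1)[OF fo.preGarside])
    show "bij_betw (\<phi> ^^ N) (carrier ?T) (carrier ?P)" using N(4) by simp
    then have cl: "(\<phi> ^^ N) x \<in> carrier ?P" if "x \<in> carrier ?T" for x using that by (meson bij_betwE)
    have sub: "carrier ?T \<subseteq> carrier M" using submonoid.subset[OF submonoid_generated[OF Tc]] by simp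
    show "\<phi> ^^ N \<in> hom ?T ?P"
    proof (rule homI)
      show "(\<phi> ^^ N) x \<in> carrier ?P" if "x \<in> carrier ?T" for x by (rule cl[OF that])
      fix x y assume "x \<in> carrier ?T" "y \<in> carrier ?T"
      then have "x \<in> carrier M" "y \<in> carrier M" using sub by blast+
      then show "(\<phi> ^^ N) (x \<otimes>\<^bsub>?T\<^esub> y) = (\<phi> ^^ N) x \<otimes>\<^bsub>?P\<^esub> (\<phi> ^^ N) y" using End_mult[OF EN] by simp
    qed
    show "(\<phi> ^^ N) \<one>\<^bsub>?T\<^esub> = \<one>\<^bsub>?P\<^esub>" using End_one[OF EN] by simp
  qed
  obtain B n where "artin_on ?P B n" using artin_monoid_imp_artin_on[OF artP] by blast
  then interpret P: artin_in ?P B n by (rule artin_inI)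
  interpret aut: artin_automorphism ?P B n \<phi> N by unfold_locales
  have "artin_monoid (?P\<lparr>carrier := Fix ?P \<phi>\<rparr>)" by (rule aut.artin_Fix)
  then show "artin_monoid (M\<lparr>carrier := Fix M \<phi>\<rparr>)" by (simp add: Fix_Per_restrict)
qed

theorem theorem0p1:
  fixes M :: "('a, 'm) monoid_scheme" and \<phi> :: "'a \<Rightarrow> 'a" and \<nu> :: "'a \<Rightarrow> nat"
  assumes "\<phi> \<in> monoid_End M"
  shows "(fin_gen_monoid M \<and> left_preGarside M \<and> additive_norm M \<nu> \<and> homogeneous_norm M \<nu> \<and>
            pi_well_defined M (S2 M \<phi>) \<longrightarrow>
          (fin_gen_monoid (M\<lparr>carrier := Fix M \<phi>\<rparr>) \<and> left_preGarside (M\<lparr>carrier := Fix M \<phi>\<rparr>)) \<and>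
          (fin_gen_monoid (M\<lparr>carrier := Per M \<phi>\<rparr>) \<and> left_preGarside (M\<lparr>carrier := Per M \<phi>\<rparr>))) \<and>
         (artin_monoid M \<longrightarrow>
          artin_monoid (M\<lparr>carrier := Fix M \<phi>\<rparr>) \<and> artin_monoid (M\<lparr>carrier := Per M \<phi>\<rparr>))"
  using preGarside_Fix_Per[OF assms] artin_Fix_Per[OF assms] by blast

end
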